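(* Let $R$ be a Dedekind domain, let $\mathcal A$ be a fully additive hom-finite $R$-category and let $\mathfrak n=\operatorname{nil}\mathcal A$. (1) Let $A,B$ be torsion reduced objects of $\mathcal A$ and let $\alpha:A\to B$, $\beta:B\to A$ be morphisms such that $\beta\alpha\equiv a1_A \pmod{\mathfrak n}$ and $\alpha\beta\equiv a1_B\pmod{\mathfrak n}$ for some non-zero $a\in R$. If $\mathfrak p_1,\dots,\mathfrak p_r$ ($r\ge 1$) are all the prime ideals of $R$ containing $a$, then there are torsion reduced objects $A_1,\dots,A_r$ of $\mathcal A$ such that (a) $(A_i)_{\mathfrak p_i}\simeq A_{\mathfrak p_i}$, and $(A_i)_{\mathfrak q}\simeq B_{\mathfrak q}$ for every $\mathfrak q\in\max R$ with $\mathfrak q\neq\mathfrak p_i$; (b) $\bigoplus_{i=1}^r A_i\simeq A\oplus (r-1)B$. Moreover, for torsion reduced $A,B$, such $\alpha,\beta$ and $a$ exist if and only if $QA\simeq QB$. (2) Let $\mathfrak p_1,\dots,\mathfrak p_r$ be different maximal ideals of $R$, let $A_i$ ($1\le i\le r$) be a torsion reduced object of $\mathcal A_{\mathfrak p_i}$, let $B$ be a torsion reduced object of $\mathcal A$, and suppose $QA_i\simeq QB$ for all $i$. Then there is a torsion reduced object $A$ of $\mathcal A$ such that $A_{\mathfrak p_i}\simeq A_i$ for $1\le i\le r$ and $A_{\mathfrak q}\simeq B_{\mathfrak q}$ for every $\mathfrak q\in\max R$ with $\mathfrak q\notin\{\mathfrak p_1,\dots,\mathfrak p_r\}$. (3)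 Suppose that $\mathcal A$ is torsion free. Let $\mathfrak p_1,\dots,\mathfrak p_r$ be different maximal ideals of $R$, and let $\alpha\in\mathcal A(A,B)$ and $\beta_i\in\mathcal A_{\mathfrak p_i}(A_{\mathfrak p_i},B_{\mathfrak p_i})$ be such that $Q\beta_i=Q\alpha$ for all $i$. Then there is a morphism $\beta:A\to B$ such that $\beta_{\mathfrak p_i}=\beta_i$ for all $i$ and $\beta_{\mathfrak q}=\alpha_{\mathfrak q}$ for every $\mathfrak q\in\max R$ with $\mathfrak q\notin\{\mathfrak p_1,\dots,\mathfrak p_r\}$.
   Context: All categories are small and preadditive. A category is fully additive if it is additive and every idempotent endomorphism splits. For a commutative ring $R$, an $R$-category is a category whose Hom sets $\mathcal A(A,B)$ are $R$-modules with $R$-bilinear composition; it is hom-finite if all $\mathcal A(A,B)$ are finitely generated $R$-modules. Nilradical: a morphism $a\in\mathcal A(A,B)$ is essentially nilpotent if for every sequence $b_1,b_2,\dots$ in $\mathcal A(B,A)$ there is $n$ with $ab_1ab_2\cdots ab_na=0$; $\operatorname{nil}(A,B)$ is the set of these, and $\operatorname{nil}\mathcal A=\bigcup_{A,B}\operatorname{nil}(A,B)$, which is an ideal of $\mathcal A$. Let $R$ be a Dedekind domain with field of fractions $K$ and $\max R$ its set of maximal ideals. $\operatorname{tors}(A,B)$ is the torsion submodule of $\mathcal A(A,B)$. An object $A$ is torsion reduced if $\operatorname{tors}(A,A)\subseteq\operatorname{nil}(A,A)$. $\mathcal A$ is torsion free if all $\mathcal A(A,B)$ are torsion free $R$-modules.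 The same terms are used for $\mathcal A_{\mathfrak p}$ as an $R_{\mathfrak p}$-category. For a commutative $R$-algebra $S$, $S\otimes_R\mathcal A$ is the category with the same objects as $\mathcal A$ and morphisms $S\otimes_R\mathcal A(A,B)$. For a preadditive category $\mathcal C$, $\operatorname{add}\mathcal C$ is the (unique up to equivalence) fully additive category containing $\mathcal C$ as a full subcategory in which every object is a direct summand of a finite direct sum of objects of $\mathcal C$. Put $Q\mathcal A=\operatorname{add}(K\otimes_R\mathcal A)$ and $\mathcal A_{\mathfrak p}=\operatorname{add}(R_{\mathfrak p}\otimes_R\mathcal A)$. The images of an object $A$ (or morphism $\alpha$) of $\mathcal A$ in these categories are denoted $QA$, $A_{\mathfrak p}$ ($Q\alpha$, $\alpha_{\mathfrak p}$); likewise $Q$ denotes the natural functor $\mathcal A_{\mathfrak p}\to Q\mathcal A$. $nB$ is the direct sum of $n$ copies of $B$. *)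

theory Defs
  imports
    "HOL-Algebra.Ring_Divisibility"
    "HOL-Algebra.Module"
    "HOL-Algebra.Generated_Groups"
    "HOL-Algebra.Free_Abelian_Groups"
    "Jordan_Normal_Form.Matrix"
begin

section \<open>Categories enriched in modules\<close>

text \<open>
  Small categories whose Hom sets are modules over a ring with carrier in \<^typ>\<open>'r\<close>.
  \<open>Comp C A B D g f\<close> is the composite \<open>g f : A \<rightarrow> D\<close> of \<open>f : A \<rightarrow> B\<close> and \<open>g : B \<rightarrow> D\<close>.
  Since composition is told the objects involved, different Hom sets need not be disjoint.
  The fields \<^const>\<open>monoid.mult\<close> and \<^const>\<open>monoid.one\<close> of the module records
  \<open>Hom C A B\<close> carry no meaning.
\<close>

record ('o, 'r, 'm) mcat =
  Obj :: "'o set"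
  Hom :: "'o \<Rightarrow> 'o \<Rightarrow> ('r, 'm) module"
  Comp :: "'o \<Rightarrow> 'o \<Rightarrow> 'o \<Rightarrow> 'm \<Rightarrow> 'm \<Rightarrow> 'm"
  Ident :: "'o \<Rightarrow> 'm"

locale r_category = R?: cring R
  for R :: "('r, 'k) ring_scheme" (structure) and C :: "('o, 'r, 'm) mcat" +
  assumes Hom_module:
      "\<lbrakk>A \<in> Obj C; B \<in> Obj C\<rbrakk> \<Longrightarrow> module R (Hom C A B)"
    and Comp_closed:
      "\<lbrakk>A \<in> Obj C; B \<in> Obj C; D \<in> Obj C; f \<in> carrier (Hom C A B); g \<in> carrier (Hom C B D)\<rbrakk>
        \<Longrightarrow> Comp C A B D g f \<in> carrier (Hom C A D)"
    and Ident_closed: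
      "A \<in> Obj C \<Longrightarrow> Ident C A \<in> carrier (Hom C A A)"
    and Comp_Ident_right:
      "\<lbrakk>A \<in> Obj C; B \<in> Obj C; f \<in> carrier (Hom C A B)\<rbrakk> \<Longrightarrow> Comp C A A B f (Ident C A) = f"
    and Comp_Ident_left:
      "\<lbrakk>A \<in> Obj C; B \<in> Obj C; f \<in> carrier (Hom C A B)\<rbrakk> \<Longrightarrow> Comp C A B B (Ident C B) f = f"
    and Comp_assoc:
      "\<lbrakk>A \<in> Obj C; B \<in> Obj C; D \<in> Obj C; E \<in> Obj C;
        f \<in> carrier (Hom C A B); g \<in> carrier (Hom C B D); h \<in> carrier (Hom C D E)\<rbrakk>
        \<Longrightarrow> Comp C A D E h (Comp C A B D g f) = Comp C A B E (Comp C B D E h g) f"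
    and Comp_add_right:
      "\<lbrakk>A \<in> Obj C; B \<in> Obj C; D \<in> Obj C; f \<in> carrier (Hom C A B); f' \<in> carrier (Hom C A B);
        g \<in> carrier (Hom C B D)\<rbrakk>
        \<Longrightarrow> Comp C A B D g (f \<oplus>\<^bsub>Hom C A B\<^esub> f') = Comp C A B D g f \<oplus>\<^bsub>Hom C A D\<^esub> Comp C A B D g f'"
    and Comp_add_left:
      "\<lbrakk>A \<in> Obj C; B \<in> Obj C; D \<in> Obj C; f \<in> carrier (Hom C A B);
        g \<in> carrier (Hom C B D); g' \<in> carrier (Hom C B D)\<rbrakk>
        \<Longrightarrow> Comp C A B D (g \<oplus>\<^bsub>Hom C B D\<^esub> g') f = Comp C A B D g f \<oplus>\<^bsub>Hom C A D\<^esub> Comp C A B D g' f"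
    and Comp_smult_right:
      "\<lbrakk>A \<in> Obj C; B \<in> Obj C; D \<in> Obj C; f \<in> carrier (Hom C A B); g \<in> carrier (Hom C B D);
        r \<in> carrier R\<rbrakk>
        \<Longrightarrow> Comp C A B D g (r \<odot>\<^bsub>Hom C A B\<^esub> f) = r \<odot>\<^bsub>Hom C A D\<^esub> Comp C A B D g f"
    and Comp_smult_left:
      "\<lbrakk>A \<in> Obj C; B \<in> Obj C; D \<in> Obj C; f \<in> carrier (Hom C A B); g \<in> carrier (Hom C B D);
        r \<in> carrier R\<rbrakk>
        \<Longrightarrow> Comp C A B D (r \<odot>\<^bsub>Hom C B D\<^esub> g) f = r \<odot>\<^bsub>Hom C A D\<^esub> Comp C A B D g f"

definition hom_finite :: "('r, 'k) ring_scheme \<Rightarrow> ('o, 'r, 'm) mcat \<Rightarrow> bool" where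
  "hom_finite R C \<longleftrightarrow> (\<forall>A\<in>Obj C. \<forall>B\<in>Obj C. \<exists>F. finite F \<and> F \<subseteq> carrier (Hom C A B) \<and>
     (\<forall>f\<in>carrier (Hom C A B). \<exists>c\<in>F \<rightarrow> carrier R.
        f = (\<Oplus>\<^bsub>Hom C A B\<^esub>x\<in>F. c x \<odot>\<^bsub>Hom C A B\<^esub> x)))"

definition isomorphic :: "('o, 'r, 'm) mcat \<Rightarrow> 'o \<Rightarrow> 'o \<Rightarrow> bool" where
  "isomorphic C A B \<longleftrightarrow> A \<in> Obj C \<and> B \<in> Obj C \<and>
     (\<exists>f\<in>carrier (Hom C A B). \<exists>g\<in>carrier (Hom C B A).
        Comp C A B A g f = Ident C A \<and> Comp C B A B f g = Ident C B)"

text \<open>\<open>S\<close> is a direct sum of the finite list \<open>Xs\<close> of objects; a direct sum of the empty list is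
  a zero object.\<close>

definition direct_sum :: "('o, 'r, 'm) mcat \<Rightarrow> 'o list \<Rightarrow> 'o \<Rightarrow> bool" where
  "direct_sum C Xs S \<longleftrightarrow> set Xs \<subseteq> Obj C \<and> S \<in> Obj C \<and>
     (\<exists>inj proj.
        (\<forall>i<length Xs. inj i \<in> carrier (Hom C (Xs ! i) S) \<and> proj i \<in> carrier (Hom C S (Xs ! i))) \<and>
        (\<forall>i<length Xs. \<forall>j<length Xs. Comp C (Xs ! i) S (Xs ! j) (proj j) (inj i) =
           (if i = j then Ident C (Xs ! i) else \<zero>\<^bsub>Hom C (Xs ! i) (Xs ! j)\<^esub>)) \<and>
        (\<Oplus>\<^bsub>Hom C S S\<^esub>i\<in>{..<length Xs}. Comp C S (Xs ! i) S (inj i) (proj i)) = Ident C S)"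

definition additive :: "('o, 'r, 'm) mcat \<Rightarrow> bool" where
  "additive C \<longleftrightarrow> (\<forall>Xs. set Xs \<subseteq> Obj C \<longrightarrow> (\<exists>S. direct_sum C Xs S))"

definition idempotents_split :: "('o, 'r, 'm) mcat \<Rightarrow> bool" where
  "idempotents_split C \<longleftrightarrow> (\<forall>A\<in>Obj C. \<forall>e\<in>carrier (Hom C A A). Comp C A A A e e = e \<longrightarrow>
     (\<exists>B\<in>Obj C. \<exists>p\<in>carrier (Hom C A B). \<exists>i\<in>carrier (Hom C B A).
        Comp C A B A i p = e \<and> Comp C B A B p i = Ident C B))"

definition fully_additive :: "('o, 'r, 'm) mcat \<Rightarrow> bool" where
  "fully_additive C \<longleftrightarrow> additive C \<and> idempotents_split C"


section \<open>Nilradical and torsion\<close>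

text \<open>For \<open>a : A \<rightarrow> B\<close> and \<open>b i : B \<rightarrow> A\<close> this is the product \<open>a (b 0) a (b 1) \<dots> a (b (n - 1)) a\<close>.\<close>

primrec alt_prod :: "('o, 'r, 'm) mcat \<Rightarrow> 'o \<Rightarrow> 'o \<Rightarrow> 'm \<Rightarrow> (nat \<Rightarrow> 'm) \<Rightarrow> nat \<Rightarrow> 'm" where
  "alt_prod C A B a b 0 = a"
| "alt_prod C A B a b (Suc n) =
     Comp C A A B (alt_prod C A B a b n) (Comp C A B A (b n) a)"

definition nilrad :: "('o, 'r, 'm) mcat \<Rightarrow> 'o \<Rightarrow> 'o \<Rightarrow> 'm set" where
  "nilrad C A B = {a \<in> carrier (Hom C A B).
     \<forall>b\<in>UNIV \<rightarrow> carrier (Hom C B A). \<exists>n. alt_prod C A B a b n = \<zero>\<^bsub>Hom C A B\<^esub>}"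

definition tors :: "('r, 'k) ring_scheme \<Rightarrow> ('o, 'r, 'm) mcat \<Rightarrow> 'o \<Rightarrow> 'o \<Rightarrow> 'm set" where
  "tors R C A B = {f \<in> carrier (Hom C A B).
     \<exists>r\<in>carrier R - {\<zero>\<^bsub>R\<^esub>}. r \<odot>\<^bsub>Hom C A B\<^esub> f = \<zero>\<^bsub>Hom C A B\<^esub>}"

definition torsion_reduced :: "('r, 'k) ring_scheme \<Rightarrow> ('o, 'r, 'm) mcat \<Rightarrow> 'o \<Rightarrow> bool" where
  "torsion_reduced R C A \<longleftrightarrow> A \<in> Obj C \<and> tors R C A A \<subseteq> nilrad C A A"

definition torsion_free :: "('r, 'k) ring_scheme \<Rightarrow> ('o, 'r, 'm) mcat \<Rightarrow> bool" where
  "torsion_free R C \<longleftrightarrow> (\<forall>A\<in>Obj C. \<forall>B\<in>Obj C. tors R C A B = {\<zero>\<^bsub>Hom C A B\<^esub>})"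


section \<open>Rings of fractions and Dedekind domains\<close>

definition frac_rel :: "('r, 'k) ring_scheme \<Rightarrow> 'r set \<Rightarrow> (('r \<times> 'r) \<times> ('r \<times> 'r)) set" where
  "frac_rel R S = {((a, s), (b, t)). a \<in> carrier R \<and> s \<in> S \<and> b \<in> carrier R \<and> t \<in> S \<and>
     (\<exists>u\<in>S. u \<otimes>\<^bsub>R\<^esub> (a \<otimes>\<^bsub>R\<^esub> t \<ominus>\<^bsub>R\<^esub> b \<otimes>\<^bsub>R\<^esub> s) = \<zero>\<^bsub>R\<^esub>)}"

definition fraction :: "('r, 'k) ring_scheme \<Rightarrow> 'r set \<Rightarrow> 'r \<Rightarrow> 'r \<Rightarrow> ('r \<times> 'r) set" where
  "fraction R S a s = frac_rel R S `` {(a, s)}"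

text \<open>Here and below, an operation on equivalence classes is the union of its values over all
  representatives, all of which are the same class.\<close>

definition frac_ring :: "('r, 'k) ring_scheme \<Rightarrow> 'r set \<Rightarrow> ('r \<times> 'r) set ring" where
  "frac_ring R S =
     \<lparr>carrier = (carrier R \<times> S) // frac_rel R S,
      monoid.mult = (\<lambda>X Y. \<Union>(a, s)\<in>X. \<Union>(b, t)\<in>Y. fraction R S (a \<otimes>\<^bsub>R\<^esub> b) (s \<otimes>\<^bsub>R\<^esub> t)),
      monoid.one = fraction R S \<one>\<^bsub>R\<^esub> \<one>\<^bsub>R\<^esub>,
      ring.zero = fraction R S \<zero>\<^bsub>R\<^esub> \<one>\<^bsub>R\<^esub>,
      ring.add = (\<lambda>X Y. \<Union>(a, s)\<in>X. \<Union>(b, t)\<in>Y.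
               fraction R S (a \<otimes>\<^bsub>R\<^esub> t \<oplus>\<^bsub>R\<^esub> b \<otimes>\<^bsub>R\<^esub> s) (s \<otimes>\<^bsub>R\<^esub> t))\<rparr>"

definition frac_emb :: "('r, 'k) ring_scheme \<Rightarrow> 'r set \<Rightarrow> 'r \<Rightarrow> ('r \<times> 'r) set" where
  "frac_emb R S r = fraction R S r \<one>\<^bsub>R\<^esub>"

abbreviation nonzeros :: "('r, 'k) ring_scheme \<Rightarrow> 'r set" where
  "nonzeros R \<equiv> carrier R - {\<zero>\<^bsub>R\<^esub>}"

abbreviation fraction_field :: "('r, 'k) ring_scheme \<Rightarrow> ('r \<times> 'r) set ring" where
  "fraction_field R \<equiv> frac_ring R (nonzeros R)"

abbreviation local_ring :: "('r, 'k) ring_scheme \<Rightarrow> 'r set \<Rightarrow> ('r \<times> 'r) set ring" where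
  "local_ring R P \<equiv> frac_ring R (carrier R - P)"

text \<open>Every element \<open>x\<close> of the field of fractions satisfying a monic equation
  \<open>x^n + c (n - 1) x^(n - 1) + \<dots> + c 0 = 0\<close> over \<open>R\<close> lies in \<open>R\<close>.\<close>

definition integrally_closed :: "('r, 'k) ring_scheme \<Rightarrow> bool" where
  "integrally_closed R \<longleftrightarrow>
     (\<forall>x\<in>carrier (fraction_field R).
        (\<exists>n :: nat. \<exists>c\<in>{..<n} \<rightarrow> carrier R.
           x [^]\<^bsub>fraction_field R\<^esub> n \<oplus>\<^bsub>fraction_field R\<^esub>
             (\<Oplus>\<^bsub>fraction_field R\<^esub>i\<in>{..<n}.
                frac_emb R (nonzeros R) (c i) \<otimes>\<^bsub>fraction_field R\<^esub> x [^]\<^bsub>fraction_field R\<^esub> i)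
           = \<zero>\<^bsub>fraction_field R\<^esub>)
        \<longrightarrow> x \<in> frac_emb R (nonzeros R) ` carrier R)"

text \<open>As in most references, fields count as Dedekind domains.\<close>

locale dedekind_domain = noetherian_domain R for R (structure) +
  assumes integrally_closed: "integrally_closed R"
    and prime_maximal: "\<lbrakk>primeideal P R; P \<noteq> {\<zero>}\<rbrakk> \<Longrightarrow> maximalideal P R"

definition max_spec :: "('r, 'k) ring_scheme \<Rightarrow> 'r set set" where
  "max_spec R = {P. maximalideal P R}"


section \<open>Extension of scalars\<close>

text \<open>The tensor product \<open>S \<otimes>\<^sub>R M\<close> for a ring homomorphism \<open>\<phi> : R \<rightarrow> S\<close> and an
  \<open>R\<close>-module \<open>M\<close>: the free abelian group on the pairs \<open>(s, m)\<close> modulo the subgroup generated by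
  the usual relations, an \<open>S\<close>-module through the left factor.\<close>

type_synonym ('s, 'm) tens = "('s \<times> 'm \<Rightarrow>\<^sub>0 int) set"

abbreviation pair_group :: "('s, 'l) ring_scheme \<Rightarrow> ('r, 'm) module \<Rightarrow> ('s \<times> 'm \<Rightarrow>\<^sub>0 int) monoid" where
  "pair_group S M \<equiv> free_Abelian_group (carrier S \<times> carrier M)"

definition tens_rels ::
  "('r, 'k) ring_scheme \<Rightarrow> ('s, 'l) ring_scheme \<Rightarrow> ('r \<Rightarrow> 's) \<Rightarrow> ('r, 'm) module \<Rightarrow> ('s \<times> 'm \<Rightarrow>\<^sub>0 int) set"
where
  "tens_rels R S \<phi> M =
     {frag_of (s \<oplus>\<^bsub>S\<^esub> t, m) - frag_of (s, m) - frag_of (t, m) | s t m.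
        s \<in> carrier S \<and> t \<in> carrier S \<and> m \<in> carrier M} \<union>
     {frag_of (s, m \<oplus>\<^bsub>M\<^esub> n) - frag_of (s, m) - frag_of (s, n) | s m n.
        s \<in> carrier S \<and> m \<in> carrier M \<and> n \<in> carrier M} \<union>
     {frag_of (\<phi> r \<otimes>\<^bsub>S\<^esub> s, m) - frag_of (s, r \<odot>\<^bsub>M\<^esub> m) | r s m.
        r \<in> carrier R \<and> s \<in> carrier S \<and> m \<in> carrier M}"

definition tens_class ::
  "('r, 'k) ring_scheme \<Rightarrow> ('s, 'l) ring_scheme \<Rightarrow> ('r \<Rightarrow> 's) \<Rightarrow> ('r, 'm) module \<Rightarrow>
     ('s \<times> 'm \<Rightarrow>\<^sub>0 int) \<Rightarrow> ('s, 'm) tens"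
where
  "tens_class R S \<phi> M c =
     generate (pair_group S M) (tens_rels R S \<phi> M) #>\<^bsub>pair_group S M\<^esub> c"

definition tens_module ::
  "('r, 'k) ring_scheme \<Rightarrow> ('s, 'l) ring_scheme \<Rightarrow> ('r \<Rightarrow> 's) \<Rightarrow> ('r, 'm) module \<Rightarrow>
     ('s, ('s, 'm) tens) module"
where
  "tens_module R S \<phi> M =
     (let T = pair_group S M Mod generate (pair_group S M) (tens_rels R S \<phi> M) in
      \<lparr>carrier = carrier T, monoid.mult = undefined, monoid.one = undefined,
       ring.zero = \<one>\<^bsub>T\<^esub>, ring.add = (\<lambda>X Y. X \<otimes>\<^bsub>T\<^esub> Y),
       smult = (\<lambda>s X. \<Union>c\<in>X.
          tens_class R S \<phi> M (frag_extend (\<lambda>(t, m). frag_of (s \<otimes>\<^bsub>S\<^esub> t, m)) c))\<rparr>)"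

text \<open>The category \<open>S \<otimes>\<^sub>R C\<close>; composition is the biadditive extension of
  \<open>(s \<otimes> g) (t \<otimes> f) = s t \<otimes> g f\<close>.\<close>

definition tens_cat ::
  "('r, 'k) ring_scheme \<Rightarrow> ('s, 'l) ring_scheme \<Rightarrow> ('r \<Rightarrow> 's) \<Rightarrow> ('o, 'r, 'm) mcat \<Rightarrow>
     ('o, 's, ('s, 'm) tens) mcat"
where
  "tens_cat R S \<phi> C =
     \<lparr>Obj = Obj C,
      Hom = (\<lambda>A B. tens_module R S \<phi> (Hom C A B)),
      Comp = (\<lambda>A B D Y X. \<Union>d\<in>Y. \<Union>c\<in>X. tens_class R S \<phi> (Hom C A D)
                (frag_extend (\<lambda>(s, g). frag_extend (\<lambda>(t, f).
                   frag_of (s \<otimes>\<^bsub>S\<^esub> t, Comp C A B D g f)) c) d)),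
      Ident = (\<lambda>A. tens_class R S \<phi> (Hom C A A) (frag_of (\<one>\<^bsub>S\<^esub>, Ident C A)))\<rparr>"


section \<open>The fully additive hull\<close>

text \<open>\<open>add C\<close> is realised by the usual model: first adjoin formal direct sums (lists of
  objects, with matrices of morphisms, the entry in row \<open>i\<close> and column \<open>j\<close> being a morphism from
  the \<open>j\<close>-th summand of the source to the \<open>i\<close>-th summand of the target), then split idempotents
  (pairs of an object and an idempotent endomorphism \<open>e\<close>; the morphisms \<open>(X, e) \<rightarrow> (Y, e')\<close> are
  the \<open>g : X \<rightarrow> Y\<close> with \<open>e' g = g = g e\<close>, and \<open>e\<close> is the identity of \<open>(X, e)\<close>).\<close>

definition sum_hull :: "('o, 'r, 'm) mcat \<Rightarrow> ('o list, 'r, 'm mat) mcat" where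
  "sum_hull C =
     \<lparr>Obj = {Xs. set Xs \<subseteq> Obj C},
      Hom = (\<lambda>Xs Ys.
        \<lparr>carrier = {M \<in> carrier_mat (length Ys) (length Xs).
            \<forall>i<length Ys. \<forall>j<length Xs. M $$ (i, j) \<in> carrier (Hom C (Xs ! j) (Ys ! i))},
         monoid.mult = undefined, monoid.one = undefined,
         ring.zero = mat (length Ys) (length Xs) (\<lambda>(i, j). \<zero>\<^bsub>Hom C (Xs ! j) (Ys ! i)\<^esub>),
         ring.add = (\<lambda>M N. mat (length Ys) (length Xs)
            (\<lambda>(i, j). M $$ (i, j) \<oplus>\<^bsub>Hom C (Xs ! j) (Ys ! i)\<^esub> N $$ (i, j))),
         smult = (\<lambda>r M. mat (length Ys) (length Xs)
            (\<lambda>(i, j). r \<odot>\<^bsub>Hom C (Xs ! j) (Ys ! i)\<^esub> M $$ (i, j)))\<rparr>),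
      Comp = (\<lambda>Xs Ys Zs N M. mat (length Zs) (length Xs)
         (\<lambda>(i, j). \<Oplus>\<^bsub>Hom C (Xs ! j) (Zs ! i)\<^esub>k\<in>{..<length Ys}.
            Comp C (Xs ! j) (Ys ! k) (Zs ! i) (N $$ (i, k)) (M $$ (k, j)))),
      Ident = (\<lambda>Xs. mat (length Xs) (length Xs)
         (\<lambda>(i, j). if i = j then Ident C (Xs ! i) else \<zero>\<^bsub>Hom C (Xs ! j) (Xs ! i)\<^esub>))\<rparr>"

definition idem_hull :: "('o, 'r, 'm) mcat \<Rightarrow> ('o \<times> 'm, 'r, 'm) mcat" where
  "idem_hull C =
     \<lparr>Obj = {(X, e). X \<in> Obj C \<and> e \<in> carrier (Hom C X X) \<and> Comp C X X X e e = e},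
      Hom = (\<lambda>(X, e) (Y, e'). (Hom C X Y)
        \<lparr>carrier := {g \<in> carrier (Hom C X Y). Comp C X Y Y e' g = g \<and> Comp C X X Y g e = g}\<rparr>),
      Comp = (\<lambda>(X, _) (Y, _) (Z, _). Comp C X Y Z),
      Ident = (\<lambda>(X, e). e)\<rparr>"

definition add_hull :: "('o, 'r, 'm) mcat \<Rightarrow> ('o list \<times> 'm mat, 'r, 'm mat) mcat" where
  "add_hull C = idem_hull (sum_hull C)"

definition hull_obj :: "('o, 'r, 'm) mcat \<Rightarrow> 'o \<Rightarrow> 'o list \<times> 'm mat" where
  "hull_obj C A = ([A], mat 1 1 (\<lambda>_. Ident C A))"

definition hull_mor :: "'m \<Rightarrow> 'm mat" where
  "hull_mor f = mat 1 1 (\<lambda>_. f)"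


section \<open>Localisations of a category\<close>

type_synonym ('r, 'm) lmor = "((('r \<times> 'r) set, 'm) tens) mat"
type_synonym ('o, 'r, 'm) lobj = "'o list \<times> ('r, 'm) lmor"

text \<open>\<open>loc_cat R S C\<close> is \<open>add (S\<^sup>-\<^sup>1R \<otimes>\<^sub>R C)\<close> for a multiplicative subset \<open>S\<close>; \<open>S\<close> consists of the
  nonzero elements for \<open>Q C\<close> and is the complement of \<open>\<pp>\<close> for \<open>C\<^sub>\<pp>\<close>.\<close>

definition frac_cat ::
  "('r, 'k) ring_scheme \<Rightarrow> 'r set \<Rightarrow> ('o, 'r, 'm) mcat \<Rightarrow>
     ('o, ('r \<times> 'r) set, (('r \<times> 'r) set, 'm) tens) mcat"
where
  "frac_cat R S C = tens_cat R (frac_ring R S) (frac_emb R S) C"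

definition loc_cat ::
  "('r, 'k) ring_scheme \<Rightarrow> 'r set \<Rightarrow> ('o, 'r, 'm) mcat \<Rightarrow>
     (('o, 'r, 'm) lobj, ('r \<times> 'r) set, ('r, 'm) lmor) mcat"
where
  "loc_cat R S C = add_hull (frac_cat R S C)"

definition loc_obj ::
  "('r, 'k) ring_scheme \<Rightarrow> 'r set \<Rightarrow> ('o, 'r, 'm) mcat \<Rightarrow> 'o \<Rightarrow> ('o, 'r, 'm) lobj"
where
  "loc_obj R S C A = hull_obj (frac_cat R S C) A"

definition loc_mor ::
  "('r, 'k) ring_scheme \<Rightarrow> 'r set \<Rightarrow> ('o, 'r, 'm) mcat \<Rightarrow> 'o \<Rightarrow> 'o \<Rightarrow> 'm \<Rightarrow> ('r, 'm) lmor"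
where
  "loc_mor R S C A B f = hull_mor
     (tens_class R (frac_ring R S) (frac_emb R S) (Hom C A B) (frag_of (\<one>\<^bsub>frac_ring R S\<^esub>, f)))"

text \<open>For \<open>S \<subseteq> T\<close>: the canonical maps \<open>S\<^sup>-\<^sup>1R \<rightarrow> T\<^sup>-\<^sup>1R\<close> and
  \<open>S\<^sup>-\<^sup>1R \<otimes>\<^sub>R C(A, B) \<rightarrow> T\<^sup>-\<^sup>1R \<otimes>\<^sub>R C(A, B)\<close>, and the functor
  \<open>add (S\<^sup>-\<^sup>1R \<otimes>\<^sub>R C) \<rightarrow> add (T\<^sup>-\<^sup>1R \<otimes>\<^sub>R C)\<close> they induce by acting on the entries of matrices.\<close>

definition frac_change :: "('r, 'k) ring_scheme \<Rightarrow> 'r set \<Rightarrow> ('r \<times> 'r) set \<Rightarrow> ('r \<times> 'r) set" where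
  "frac_change R T X = (\<Union>(a, s)\<in>X. fraction R T a s)"

definition tens_change ::
  "('r, 'k) ring_scheme \<Rightarrow> 'r set \<Rightarrow> ('r, 'm) module \<Rightarrow>
     (('r \<times> 'r) set, 'm) tens \<Rightarrow> (('r \<times> 'r) set, 'm) tens"
where
  "tens_change R T M X = (\<Union>c\<in>X. tens_class R (frac_ring R T) (frac_emb R T) M
     (frag_extend (\<lambda>(s, m). frag_of (frac_change R T s, m)) c))"

definition change_mat ::
  "('r, 'k) ring_scheme \<Rightarrow> 'r set \<Rightarrow> ('o, 'r, 'm) mcat \<Rightarrow> 'o list \<Rightarrow> 'o list \<Rightarrow>
     ('r, 'm) lmor \<Rightarrow> ('r, 'm) lmor"
where
  "change_mat R T C Xs Ys M = mat (length Ys) (length Xs)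
     (\<lambda>(i, j). tens_change R T (Hom C (Xs ! j) (Ys ! i)) (M $$ (i, j)))"

definition change_obj ::
  "('r, 'k) ring_scheme \<Rightarrow> 'r set \<Rightarrow> ('o, 'r, 'm) mcat \<Rightarrow> ('o, 'r, 'm) lobj \<Rightarrow> ('o, 'r, 'm) lobj"
where
  "change_obj R T C X = (fst X, change_mat R T C (fst X) (fst X) (snd X))"

definition change_mor ::
  "('r, 'k) ring_scheme \<Rightarrow> 'r set \<Rightarrow> ('o, 'r, 'm) mcat \<Rightarrow> ('o, 'r, 'm) lobj \<Rightarrow> ('o, 'r, 'm) lobj \<Rightarrow>
     ('r, 'm) lmor \<Rightarrow> ('r, 'm) lmor"
where
  "change_mor R T C X Y = change_mat R T C (fst X) (fst Y)"

text \<open>\<open>Q C\<close> and \<open>C\<^sub>\<pp>\<close>, the images in them of objects and morphisms of \<open>C\<close>, and the natural functor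
  from \<open>C\<^sub>\<pp>\<close> to \<open>Q C\<close> (it does not mention \<open>\<pp>\<close>, since elements of \<open>R\<^sub>\<pp>\<close> are classes of
  pairs).\<close>

abbreviation "Q_cat R C \<equiv> loc_cat R (nonzeros R) C"
abbreviation "Q_obj R C \<equiv> loc_obj R (nonzeros R) C"
abbreviation "Q_mor R C \<equiv> loc_mor R (nonzeros R) C"

abbreviation (input) "at_cat R P C \<equiv> loc_cat R (carrier R - P) C"
abbreviation (input) "at_obj R P C \<equiv> loc_obj R (carrier R - P) C"
abbreviation (input) "at_mor R P C \<equiv> loc_mor R (carrier R - P) C"

abbreviation "Q_of_obj R C \<equiv> change_obj R (nonzeros R) C"
abbreviation "Q_of_mor R C \<equiv> change_mor R (nonzeros R) C"

definition congruent_nil :: "('o, 'r, 'm) mcat \<Rightarrow> 'o \<Rightarrow> 'o \<Rightarrow> 'm \<Rightarrow> 'm \<Rightarrow> bool" where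
  "congruent_nil C A B f g \<longleftrightarrow> f \<ominus>\<^bsub>Hom C A B\<^esub> g \<in> nilrad C A B"

text \<open>Morphisms \<open>\<alpha> : A \<rightarrow> B\<close>, \<open>\<beta> : B \<rightarrow> A\<close> and a nonzero \<open>a\<close> with
  \<open>\<beta> \<alpha> \<equiv> a 1\<^sub>A\<close> and \<open>\<alpha> \<beta> \<equiv> a 1\<^sub>B\<close> modulo the nilradical.\<close>

definition quasi_inverse ::
  "('r, 'k) ring_scheme \<Rightarrow> ('o, 'r, 'm) mcat \<Rightarrow> 'o \<Rightarrow> 'o \<Rightarrow> 'm \<Rightarrow> 'm \<Rightarrow> 'r \<Rightarrow> bool"
where
  "quasi_inverse R C A B \<alpha> \<beta> a \<longleftrightarrow>
     \<alpha> \<in> carrier (Hom C A B) \<and> \<beta> \<in> carrier (Hom C B A) \<and> a \<in> carrier R \<and> a \<noteq> \<zero>\<^bsub>R\<^esub> \<and>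
     congruent_nil C A A (Comp C A B A \<beta> \<alpha>) (a \<odot>\<^bsub>Hom C A A\<^esub> Ident C A) \<and>
     congruent_nil C B B (Comp C B A B \<alpha> \<beta>) (a \<odot>\<^bsub>Hom C B B\<^esub> Ident C B)"

end

theory Submission
  imports Defs
begin

text \<open>
  Isomorphisms in a localisation of the category amount to morphisms of the category itself that
  compose to a scalar, and all relations needed can be made exact by clearing denominators and
  annihilators. If \<open>\<alpha> : A \<rightarrow> B\<close> and \<open>\<beta> : B \<rightarrow> A\<close> compose to \<open>a\<close> both ways, and \<open>x (1 - x) = a z\<close>, then
  \<open>[[x, \<beta>], [z \<alpha>, 1 - x]]\<close> is an idempotent of \<open>A \<oplus> B\<close>; its image is locally isomorphic to \<open>A\<close> where
  \<open>x\<close> is a unit and to \<open>B\<close> where \<open>1 - x\<close> is. Taking \<open>x\<close> to be, modulo \<open>a\<close>, the idempotent that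
  belongs to one prime \<open>\<pp>\<close> replaces \<open>B\<close> by \<open>A\<close> at \<open>\<pp>\<close> only; the complementary summand does the
  reverse, so (1) follows by splitting off one prime after another. The same works when \<open>A\<close> is only
  the image of an idempotent \<open>\<epsilon>/s\<close> defined over the localisation at \<open>\<pp>\<close>, which gives (2).
\<close>

section \<open>Ideals of Dedekind domains\<close>

text \<open>The obstacle is torsion reducedness of a glued object. It is known only through pairs of
  morphisms to and from \<open>X\<close> and \<open>B\<close> composing to scalars. Conjugation by
  such a pair is multiplicative up to a scalar, so alternating products of torsion endomorphisms
  vanish after multiplication by powers of these scalars; since the scalars of all comparisons
  together lie in no maximal ideal, the products vanish outright. Hom modules may have torsion, so
  scalars are carried along instead of being cancelled. The idempotent of R/aR at \<pp> is found
  without factoring ideals: a prime avoiding a multiplicative set shows that each element of \<pp>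
  is nilpotent modulo \<open>a\<close> up to a factor outside \<pp>, and the noetherian condition
  makes one factor serve all elements. Relations modulo the nilradical are made exact at the price
  of replacing \<open>a\<close> by a power, which is contained in no new prime ideal. Part (3) rests
  on injectivity: for torsion free Hom modules a local morphism is determined by its image under Q,
  so the prescribed local morphisms are already those of \<alpha>.\<close>

lemma (in noetherian_ring) exists_maximal_in_family:
  assumes "\<F> \<noteq> {}" "\<And>J. J \<in> \<F> \<Longrightarrow> ideal J R"
  shows "\<exists>M\<in>\<F>. \<forall>J\<in>\<F>. M \<subseteq> J \<longrightarrow> J = M"
proof (rule subset_Zorn)
  fix \<C> assume ch: "subset.chain \<F> \<C>"
  show "\<exists>U\<in>\<F>. \<forall>X\<in>\<C>. X \<subseteq> U"
  proof (cases "\<C> = {}")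
    case True
    obtain U where "U \<in> \<F>" using assms(1) by (meson ex_in_conv)
    then show ?thesis using True by (intro bexI[of _ U]) simp_all
  next
    case False
    have sub: "\<C> \<subseteq> \<F>" using ch by (simp add: pred_on.chain_def)
    have "\<C> \<subseteq> {I. ideal I R}"
    proof
      fix I assume "I \<in> \<C>"
      then show "I \<in> {I. ideal I R}" using sub assms(2)[of I] by (simp add: subset_iff)
    qed
    \<comment> \<open>The noetherian condition in the form that Zorn's lemma wants: a nonempty chain
      of ideals contains its own union.\<close>
    then have "subset.chain {I. ideal I R} \<C>"
      using ch by (simp add: pred_on.chain_def)
    then have "\<Union>\<C> \<in> \<C>" by (rule ideal_chain_is_trivial[OF False])
    then show ?thesis by (intro bexI[of _ "\<Union>\<C>"] ballI Union_upper subsetD[OF sub])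
  qed
qed

text \<open>The witness is the sum of \<open>P\<close> and the principal ideal of \<open>a\<close>.
  It is described by elements because the applications need an explicit combination
  \<open>p \<oplus> r \<otimes> a\<close>, equal to 1 or lying in a multiplicative set.\<close>

lemma (in cring) ideal_insert:
  assumes "ideal P R" "a \<in> carrier R"
  shows "\<exists>J. ideal J R \<and> P \<subseteq> J \<and> a \<in> J \<and> (\<forall>x\<in>J. \<exists>p\<in>P. \<exists>r\<in>carrier R. x = p \<oplus> r \<otimes> a)"
proof (intro exI conjI)
  let ?J = "set_add R P (PIdl a)"
  show "ideal ?J R" using assms by (intro add_ideals cgenideal_ideal)
  have 0: "\<zero> \<in> P" using assms by (simp add: additive_subgroup.zero_closed ideal.axioms(1))
  show "P \<subseteq> ?J"
  proof
    fix x assume x: "x \<in> P"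
    then have "x = x \<oplus> \<zero> \<otimes> a" using assms by (simp add: ideal.Icarr)
    then show "x \<in> ?J" using x unfolding set_add_def' cgenideal_def by blast
  qed
  have "a = \<zero> \<oplus> \<one> \<otimes> a" using assms by simp
  then show "a \<in> ?J" using 0 unfolding set_add_def' cgenideal_def by blast
  show "\<forall>x\<in>?J. \<exists>p\<in>P. \<exists>r\<in>carrier R. x = p \<oplus> r \<otimes> a"
    unfolding set_add_def' cgenideal_def by blast
qed

lemma (in noetherian_domain) exists_maximalideal:
  assumes "ideal I R" "\<one> \<notin> I"
  shows "\<exists>P. maximalideal P R \<and> I \<subseteq> P"
proof -
  have "\<exists>P\<in>{J. ideal J R \<and> I \<subseteq> J \<and> \<one> \<notin> J}. \<forall>J\<in>{J. ideal J R \<and> I \<subseteq> J \<and> \<one> \<notin> J}. P \<subseteq> J \<longrightarrow> J = P"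
    using assms by (intro exists_maximal_in_family) auto
  then obtain P where P: "ideal P R" "I \<subseteq> P" "\<one> \<notin> P"
    and max: "\<And>J. ideal J R \<Longrightarrow> \<one> \<notin> J \<Longrightarrow> P \<subseteq> J \<Longrightarrow> J = P"
    by auto
  have "maximalideal P R"
  proof (rule maximalidealI[OF P(1)])
    show "carrier R \<noteq> P" using P(3) by auto
  next
    fix J assume "ideal J R" "P \<subseteq> J" "J \<subseteq> carrier R"
    then show "J = P \<or> J = carrier R" using max[of J] ideal.one_imp_carrier[of J R] by auto
  qed
  then show ?thesis using P by auto
qed

text \<open>An ideal maximal among those disjoint from \<open>T\<close> is prime: enlarged by
  \<open>a\<close>, or by \<open>b\<close>, it meets \<open>T\<close>. The product of the two
  elements found there is in \<open>T\<close>, and if \<open>a \<otimes> b\<close> were in the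
  ideal, so would be every term of the expanded product.\<close>

lemma (in noetherian_domain) exists_primeideal_avoiding:
  assumes I: "ideal I R" and T: "T \<subseteq> carrier R" "\<one> \<in> T" "\<And>s t. s \<in> T \<Longrightarrow> t \<in> T \<Longrightarrow> s \<otimes> t \<in> T"
    and disj: "I \<inter> T = {}"
  shows "\<exists>P. primeideal P R \<and> I \<subseteq> P \<and> P \<inter> T = {}"
proof -
  have "\<exists>P\<in>{J. ideal J R \<and> I \<subseteq> J \<and> J \<inter> T = {}}. \<forall>J\<in>{J. ideal J R \<and> I \<subseteq> J \<and> J \<inter> T = {}}. P \<subseteq> J \<longrightarrow> J = P"
    using assms by (intro exists_maximal_in_family) auto
  then obtain P where P: "ideal P R" "I \<subseteq> P" "P \<inter> T = {}"
    and max: "\<And>J. ideal J R \<Longrightarrow> J \<inter> T = {} \<Longrightarrow> P \<subseteq> J \<Longrightarrow> J = P"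
    by auto
  interpret P: ideal P R by (rule P(1))
  have meets: "\<exists>p\<in>P. \<exists>r\<in>carrier R. p \<oplus> r \<otimes> a \<in> T" if "a \<in> carrier R" "a \<notin> P" for a
  proof -
    obtain J where J: "ideal J R" "P \<subseteq> J" "a \<in> J"
        "\<And>x. x \<in> J \<Longrightarrow> \<exists>p\<in>P. \<exists>r\<in>carrier R. x = p \<oplus> r \<otimes> a"
      using ideal_insert[OF P(1) \<open>a \<in> carrier R\<close>] by metis
    have "J \<noteq> P" using J(3) \<open>a \<notin> P\<close> by auto
    then have "J \<inter> T \<noteq> {}" using max[OF J(1) _ J(2)] by auto
    then obtain x where x: "x \<in> J" "x \<in> T" by blast
    then obtain p r where "p \<in> P" "r \<in> carrier R" "x = p \<oplus> r \<otimes> a" using J(4) by meson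
    then show ?thesis using x(2) by (intro bexI[of _ p] bexI[of _ r]) simp_all
  qed
  have "primeideal P R"
  proof (rule primeidealI[OF P(1) is_cring])
    show "carrier R \<noteq> P" using P(3) T(2) by auto
  next
    fix a b assume ab: "a \<in> carrier R" "b \<in> carrier R" "a \<otimes> b \<in> P"
    show "a \<in> P \<or> b \<in> P"
    proof (rule ccontr)
      assume "\<not> (a \<in> P \<or> b \<in> P)"
      then obtain p r q t where c: "p \<in> P" "r \<in> carrier R" "p \<oplus> r \<otimes> a \<in> T"
          "q \<in> P" "t \<in> carrier R" "q \<oplus> t \<otimes> b \<in> T"
        using meets ab by meson
      have "(p \<oplus> r \<otimes> a) \<otimes> (q \<oplus> t \<otimes> b) = p \<otimes> (q \<oplus> t \<otimes> b) \<oplus> ((r \<otimes> a) \<otimes> q \<oplus> (r \<otimes> t) \<otimes> (a \<otimes> b))"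
        using c(1,2,4,5) ab(1,2) by (simp add: l_distr r_distr m_ac a_ac)
      moreover have "p \<otimes> (q \<oplus> t \<otimes> b) \<in> P"
        using c(1,2,4,5) ab by (intro P.I_r_closed) auto
      moreover have "(r \<otimes> a) \<otimes> q \<in> P" "(r \<otimes> t) \<otimes> (a \<otimes> b) \<in> P"
        using c(1,2,4,5) ab by (auto intro: P.I_l_closed)
      ultimately have "(p \<oplus> r \<otimes> a) \<otimes> (q \<oplus> t \<otimes> b) \<in> P" by auto
      then show False using T(3)[OF c(3,6)] P(3) by auto
    qed
  qed
  then show ?thesis using P by auto
qed

section \<open>Scalars that separate one maximal ideal from the others\<close>

context dedekind_domain
begin

lemma max_specD:
  assumes "\<pp> \<in> max_spec R"
  shows "ideal \<pp> R" "primeideal \<pp> R" "\<one> \<notin> \<pp>" "\<pp> \<subseteq> carrier R" "maximalideal \<pp> R"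
proof -
  show m: "maximalideal \<pp> R" using assms by (simp add: max_spec_def)
  then show i: "ideal \<pp> R" by (rule maximalideal.axioms(1))
  show "primeideal \<pp> R" by (rule maximalideal_prime[OF m])
  show "\<pp> \<subseteq> carrier R" using i by (auto simp: ideal.Icarr)
  show "\<one> \<notin> \<pp>" using ideal.one_imp_carrier[OF i] maximalideal.I_notcarr[OF m] by auto
qed

lemma max_spec_mult_notin:
  assumes "\<pp> \<in> max_spec R" "x \<in> carrier R" "x \<notin> \<pp>" "y \<in> carrier R" "y \<notin> \<pp>"
  shows "x \<otimes> y \<notin> \<pp>"
  using primeideal.I_prime[OF max_specD(2)[OF assms(1)]] assms by blast

lemma max_spec_pow_notin:
  assumes "\<pp> \<in> max_spec R" "x \<in> carrier R" "x \<notin> \<pp>"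
  shows "x [^] (n::nat) \<notin> \<pp>"
proof (induction n)
  case 0
  then show ?case using max_specD(3)[OF assms(1)] by simp
next
  case (Suc n)
  then show ?case
    using max_spec_mult_notin[OF assms(1) nat_pow_closed[OF assms(2)] _ assms(2,3)] by simp
qed

lemma max_spec_incomparable:
  assumes "\<pp> \<in> max_spec R" "\<qq> \<in> max_spec R" "\<pp> \<subseteq> \<qq>"
  shows "\<pp> = \<qq>"
  using maximalideal.I_maximal[OF max_specD(5)[OF assms(1)] max_specD(1)[OF assms(2)] assms(3) max_specD(4)[OF assms(2)]]
    max_specD(3)[OF assms(2)] by auto

text \<open>R/\<pp> is a field. The element \<pi> is kept explicit because the relation will be
  rewritten with a power of \<pi> in its place.\<close>

lemma inverse_mod_max:
  assumes "\<pp> \<in> max_spec R" "y \<in> carrier R" "y \<notin> \<pp>"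
  shows "\<exists>\<pi>\<in>\<pp>. \<exists>r\<in>carrier R. \<pi> \<oplus> r \<otimes> y = \<one>"
proof -
  obtain J where J: "ideal J R" "\<pp> \<subseteq> J" "y \<in> J" "\<forall>x\<in>J. \<exists>p\<in>\<pp>. \<exists>r\<in>carrier R. x = p \<oplus> r \<otimes> y"
    using ideal_insert[OF max_specD(1)[OF assms(1)] assms(2)] by blast
  have "J = carrier R"
    using maximalideal.I_maximal[OF max_specD(5)[OF assms(1)] J(1,2)] J(3) assms(3) ideal.Icarr[OF J(1)]
    by (auto simp del: ideal.Icarr)
  then have "\<one> \<in> J" by simp
  then show ?thesis using J(4) by (metis (no_types))
qed

text \<open>Some element outside \<open>\<pp>\<close> times a power of any given \<open>\<pi> \<in> \<pp>\<close> is divisible by \<open>a\<close>: otherwise a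
  prime ideal containing \<open>a\<close>, strictly below \<open>\<pp>\<close>, would exist.\<close>

lemma power_in_local_ideal:
  assumes p: "\<pp> \<in> max_spec R" and a: "a \<in> carrier R" "a \<noteq> \<zero>" and \<pi>: "\<pi> \<in> \<pp>"
  shows "\<exists>y\<in>carrier R - \<pp>. \<exists>k::nat. y \<otimes> \<pi> [^] k \<in> PIdl a"
proof (rule ccontr)
  assume contra: "\<not> ?thesis"
  have \<pi>R: "\<pi> \<in> carrier R" using max_specD(4)[OF p] \<pi> by auto
  let ?T = "{y \<otimes> \<pi> [^] k | y (k::nat). y \<in> carrier R - \<pp>}"
  have one: "\<one> \<in> carrier R - \<pp>" using max_specD(3)[OF p] by auto
  have in_T: "y \<in> ?T" if "y \<in> carrier R - \<pp>" for y
    using that by (auto intro!: exI[of _ y] exI[of _ "0::nat"])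
  have "\<exists>P. primeideal P R \<and> PIdl a \<subseteq> P \<and> P \<inter> ?T = {}"
  proof (rule exists_primeideal_avoiding)
    show "ideal (PIdl a) R" by (rule cgenideal_ideal[OF a(1)])
    show "?T \<subseteq> carrier R" using \<pi>R by auto
    show "\<one> \<in> ?T" using in_T[OF one] .
    show "PIdl a \<inter> ?T = {}" using contra by auto
  next
    fix s t assume "s \<in> ?T" "t \<in> ?T"
    then obtain y k z l where st: "s = y \<otimes> \<pi> [^] (k::nat)" "y \<in> carrier R - \<pp>"
        "t = z \<otimes> \<pi> [^] (l::nat)" "z \<in> carrier R - \<pp>" by blast
    then have "s \<otimes> t = (y \<otimes> z) \<otimes> \<pi> [^] (k + l)"
      using \<pi>R by (simp add: nat_pow_mult[symmetric] m_ac)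
    moreover have "y \<otimes> z \<in> carrier R - \<pp>" using st max_spec_mult_notin[OF p] by auto
    ultimately show "s \<otimes> t \<in> ?T" by blast
  qed
  then obtain P where P: "primeideal P R" "PIdl a \<subseteq> P" "P \<inter> ?T = {}" by auto
  have "a \<in> P" using P(2) cgenideal_self[OF a(1)] by auto
  then have "P \<in> max_spec R" using prime_maximal[OF P(1)] a(2) by (auto simp: max_spec_def)
  \<comment> \<open>\<open>?T\<close> contains everything outside \<pp>, so \<open>P\<close>, which
    avoids \<open>?T\<close>, lies inside \<pp>. Being nonzero it is maximal, hence equal to \<pp>;
    but \<pi> lies both in \<pp> and in \<open>?T\<close>.\<close>
  moreover have "P \<subseteq> \<pp>"
    using in_T P(3) ideal.Icarr[OF primeideal.axioms(1)[OF P(1)]] by blast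
  ultimately have "P = \<pp>" by (rule max_spec_incomparable[OF _ p])
  moreover have "\<pi> \<in> ?T" using one \<pi>R by (auto intro!: exI[of _ \<one>] exI[of _ "1::nat"])
  ultimately show False using \<pi> P(3) by auto
qed

text \<open>If \<pi> is 1 modulo \<open>c\<close>, so are its powers. This allows passing to a power
  of \<pi> that \<open>y\<close> makes divisible by \<open>a\<close>.\<close>

lemma power_complement:
  assumes "\<pi> \<in> carrier R" "c \<in> carrier R" "r \<in> carrier R" "\<pi> \<oplus> r \<otimes> c = \<one>"
  shows "\<exists>r'\<in>carrier R. \<pi> [^] (k::nat) \<oplus> r' \<otimes> c = \<one>"
proof (induction k)
  case 0
  show ?case using assms by (auto intro!: bexI[of _ \<zero>])
next
  case (Suc k)
  then obtain r' where r': "r' \<in> carrier R" "\<pi> [^] k \<oplus> r' \<otimes> c = \<one>" by auto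
  have "\<pi> [^] Suc k \<oplus> (\<pi> [^] k \<otimes> r \<oplus> r') \<otimes> c = \<pi> [^] k \<otimes> (\<pi> \<oplus> r \<otimes> c) \<oplus> r' \<otimes> c"
    using assms(1-3) r'(1) by (simp add: l_distr r_distr m_ac a_ac)
  also have "\<dots> = \<one>" using assms r' by simp
  finally show ?case using assms r' by (intro bexI[of _ "\<pi> [^] k \<otimes> r \<oplus> r'"]) auto
qed

text \<open>The scalar \<open>x\<close> is, modulo \<open>a\<close>, the idempotent of \<open>R/aR\<close> that belongs to the \<open>\<pp>\<close>-primary part,
  divided by \<open>s\<close>. Among the annihilators of \<open>y\<close> in \<open>R/aR\<close>, \<open>y \<notin> \<pp>\<close>, a maximal one
  contains a power of every \<open>\<pi> \<in> \<pp>\<close>.\<close>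

lemma glue_scalars:
  assumes p: "\<pp> \<in> max_spec R" and s: "s \<in> carrier R" "s \<notin> \<pp>" and a: "a \<in> carrier R" "a \<noteq> \<zero>"
  shows "\<exists>x\<in>carrier R - \<pp>. \<exists>w\<in>carrier R. \<exists>z\<in>carrier R. w \<oplus> x \<otimes> s = \<one> \<and> x \<otimes> w = a \<otimes> z \<and>
    (\<forall>\<qq>\<in>max_spec R. \<qq> \<noteq> \<pp> \<longrightarrow> a \<in> \<qq> \<longrightarrow> x \<in> \<qq>)"
proof -
  define J where "J y = {r \<in> carrier R. y \<otimes> r \<in> PIdl a}" for y
  interpret I: ideal "PIdl a" R by (rule cgenideal_ideal[OF a(1)])
  have "ideal (J y) R" if y: "y \<in> carrier R" for y
  proof (rule idealI[OF ring_axioms])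
    show "subgroup (J y) (add_monoid R)"
      using y I.a_inv_closed
      by unfold_locales (auto simp: J_def r_distr r_minus a_inv_def[symmetric])
  next
    fix r x assume "r \<in> J y" "x \<in> carrier R"
    then have c: "r \<in> carrier R" "x \<in> carrier R" "x \<otimes> (y \<otimes> r) \<in> PIdl a"
      using I.I_l_closed[of "y \<otimes> r" x] by (simp_all add: J_def)
    then show "x \<otimes> r \<in> J y" "r \<otimes> x \<in> J y"
      using y by (simp_all add: J_def m_ac)
  qed
  then have "\<exists>M\<in>J ` (carrier R - \<pp>). \<forall>I\<in>J ` (carrier R - \<pp>). M \<subseteq> I \<longrightarrow> I = M"
    using max_specD(3)[OF p] by (intro exists_maximal_in_family) auto
  then obtain y where y: "y \<in> carrier R" "y \<notin> \<pp>"
    and max: "\<And>y'. y' \<in> carrier R \<Longrightarrow> y' \<notin> \<pp> \<Longrightarrow> J y \<subseteq> J y' \<Longrightarrow> J y' = J y"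
    by auto
  have power: "\<exists>k::nat. y \<otimes> \<pi> [^] k \<in> PIdl a" if \<pi>: "\<pi> \<in> \<pp>" for \<pi>
  proof -
    have \<pi>R: "\<pi> \<in> carrier R" using max_specD(4)[OF p] \<pi> by auto
    obtain y' k where y': "y' \<in> carrier R" "y' \<notin> \<pp>" "y' \<otimes> \<pi> [^] (k::nat) \<in> PIdl a"
      using power_in_local_ideal[OF p a \<pi>] by auto
    \<comment> \<open>Here maximality pays: \<open>y \<otimes> y'\<close> annihilates at least as
      much as \<open>y\<close>, so it annihilates exactly as much. The power of \<pi> killed with
      the help of \<open>y'\<close>, which depends on \<pi>, is therefore killed by the fixed
      \<open>y\<close> alone.\<close>
    have "J y \<subseteq> J (y \<otimes> y')"
    proof
      fix r assume "r \<in> J y"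
      then have "r \<in> carrier R" "y' \<otimes> (y \<otimes> r) \<in> PIdl a"
        using y'(1) I.I_l_closed[of "y \<otimes> r" y'] by (simp_all add: J_def)
      then show "r \<in> J (y \<otimes> y')"
        using y(1) y'(1) by (simp add: J_def m_ac)
    qed
    then have "J (y \<otimes> y') = J y" using max y y' max_spec_mult_notin[OF p] by auto
    moreover have "\<pi> [^] k \<in> J (y \<otimes> y')"
      using y y' \<pi>R I.I_l_closed[of "y' \<otimes> \<pi> [^] k" y] by (simp add: J_def m_assoc)
    ultimately show ?thesis by (auto simp: J_def)
  qed
  have ys: "y \<otimes> s \<in> carrier R" "y \<otimes> s \<notin> \<pp>" using y s max_spec_mult_notin[OF p] by auto
  obtain \<pi> r where \<pi>: "\<pi> \<in> \<pp>" "r \<in> carrier R" "\<pi> \<oplus> r \<otimes> (y \<otimes> s) = \<one>"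
    using inverse_mod_max[OF p ys] by auto
  have \<pi>R: "\<pi> \<in> carrier R" using max_specD(4)[OF p] \<pi> by auto
  obtain k where k: "y \<otimes> \<pi> [^] (k::nat) \<in> PIdl a" using power[OF \<pi>(1)] by auto
  obtain r' where r': "r' \<in> carrier R" "\<pi> [^] Suc k \<oplus> r' \<otimes> (y \<otimes> s) = \<one>"
    using power_complement[OF \<pi>R ys(1) \<pi>(2,3)] by blast
  \<comment> \<open>The exponent is \<open>Suc k\<close> and not \<open>k\<close> so that
    \<open>?w\<close> lies in \<pp> even for \<open>k = 0\<close>; this, with \<open>wx\<close>, is
    what keeps \<open>?x\<close> outside \<pp>. The factor \<open>y\<close> in \<open>?x\<close>
    makes the product of the two divisible by \<open>a\<close>.\<close>
  let ?x = "r' \<otimes> y" and ?w = "\<pi> [^] Suc k"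
  have wx: "?w \<oplus> ?x \<otimes> s = \<one>" using r' y s \<pi>R by (simp add: m_assoc)
  have wp: "?w \<in> \<pp>"
    using \<pi>(1) \<pi>R ideal.I_l_closed[OF max_specD(1)[OF p]] by simp
  have xp: "?x \<notin> \<pp>"
  proof
    assume "?x \<in> \<pp>"
    then have "?x \<otimes> s \<in> \<pp>" by (rule ideal.I_r_closed[OF max_specD(1)[OF p] _ s(1)])
    then have "?w \<oplus> ?x \<otimes> s \<in> \<pp>"
      by (rule additive_subgroup.a_closed[OF ideal.axioms(1)[OF max_specD(1)[OF p]] wp])
    then show False using wx max_specD(3)[OF p] by simp
  qed
  have "?x \<otimes> ?w \<in> PIdl a"
  proof -
    have "?x \<otimes> ?w = (r' \<otimes> \<pi>) \<otimes> (y \<otimes> \<pi> [^] k)" using r'(1) y \<pi>R by (simp add: m_ac)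
    then show ?thesis using k r'(1) \<pi>R I.I_l_closed by simp
  qed
  from this obtain z where z: "z \<in> carrier R" "?x \<otimes> ?w = z \<otimes> a"
    unfolding cgenideal_def by blast
  have xq: "?x \<in> \<qq>" if q: "\<qq> \<in> max_spec R" "\<qq> \<noteq> \<pp>" "a \<in> \<qq>" for \<qq>
  proof -
    \<comment> \<open>Take an element of \<pp> outside \<qq>. The product of \<open>y\<close> with
      one of its powers is divisible by \<open>a\<close>, hence in \<qq>, and primality of \<qq>
      leaves only \<open>y\<close>, thus \<open>?x\<close>, to be in \<qq>.\<close>
    obtain \<pi>' where \<pi>': "\<pi>' \<in> \<pp>" "\<pi>' \<notin> \<qq>" using max_spec_incomparable[OF p q(1)] q(2) by auto
    have \<pi>'R: "\<pi>' \<in> carrier R" using max_specD(4)[OF p] \<pi>' by auto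
    obtain l where "y \<otimes> \<pi>' [^] (l::nat) \<in> PIdl a" using power[OF \<pi>'(1)] by auto
    then have "y \<otimes> \<pi>' [^] l \<in> \<qq>"
      using cgenideal_minimal[OF max_specD(1)[OF q(1)] q(3)] by auto
    then have "y \<in> \<qq>"
      using max_spec_mult_notin[OF q(1) y(1) _ nat_pow_closed[OF \<pi>'R] max_spec_pow_notin[OF q(1) \<pi>'R \<pi>'(2)]]
      by metis
    then show ?thesis by (rule ideal.I_l_closed[OF max_specD(1)[OF q(1)] _ r'(1)])
  qed
  show ?thesis
  proof (intro bexI conjI ballI impI)
    show "?w \<oplus> ?x \<otimes> s = \<one>" by (rule wx)
    show "?x \<otimes> ?w = a \<otimes> z" using z a(1) m_comm by simp
  qed (use xq xp z r'(1) y(1) \<pi>R in auto)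
qed

end

section \<open>Fractions\<close>

text \<open>This and the next two lemmas evaluate operations on classes: a union over
  representatives is a single class once the value is known not to depend on them.\<close>

lemma UN_constant_on: "x\<^sub>0 \<in> X \<Longrightarrow> (\<And>x. x \<in> X \<Longrightarrow> f x = c) \<Longrightarrow> (\<Union>x\<in>X. f x) = c"
  by auto

lemma UN_pair:
  assumes "(a\<^sub>0, s\<^sub>0) \<in> X" "\<And>a s. (a, s) \<in> X \<Longrightarrow> f a s = c"
  shows "(\<Union>(a, s)\<in>X. f a s) = c"
  using assms by fastforce

lemma UN_pairs:
  assumes "(a\<^sub>0, s\<^sub>0) \<in> X" "(b\<^sub>0, t\<^sub>0) \<in> Y"
    "\<And>a s b t. (a, s) \<in> X \<Longrightarrow> (b, t) \<in> Y \<Longrightarrow> f a s b t = c"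
  shows "(\<Union>(a, s)\<in>X. \<Union>(b, t)\<in>Y. f a s b t) = c"
  using assms by fastforce

locale fraction_setting = domain R for R :: "('r, 'k) ring_scheme" (structure) +
  fixes S :: "'r set"
  assumes S_carrier: "S \<subseteq> carrier R"
    and zero_notin_S: "\<zero> \<notin> S"
    and one_in_S: "\<one> \<in> S"
    and S_mult: "\<lbrakk>s \<in> S; t \<in> S\<rbrakk> \<Longrightarrow> s \<otimes> t \<in> S"
begin

abbreviation "fr \<equiv> fraction R S"
abbreviation "F \<equiv> frac_ring R S"

lemma S_closed [simp]: "s \<in> S \<Longrightarrow> s \<in> carrier R"
  using S_carrier by auto

lemma S_nonzero: "s \<in> S \<Longrightarrow> s \<noteq> \<zero>"
  using zero_notin_S by auto

lemma S_pow: "s \<in> S \<Longrightarrow> s [^] (n::nat) \<in> S"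
  by (induction n) (auto simp: one_in_S S_mult)

text \<open>The factor \<open>u\<close> in the definition of \<open>frac_rel\<close> cancels because
  the ring is a domain and \<open>S\<close> avoids zero. Cross multiplication is all that
  remains.\<close>

lemma frac_rel_iff:
  assumes "a \<in> carrier R" "s \<in> S" "b \<in> carrier R" "t \<in> S"
  shows "((a, s), (b, t)) \<in> frac_rel R S \<longleftrightarrow> a \<otimes> t = b \<otimes> s"
proof -
  have "(\<exists>u\<in>S. u \<otimes> (a \<otimes> t \<ominus> b \<otimes> s) = \<zero>) \<longleftrightarrow> a \<otimes> t = b \<otimes> s"
  proof
    assume "\<exists>u\<in>S. u \<otimes> (a \<otimes> t \<ominus> b \<otimes> s) = \<zero>"
    then obtain u where u: "u \<in> S" "u \<otimes> (a \<otimes> t \<ominus> b \<otimes> s) = \<zero>" by auto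
    then have "a \<otimes> t \<ominus> b \<otimes> s = \<zero>"
      using integral[of u "a \<otimes> t \<ominus> b \<otimes> s"] assms zero_notin_S by auto
    then show "a \<otimes> t = b \<otimes> s"
      using assms by (simp add: r_right_minus_eq)
  next
    assume "a \<otimes> t = b \<otimes> s"
    then show "\<exists>u\<in>S. u \<otimes> (a \<otimes> t \<ominus> b \<otimes> s) = \<zero>"
      using assms one_in_S by (intro bexI[of _ \<one>]) (auto simp: r_right_minus_eq)
  qed
  then show ?thesis
    using assms by (auto simp: frac_rel_def)
qed

lemma mem_frac_iff:
  assumes "a \<in> carrier R" "s \<in> S"
  shows "(b, t) \<in> fr a s \<longleftrightarrow> b \<in> carrier R \<and> t \<in> S \<and> a \<otimes> t = b \<otimes> s"
proof (cases "b \<in> carrier R \<and> t \<in> S")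
  case True
  then show ?thesis
    using frac_rel_iff[of a s b t] assms by (simp add: fraction_def)
next
  case False
  then show ?thesis by (auto simp: fraction_def frac_rel_def)
qed

lemma frac_eq_iff:
  assumes "a \<in> carrier R" "s \<in> S" "b \<in> carrier R" "t \<in> S"
  shows "fr a s = fr b t \<longleftrightarrow> a \<otimes> t = b \<otimes> s"
proof
  assume "fr a s = fr b t"
  moreover have "(b, t) \<in> fr b t" using assms by (simp add: mem_frac_iff)
  ultimately have "(b, t) \<in> fr a s" by simp
  then show "a \<otimes> t = b \<otimes> s" using assms by (simp add: mem_frac_iff)
next
  assume eq: "a \<otimes> t = b \<otimes> s"
  have "a \<otimes> w = c \<otimes> s \<longleftrightarrow> b \<otimes> w = c \<otimes> t" if "c \<in> carrier R" "w \<in> S" for c w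
  proof -
    have st: "s \<in> carrier R" "t \<in> carrier R" "w \<in> carrier R" "s \<noteq> \<zero>" "t \<noteq> \<zero>"
      using assms that zero_notin_S by auto
    have "a \<otimes> w = c \<otimes> s \<longleftrightarrow> t \<otimes> (a \<otimes> w) = t \<otimes> (c \<otimes> s)"
      using st assms that m_lcancel by auto
    also have "\<dots> \<longleftrightarrow> s \<otimes> (b \<otimes> w) = s \<otimes> (c \<otimes> t)"
    proof -
      have "t \<otimes> (a \<otimes> w) = (a \<otimes> t) \<otimes> w" using st assms by (simp add: m_ac)
      also have "\<dots> = s \<otimes> (b \<otimes> w)" unfolding eq using st assms by (simp add: m_ac)
      finally show ?thesis using st assms that by (simp add: m_ac)
    qed
    also have "\<dots> \<longleftrightarrow> b \<otimes> w = c \<otimes> t"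
      using st assms that m_lcancel by auto
    finally show ?thesis .
  qed
  then show "fr a s = fr b t"
    using assms by (auto simp: mem_frac_iff)
qed

lemma carrier_F: "carrier F = {fr a s | a s. a \<in> carrier R \<and> s \<in> S}"
  by (auto simp: frac_ring_def quotient_def fraction_def)

lemma frac_closed [simp]: "a \<in> carrier R \<Longrightarrow> s \<in> S \<Longrightarrow> fr a s \<in> carrier F"
  by (auto simp: carrier_F)

lemma frac_E:
  assumes "x \<in> carrier F"
  obtains a s where "a \<in> carrier R" "s \<in> S" "x = fr a s"
  using assms by (auto simp: carrier_F)

lemma frac_mult:
  assumes "a \<in> carrier R" "s \<in> S" "b \<in> carrier R" "t \<in> S"
  shows "fr a s \<otimes>\<^bsub>F\<^esub> fr b t = fr (a \<otimes> b) (s \<otimes> t)"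
proof -
  have "fr (a' \<otimes> b') (s' \<otimes> t') = fr (a \<otimes> b) (s \<otimes> t)"
    if "(a', s') \<in> fr a s" "(b', t') \<in> fr b t" for a' s' b' t'
  proof -
    have c: "a' \<in> carrier R" "s' \<in> S" "a \<otimes> s' = a' \<otimes> s"
      "b' \<in> carrier R" "t' \<in> S" "b \<otimes> t' = b' \<otimes> t"
      using that assms by (auto simp: mem_frac_iff)
    have "(a' \<otimes> b') \<otimes> (s \<otimes> t) = (a' \<otimes> s) \<otimes> (b' \<otimes> t)"
      using c(1,2,4,5) assms by (simp add: m_ac)
    also have "\<dots> = (a \<otimes> s') \<otimes> (b \<otimes> t')" using c by simp
    also have "\<dots> = (a \<otimes> b) \<otimes> (s' \<otimes> t')" using c(1,2,4,5) assms by (simp add: m_ac)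
    finally show ?thesis
      using c assms by (subst frac_eq_iff) (auto intro: S_mult)
  qed
  note rep_indep = this
  have reps: "(a, s) \<in> fr a s" "(b, t) \<in> fr b t"
    using assms by (auto simp: mem_frac_iff)
  show ?thesis
    by (simp add: frac_ring_def) (rule UN_pairs[OF reps rep_indep])
qed

lemma frac_add:
  assumes "a \<in> carrier R" "s \<in> S" "b \<in> carrier R" "t \<in> S"
  shows "fr a s \<oplus>\<^bsub>F\<^esub> fr b t = fr (a \<otimes> t \<oplus> b \<otimes> s) (s \<otimes> t)"
proof -
  have "fr (a' \<otimes> t' \<oplus> b' \<otimes> s') (s' \<otimes> t') = fr (a \<otimes> t \<oplus> b \<otimes> s) (s \<otimes> t)"
    if "(a', s') \<in> fr a s" "(b', t') \<in> fr b t" for a' s' b' t'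
  proof -
    have c: "a' \<in> carrier R" "s' \<in> S" "a \<otimes> s' = a' \<otimes> s"
      "b' \<in> carrier R" "t' \<in> S" "b \<otimes> t' = b' \<otimes> t"
      using that assms by (auto simp: mem_frac_iff)
    have "(a' \<otimes> t' \<oplus> b' \<otimes> s') \<otimes> (s \<otimes> t) = (a' \<otimes> s) \<otimes> (t \<otimes> t') \<oplus> (b' \<otimes> t) \<otimes> (s \<otimes> s')"
      using c(1,2,4,5) assms by (simp add: m_ac l_distr r_distr)
    also have "\<dots> = (a \<otimes> s') \<otimes> (t \<otimes> t') \<oplus> (b \<otimes> t') \<otimes> (s \<otimes> s')" using c by simp
    also have "\<dots> = (a \<otimes> t \<oplus> b \<otimes> s) \<otimes> (s' \<otimes> t')" using c(1,2,4,5) assms by (simp add: m_ac l_distr r_distr)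
    finally show ?thesis
      using c assms by (subst frac_eq_iff) (auto intro: S_mult)
  qed
  note rep_indep = this
  have reps: "(a, s) \<in> fr a s" "(b, t) \<in> fr b t"
    using assms by (auto simp: mem_frac_iff)
  show ?thesis
    by (simp add: frac_ring_def) (rule UN_pairs[OF reps rep_indep])
qed

lemma one_F: "\<one>\<^bsub>F\<^esub> = fr \<one> \<one>" and zero_F: "\<zero>\<^bsub>F\<^esub> = fr \<zero> \<one>"
  by (auto simp: frac_ring_def)

lemma frac_emb: "frac_emb R S r = fr r \<one>"
  by (simp add: frac_emb_def)

lemma F_mult_closed [simp]: "x \<in> carrier F \<Longrightarrow> y \<in> carrier F \<Longrightarrow> x \<otimes>\<^bsub>F\<^esub> y \<in> carrier F"
  by (elim frac_E) (auto simp: frac_mult S_mult)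

lemma F_add_closed [simp]: "x \<in> carrier F \<Longrightarrow> y \<in> carrier F \<Longrightarrow> x \<oplus>\<^bsub>F\<^esub> y \<in> carrier F"
  by (elim frac_E) (auto simp: frac_add S_mult)

lemma frac_emb_closed [simp]: "r \<in> carrier R \<Longrightarrow> frac_emb R S r \<in> carrier F"
  by (auto simp: frac_emb one_in_S)

lemma F_mult_comm: "x \<in> carrier F \<Longrightarrow> y \<in> carrier F \<Longrightarrow> x \<otimes>\<^bsub>F\<^esub> y = y \<otimes>\<^bsub>F\<^esub> x"
  by (elim frac_E) (auto simp: frac_mult m_comm)

lemma F_mult_assoc:
  "x \<in> carrier F \<Longrightarrow> y \<in> carrier F \<Longrightarrow> z \<in> carrier F \<Longrightarrow> (x \<otimes>\<^bsub>F\<^esub> y) \<otimes>\<^bsub>F\<^esub> z = x \<otimes>\<^bsub>F\<^esub> (y \<otimes>\<^bsub>F\<^esub> z)"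
  by (elim frac_E) (auto simp: frac_mult m_assoc S_mult)

lemma F_mult_left_comm:
  assumes "x \<in> carrier F" "y \<in> carrier F" "z \<in> carrier F"
  shows "x \<otimes>\<^bsub>F\<^esub> (y \<otimes>\<^bsub>F\<^esub> z) = y \<otimes>\<^bsub>F\<^esub> (x \<otimes>\<^bsub>F\<^esub> z)"
  using assms by (metis F_mult_assoc F_mult_comm)

lemma F_l_distr:
  assumes "x \<in> carrier F" "y \<in> carrier F" "z \<in> carrier F"
  shows "(x \<oplus>\<^bsub>F\<^esub> y) \<otimes>\<^bsub>F\<^esub> z = x \<otimes>\<^bsub>F\<^esub> z \<oplus>\<^bsub>F\<^esub> y \<otimes>\<^bsub>F\<^esub> z"
proof -
  obtain a s b t c w where c: "a \<in> carrier R" "s \<in> S" "b \<in> carrier R" "t \<in> S" "c \<in> carrier R" "w \<in> S"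
    and eq: "x = fr a s" "y = fr b t" "z = fr c w"
    using assms by (meson frac_E)
  have "((a \<otimes> t \<oplus> b \<otimes> s) \<otimes> c) \<otimes> ((s \<otimes> w) \<otimes> (t \<otimes> w)) =
      ((a \<otimes> c) \<otimes> (t \<otimes> w) \<oplus> (b \<otimes> c) \<otimes> (s \<otimes> w)) \<otimes> ((s \<otimes> t) \<otimes> w)"
    using c by (simp add: l_distr r_distr m_ac)
  then show ?thesis
    using c unfolding eq by (simp add: frac_mult frac_add S_mult frac_eq_iff)
qed

lemma F_r_distr:
  assumes "x \<in> carrier F" "y \<in> carrier F" "z \<in> carrier F"
  shows "z \<otimes>\<^bsub>F\<^esub> (x \<oplus>\<^bsub>F\<^esub> y) = z \<otimes>\<^bsub>F\<^esub> x \<oplus>\<^bsub>F\<^esub> z \<otimes>\<^bsub>F\<^esub> y"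
  using F_l_distr[of x y z] assms by (simp add: F_mult_comm)

end

section \<open>Modules of fractions as tensor products\<close>

text \<open>The biadditive extension nests one \<open>frag_extend\<close> in another, and its right
  argument sits inside the function of the outer one. Additivity there needs additivity in the
  function.\<close>

lemma frag_extend_fun_diff:
  "frag_extend (\<lambda>x. f x - g x) c = frag_extend f c - frag_extend g c"
  using subset_UNIV by (induction c rule: frag_induction) (auto simp: frag_extend_diff)

lemma frag_extend_fun_zero: "frag_extend (\<lambda>x. 0) c = 0"
  by (rule frag_extend_eq_0) auto

lemma keys_diff_subset:
  "Poly_Mapping.keys c \<subseteq> A \<Longrightarrow> Poly_Mapping.keys d \<subseteq> A \<Longrightarrow> Poly_Mapping.keys (c - d) \<subseteq> A"
  using keys_diff[of c d] by auto

lemma keys_add_subset: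
  "Poly_Mapping.keys c \<subseteq> A \<Longrightarrow> Poly_Mapping.keys d \<subseteq> A \<Longrightarrow> Poly_Mapping.keys (c + d) \<subseteq> A"
  using keys_add[of c d] by auto

lemma tens_relsE:
  assumes "c \<in> tens_rels R S \<phi> M"
  obtains (add_left) x y m where "x \<in> carrier S" "y \<in> carrier S" "m \<in> carrier M"
      "c = frag_of (x \<oplus>\<^bsub>S\<^esub> y, m) - frag_of (x, m) - frag_of (y, m)"
    | (add_right) x m n where "x \<in> carrier S" "m \<in> carrier M" "n \<in> carrier M"
      "c = frag_of (x, m \<oplus>\<^bsub>M\<^esub> n) - frag_of (x, m) - frag_of (x, n)"
    | (smult) r x m where "r \<in> carrier R" "x \<in> carrier S" "m \<in> carrier M"
      "c = frag_of (\<phi> r \<otimes>\<^bsub>S\<^esub> x, m) - frag_of (x, r \<odot>\<^bsub>M\<^esub> m)"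
  using assms unfolding tens_rels_def by blast

lemma (in abelian_group) minus_eq_zero_iff:
  "a \<in> carrier G \<Longrightarrow> b \<in> carrier G \<Longrightarrow> a \<ominus> b = \<zero> \<longleftrightarrow> a = b"
  using add.inv_equality[of a "\<ominus> b"] by (auto simp: minus_eq r_neg)

lemma (in module) smult_r_diff:
  "\<lbrakk>a \<in> carrier R; x \<in> carrier M; y \<in> carrier M\<rbrakk> \<Longrightarrow>
    a \<odot>\<^bsub>M\<^esub> (x \<ominus>\<^bsub>M\<^esub> y) = a \<odot>\<^bsub>M\<^esub> x \<ominus>\<^bsub>M\<^esub> a \<odot>\<^bsub>M\<^esub> y"
  by (simp add: M.minus_eq smult_r_distr smult_r_minus)

text \<open>The fraction m/s, realised as the pure tensor of 1/s and m. Every element of the tensor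
  product turns out to have this form, so the localised module can be handled by numerators and
  denominators.\<close>

definition mfrac ::
  "('r, 'k) ring_scheme \<Rightarrow> 'r set \<Rightarrow> ('r, 'm) module \<Rightarrow> 'm \<Rightarrow> 'r \<Rightarrow> (('r \<times> 'r) set, 'm) tens"
where
  "mfrac R S M m s = tens_class R (frac_ring R S) (frac_emb R S) M (frag_of (fraction R S \<one>\<^bsub>R\<^esub> s, m))"

locale fraction_module = fraction_setting R S + M: module R M
  for R :: "('r, 'k) ring_scheme" (structure) and S and M :: "('r, 'm) module"
begin

abbreviation "G \<equiv> pair_group F M"
abbreviation "K \<equiv> generate G (tens_rels R F (frac_emb R S) M)"
abbreviation "cls \<equiv> tens_class R F (frac_emb R S) M"
abbreviation "T \<equiv> tens_module R F (frac_emb R S) M"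

abbreviation "mfr \<equiv> mfrac R S M"

lemma mfr_def: "mfr m s = cls (frag_of (fr \<one> s, m))"
  by (rule mfrac_def)

sublocale G: comm_group G
  by (rule abelian_free_Abelian_group)

lemma rels_carrier: "tens_rels R F (frac_emb R S) M \<subseteq> carrier G"
  unfolding tens_rels_def carrier_free_Abelian_group_iff
  by (intro subsetI; simp; elim disjE exE conjE; hypsubst; intro keys_diff_subset; auto)

lemma K_subgroup: "subgroup K G"
  by (rule G.generate_is_subgroup[OF rels_carrier])

lemma K_carrier: "c \<in> K \<Longrightarrow> Poly_Mapping.keys c \<subseteq> carrier F \<times> carrier M"
  using subgroup.mem_carrier[OF K_subgroup, of c] by simp

lemma K_zero: "0 \<in> K"
  using subgroup.one_closed[OF K_subgroup] by simp

lemma K_add: "c \<in> K \<Longrightarrow> d \<in> K \<Longrightarrow> c + d \<in> K"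
  using subgroup.m_closed[OF K_subgroup] by simp

lemma K_minus: "c \<in> K \<Longrightarrow> - c \<in> K"
  using subgroup.m_inv_closed[OF K_subgroup, of c] K_carrier[of c] by simp

lemma K_diff: "c \<in> K \<Longrightarrow> d \<in> K \<Longrightarrow> c - d \<in> K"
  using K_add[of c "- d"] K_minus[of d] by simp

lemma K_rel: "c \<in> tens_rels R F (frac_emb R S) M \<Longrightarrow> c \<in> K"
  by (rule generate.incl)

text \<open>Differences alone build the subgroup from its generators, since 0 - h is the inverse of
  h. A claim about additive maps thus has to be checked only on the three kinds of defining
  relation.\<close>

lemma K_induct [consumes 1, case_names rel diff]:
  assumes "c \<in> K" and rel: "\<And>c. c \<in> tens_rels R F (frac_emb R S) M \<Longrightarrow> P c"
    and diff: "\<And>c d. P c \<Longrightarrow> P d \<Longrightarrow> P (c - d)" and zero: "P 0"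
  shows "P c"
  using assms(1)
proof (induction rule: generate.induct)
  case one
  then show ?case using zero by simp
next
  case (incl h)
  then show ?case by (rule rel)
next
  case (inv h)
  then have "Poly_Mapping.keys h \<subseteq> carrier F \<times> carrier M"
    using subsetD[OF rels_carrier, of h] by simp
  moreover have "P (0 - h)" using zero rel[OF inv] diff by blast
  ultimately show ?case by simp
next
  case (eng g h)
  have "P (g - (0 - h))" using eng diff zero by blast
  then show ?case by simp
qed

lemma cls_mem: "d \<in> cls c \<longleftrightarrow> d - c \<in> K"
proof
  assume "d \<in> cls c"
  then show "d - c \<in> K" by (auto simp: tens_class_def r_coset_def)
next
  assume "d - c \<in> K"
  then show "d \<in> cls c"
    by (auto simp: tens_class_def r_coset_def intro!: bexI[of _ "d - c"])
qed

lemma cls_self: "c \<in> cls c"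
  by (simp add: cls_mem K_zero)

lemma cls_eq_iff: "cls c = cls d \<longleftrightarrow> c - d \<in> K"
proof
  assume "cls c = cls d"
  then show "c - d \<in> K" using cls_self[of c] by (simp add: cls_mem)
next
  assume cd: "c - d \<in> K"
  have "x - c \<in> K \<longleftrightarrow> x - d \<in> K" for x
    using K_add[OF cd, of "x - c"] K_diff[OF _ cd, of "x - d"] by (auto simp: algebra_simps)
  then show "cls c = cls d" by (auto simp: cls_mem)
qed

lemma carrier_T: "carrier T = {cls c | c. Poly_Mapping.keys c \<subseteq> carrier F \<times> carrier M}"
  by (auto simp: tens_module_def Let_def FactGroup_def RCOSETS_def tens_class_def)

lemma zero_T: "\<zero>\<^bsub>T\<^esub> = cls 0"
  by (auto simp: tens_module_def Let_def FactGroup_def cls_mem)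

lemma add_T:
  assumes "Poly_Mapping.keys c \<subseteq> carrier F \<times> carrier M" "Poly_Mapping.keys d \<subseteq> carrier F \<times> carrier M"
  shows "cls c \<oplus>\<^bsub>T\<^esub> cls d = cls (c + d)"
proof -
  have "K \<lhd> G" by (rule G.subgroup_imp_normal[OF K_subgroup])
  then have "cls c <#>\<^bsub>G\<^esub> cls d = cls (c + d)"
    using normal.rcos_sum[of K G c d] assms by (simp add: tens_class_def)
  then show ?thesis by (simp add: tens_module_def Let_def FactGroup_def)
qed

lemma T_abelian_group: "abelian_group T"
proof (rule abelian_groupI)
  show "\<zero>\<^bsub>T\<^esub> \<in> carrier T" by (auto simp: carrier_T zero_T)
next
  fix x assume "x \<in> carrier T"
  then obtain c where c: "Poly_Mapping.keys c \<subseteq> carrier F \<times> carrier M" "x = cls c"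
    by (auto simp: carrier_T)
  then show "\<zero>\<^bsub>T\<^esub> \<oplus>\<^bsub>T\<^esub> x = x" by (simp add: zero_T add_T)
  have "cls (- c) \<oplus>\<^bsub>T\<^esub> x = \<zero>\<^bsub>T\<^esub>" "cls (- c) \<in> carrier T"
    using c by (auto simp: zero_T add_T carrier_T intro!: exI[of _ "- c"])
  then show "\<exists>y\<in>carrier T. y \<oplus>\<^bsub>T\<^esub> x = \<zero>\<^bsub>T\<^esub>" by blast
next
  fix x y assume "x \<in> carrier T" "y \<in> carrier T"
  then obtain c d where c: "Poly_Mapping.keys c \<subseteq> carrier F \<times> carrier M" "x = cls c"
      "Poly_Mapping.keys d \<subseteq> carrier F \<times> carrier M" "y = cls d"
    by (auto simp: carrier_T)
  then show "x \<oplus>\<^bsub>T\<^esub> y \<in> carrier T"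
    using keys_add_subset[OF c(1,3)] by (auto simp: add_T carrier_T)
  show "x \<oplus>\<^bsub>T\<^esub> y = y \<oplus>\<^bsub>T\<^esub> x" using c by (simp add: add_T add.commute)
next
  fix x y z assume "x \<in> carrier T" "y \<in> carrier T" "z \<in> carrier T"
  then obtain c d e where c: "Poly_Mapping.keys c \<subseteq> carrier F \<times> carrier M" "x = cls c"
      "Poly_Mapping.keys d \<subseteq> carrier F \<times> carrier M" "y = cls d"
      "Poly_Mapping.keys e \<subseteq> carrier F \<times> carrier M" "z = cls e"
    by (auto simp: carrier_T)
  then show "x \<oplus>\<^bsub>T\<^esub> y \<oplus>\<^bsub>T\<^esub> z = x \<oplus>\<^bsub>T\<^esub> (y \<oplus>\<^bsub>T\<^esub> z)"
    by (simp add: add_T keys_add_subset add.assoc)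
qed

lemma rel_add_left:
  "\<lbrakk>x \<in> carrier F; y \<in> carrier F; m \<in> carrier M\<rbrakk> \<Longrightarrow>
    frag_of (x \<oplus>\<^bsub>F\<^esub> y, m) - frag_of (x, m) - frag_of (y, m) \<in> K"
  by (rule K_rel) (auto simp: tens_rels_def)

lemma rel_add_right:
  "\<lbrakk>x \<in> carrier F; m \<in> carrier M; n \<in> carrier M\<rbrakk> \<Longrightarrow>
    frag_of (x, m \<oplus>\<^bsub>M\<^esub> n) - frag_of (x, m) - frag_of (x, n) \<in> K"
  by (rule K_rel) (auto simp: tens_rels_def)

lemma rel_smult:
  "\<lbrakk>r \<in> carrier R; x \<in> carrier F; m \<in> carrier M\<rbrakk> \<Longrightarrow>
    frag_of (frac_emb R S r \<otimes>\<^bsub>F\<^esub> x, m) - frag_of (x, r \<odot>\<^bsub>M\<^esub> m) \<in> K"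
  by (rule K_rel) (auto simp: tens_rels_def)

lemma mfr_add:
  assumes "m \<in> carrier M" "n \<in> carrier M" "s \<in> S"
  shows "mfr m s \<oplus>\<^bsub>T\<^esub> mfr n s = mfr (m \<oplus>\<^bsub>M\<^esub> n) s"
proof -
  have "frag_of (fr \<one> s, m) + frag_of (fr \<one> s, n) - frag_of (fr \<one> s, m \<oplus>\<^bsub>M\<^esub> n) \<in> K"
    using K_minus[OF rel_add_right[of "fr \<one> s" m n]] assms by (simp add: algebra_simps)
  then show ?thesis
    using assms by (simp add: mfr_def add_T cls_eq_iff)
qed

text \<open>The third kind of relation moves the numerator \<open>a\<close> across the tensor sign,
  leaving 1/s on the left.\<close>

lemma cls_frag_of:
  assumes "a \<in> carrier R" "s \<in> S" "m \<in> carrier M"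
  shows "cls (frag_of (fr a s, m)) = mfr (a \<odot>\<^bsub>M\<^esub> m) s"
proof -
  have "frac_emb R S a \<otimes>\<^bsub>F\<^esub> fr \<one> s = fr a s"
    using assms by (simp add: frac_emb frac_mult one_in_S)
  then show ?thesis
    using rel_smult[of a "fr \<one> s" m] assms by (simp add: mfr_def cls_eq_iff)
qed

lemma mfr_cancel:
  assumes "m \<in> carrier M" "s \<in> S" "t \<in> S"
  shows "mfr (t \<odot>\<^bsub>M\<^esub> m) (s \<otimes> t) = mfr m s"
proof -
  have "fr t (s \<otimes> t) = fr \<one> s"
    using assms by (subst frac_eq_iff) (auto simp: S_mult m_comm)
  then show ?thesis
    using cls_frag_of[of t "s \<otimes> t" m] assms by (simp add: S_mult mfr_def)
qed

lemma mfr_closed [simp]: "m \<in> carrier M \<Longrightarrow> s \<in> S \<Longrightarrow> mfr m s \<in> carrier T"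
  by (auto simp: mfr_def carrier_T)

lemma mfr_zero: "s \<in> S \<Longrightarrow> mfr \<zero>\<^bsub>M\<^esub> s = \<zero>\<^bsub>T\<^esub>"
proof -
  assume s: "s \<in> S"
  interpret T: abelian_group T by (rule T_abelian_group)
  have "mfr \<zero>\<^bsub>M\<^esub> s \<oplus>\<^bsub>T\<^esub> mfr \<zero>\<^bsub>M\<^esub> s = mfr \<zero>\<^bsub>M\<^esub> s"
    using s by (simp add: mfr_add)
  then show ?thesis
    using s T.add.r_cancel_one[of "mfr \<zero>\<^bsub>M\<^esub> s" "mfr \<zero>\<^bsub>M\<^esub> s"] by auto
qed

lemma mfr_minus:
  assumes "m \<in> carrier M" "s \<in> S"
  shows "cls (- frag_of (fr \<one> s, m)) = mfr (\<ominus>\<^bsub>M\<^esub> m) s"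
proof -
  have "mfr m s \<oplus>\<^bsub>T\<^esub> mfr (\<ominus>\<^bsub>M\<^esub> m) s = \<zero>\<^bsub>T\<^esub>"
    using assms by (simp add: mfr_add mfr_zero M.r_neg)
  then have "cls (frag_of (fr \<one> s, m) + frag_of (fr \<one> s, \<ominus>\<^bsub>M\<^esub> m)) = cls 0"
    using assms by (simp add: mfr_def add_T zero_T)
  then have "frag_of (fr \<one> s, m) + frag_of (fr \<one> s, \<ominus>\<^bsub>M\<^esub> m) \<in> K"
    by (simp add: cls_eq_iff)
  then have "- frag_of (fr \<one> s, m) - frag_of (fr \<one> s, \<ominus>\<^bsub>M\<^esub> m) \<in> K"
    using K_minus by force
  then show ?thesis by (simp add: mfr_def cls_eq_iff)
qed

text \<open>Induction over the free group: a difference of two fractions is again one fraction over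
  the common denominator \<open>s \<otimes> t\<close>, so sums of pure tensors collapse.\<close>

lemma cls_cases:
  assumes "Poly_Mapping.keys c \<subseteq> carrier F \<times> carrier M"
  shows "\<exists>m\<in>carrier M. \<exists>s\<in>S. cls c = mfr m s"
  using assms
proof (induction c rule: free_Abelian_group_induct[consumes 1, case_names zero diff of])
  case zero
  show ?case
    using mfr_zero[OF one_in_S] one_in_S by (auto simp: zero_T intro!: bexI[of _ "\<zero>\<^bsub>M\<^esub>"])
next
  case (diff x y)
  then obtain m s n t where c: "m \<in> carrier M" "s \<in> S" "cls x = mfr m s"
      "n \<in> carrier M" "t \<in> S" "cls y = mfr n t"
    by auto
  have "x - frag_of (fr \<one> s, m) \<in> K" "y - frag_of (fr \<one> t, n) \<in> K"
    using c by (auto simp: mfr_def cls_eq_iff)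
  from K_diff[OF this] have "cls (x - y) = cls (frag_of (fr \<one> s, m) + (- frag_of (fr \<one> t, n)))"
    by (simp add: cls_eq_iff algebra_simps)
  also have "\<dots> = mfr m s \<oplus>\<^bsub>T\<^esub> mfr (\<ominus>\<^bsub>M\<^esub> n) t"
    using c by (subst add_T[symmetric]) (auto simp: mfr_minus mfr_def[symmetric])
  also have "\<dots> = mfr (t \<odot>\<^bsub>M\<^esub> m) (s \<otimes> t) \<oplus>\<^bsub>T\<^esub> mfr (s \<odot>\<^bsub>M\<^esub> (\<ominus>\<^bsub>M\<^esub> n)) (t \<otimes> s)"
    using c by (simp add: mfr_cancel)
  also have "\<dots> = mfr (t \<odot>\<^bsub>M\<^esub> m \<oplus>\<^bsub>M\<^esub> s \<odot>\<^bsub>M\<^esub> (\<ominus>\<^bsub>M\<^esub> n)) (s \<otimes> t)"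
    using c by (simp add: m_comm[of t s] mfr_add S_mult)
  finally show ?case
    using c by (intro bexI[of _ "t \<odot>\<^bsub>M\<^esub> m \<oplus>\<^bsub>M\<^esub> s \<odot>\<^bsub>M\<^esub> (\<ominus>\<^bsub>M\<^esub> n)"] bexI[of _ "s \<otimes> t"]) (auto simp: S_mult)
next
  case (of a)
  then obtain x m where a: "a = (x, m)" "x \<in> carrier F" "m \<in> carrier M" by auto
  then obtain b s where "x = fr b s" "b \<in> carrier R" "s \<in> S" by (meson frac_E)
  then show ?case
    using a cls_frag_of[of b s m] by auto
qed

lemma T_cases:
  assumes "x \<in> carrier T"
  obtains m s where "m \<in> carrier M" "s \<in> S" "x = mfr m s"
  using assms cls_cases unfolding carrier_T by blast

text \<open>The numerator of \<open>x\<close> over the denominator \<open>t\<close>, meaningful only if \<open>t x\<close> lies in \<open>R\<close>.\<close>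

definition numer :: "('r \<times> 'r) set \<Rightarrow> 'r \<Rightarrow> 'r" where
  "numer x t = (if \<exists>r\<in>carrier R. fr r t = x then SOME r. r \<in> carrier R \<and> fr r t = x else \<zero>)"

lemma numer_closed [simp]: "numer x t \<in> carrier R"
proof (cases "\<exists>r\<in>carrier R. fr r t = x")
  case True
  then have "\<exists>r. r \<in> carrier R \<and> fr r t = x" by auto
  from someI_ex[OF this] show ?thesis using True by (simp add: numer_def)
qed (auto simp: numer_def)

lemma numer_frac:
  assumes "r \<in> carrier R" "t \<in> S"
  shows "numer (fr r t) t = r"
proof -
  have "fr r' t = fr r t \<longleftrightarrow> r' = r" if "r' \<in> carrier R" for r'
    using assms that S_nonzero[of t] m_rcancel[of t r' r] by (auto simp: frac_eq_iff)
  then have "(SOME r'. r' \<in> carrier R \<and> fr r' t = fr r t) = r"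
    using assms by (intro some_equality) auto
  then show ?thesis using assms by (auto simp: numer_def)
qed

lemma numer_frac_mult:
  assumes "a \<in> carrier R" "s \<in> S" "v \<in> S"
  shows "numer (fr a s) (s \<otimes> v) = a \<otimes> v"
proof -
  have "fr a s = fr (a \<otimes> v) (s \<otimes> v)"
    using assms by (subst frac_eq_iff) (auto simp: S_mult m_ac)
  then show ?thesis using assms by (simp add: numer_frac S_mult)
qed

text \<open>Evaluating \<open>x \<otimes> m\<close> as \<open>t x m\<close> kills the relations as soon as \<open>t\<close> is sufficiently
  divisible, so \<open>1 \<otimes> m\<close> can only vanish if \<open>m\<close> is annihilated by an element of \<open>S\<close>.\<close>

lemma one_tensor_eq_zero:
  assumes m: "m \<in> carrier M" and "frag_of (fr \<one> \<one>, m) \<in> K"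
  shows "\<exists>u\<in>S. u \<odot>\<^bsub>M\<^esub> m = \<zero>\<^bsub>M\<^esub>"
proof -
  \<comment> \<open>By the universal property of the free group each \<open>t\<close> gives a
    homomorphism sending the pair (x, m) to (t x) m, with a default value where t x is not in the
    ring.\<close>
  have "\<exists>h. h \<in> hom G (add_monoid M) \<and>
      (\<forall>p\<in>carrier F \<times> carrier M. h (frag_of p) = numer (fst p) t \<odot>\<^bsub>M\<^esub> snd p)" for t
  proof -
    have "(\<lambda>p. numer (fst p) t \<odot>\<^bsub>M\<^esub> snd p) ` (carrier F \<times> carrier M) \<subseteq> carrier (add_monoid M)"
      by auto
    from comm_group.free_Abelian_group_universal[OF M.a_comm_group this] show ?thesis by metis
  qed
  then obtain h where h: "\<And>t. h t \<in> hom G (add_monoid M)"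
    and h_of: "\<And>t p. p \<in> carrier F \<times> carrier M \<Longrightarrow> h t (frag_of p) = numer (fst p) t \<odot>\<^bsub>M\<^esub> snd p"
    by metis
  have h_closed: "h t c \<in> carrier M" if "Poly_Mapping.keys c \<subseteq> carrier F \<times> carrier M" for t c
    using hom_in_carrier[OF h[of t], of c] that by simp
  have h_add: "h t (c + d) = h t c \<oplus>\<^bsub>M\<^esub> h t d"
    if "Poly_Mapping.keys c \<subseteq> carrier F \<times> carrier M" "Poly_Mapping.keys d \<subseteq> carrier F \<times> carrier M" for t c d
    using hom_mult[OF h[of t], of c d] that by simp
  have h_diff_add: "h t (c - d) \<oplus>\<^bsub>M\<^esub> h t d = h t c"
    if "Poly_Mapping.keys c \<subseteq> carrier F \<times> carrier M" "Poly_Mapping.keys d \<subseteq> carrier F \<times> carrier M" for t c d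
    using h_add[of "c - d" d t] that by (simp add: keys_diff_subset)
  have h_zero: "h t 0 = \<zero>\<^bsub>M\<^esub>" for t
    using h_add[of 0 0 t] h_closed[of 0 t] by simp
  have h_diff_zero: "h t (c - d) = \<zero>\<^bsub>M\<^esub>"
    if "Poly_Mapping.keys c \<subseteq> carrier F \<times> carrier M" "Poly_Mapping.keys d \<subseteq> carrier F \<times> carrier M" "h t c = h t d" for t c d
    using h_diff_add[of c d t] that h_closed[of d t] h_closed[of "c - d" t]
    by (auto simp: keys_diff_subset)
  \<comment> \<open>A relation is killed at \<open>t\<close> only if \<open>t\<close> clears its
    denominators, and no single \<open>t\<close> does so for all relations. Hence the demand is
    vanishing at all multiples of some threshold \<open>s\<close>; thresholds of two elements
    combine to their product.\<close>
  define P where "P c \<longleftrightarrow> Poly_Mapping.keys c \<subseteq> carrier F \<times> carrier M \<and>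
    (\<exists>s\<in>S. \<forall>v\<in>S. h (s \<otimes> v) c = \<zero>\<^bsub>M\<^esub>)" for c
  have P_three: "P (frag_of p - frag_of q - frag_of q')"
    if "p \<in> carrier F \<times> carrier M" "q \<in> carrier F \<times> carrier M" "q' \<in> carrier F \<times> carrier M"
      "s \<in> S" "\<And>v. v \<in> S \<Longrightarrow> h (s \<otimes> v) (frag_of p) = h (s \<otimes> v) (frag_of q) \<oplus>\<^bsub>M\<^esub> h (s \<otimes> v) (frag_of q')"
    for p q q' s
  proof -
    note pqs = that
    have k: "Poly_Mapping.keys (frag_of q + frag_of q') \<subseteq> carrier F \<times> carrier M"
      using that keys_add[of "frag_of q" "frag_of q'"] by auto
    have "h (s \<otimes> v) (frag_of p - (frag_of q + frag_of q')) = \<zero>\<^bsub>M\<^esub>" if v: "v \<in> S" for v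
      using pqs v k by (intro h_diff_zero) (auto simp: h_add)
    moreover have "Poly_Mapping.keys (frag_of p - (frag_of q + frag_of q')) \<subseteq> carrier F \<times> carrier M"
      using that k keys_diff[of "frag_of p" "frag_of q + frag_of q'"] by auto
    ultimately show ?thesis
      using \<open>s \<in> S\<close> by (auto simp: P_def diff_diff_eq)
  qed
  have "P c" if "c \<in> K" for c
    using that
  proof (induction rule: K_induct)
    case (rel c)
    then show "P c"
    proof (cases rule: tens_relsE)
      case (add_left x y n)
      then obtain a s b t where ab: "a \<in> carrier R" "s \<in> S" "x = fr a s" "b \<in> carrier R" "t \<in> S" "y = fr b t"
        by (meson frac_E)
      have "numer (x \<oplus>\<^bsub>F\<^esub> y) ((s \<otimes> t) \<otimes> v) = numer x ((s \<otimes> t) \<otimes> v) \<oplus> numer y ((s \<otimes> t) \<otimes> v)"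
        if v: "v \<in> S" for v
      proof -
        have "numer x ((s \<otimes> t) \<otimes> v) = a \<otimes> (t \<otimes> v)"
          using numer_frac_mult[of a s "t \<otimes> v"] ab v by (simp add: S_mult m_assoc)
        moreover have "numer y ((s \<otimes> t) \<otimes> v) = b \<otimes> (s \<otimes> v)"
          using numer_frac_mult[of b t "s \<otimes> v"] ab v by (simp add: S_mult m_ac)
        moreover have "numer (x \<oplus>\<^bsub>F\<^esub> y) ((s \<otimes> t) \<otimes> v) = (a \<otimes> t \<oplus> b \<otimes> s) \<otimes> v"
          using numer_frac_mult[of "a \<otimes> t \<oplus> b \<otimes> s" "s \<otimes> t" v] ab v by (simp add: S_mult frac_add)
        ultimately show ?thesis using ab v by (simp add: l_distr m_assoc)
      qed
      then show ?thesis
        using add_left ab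
        by (auto simp: h_of S_mult M.smult_l_distr intro!: P_three[of _ _ _ "s \<otimes> t"])
    next
      case (add_right x n n')
      then show ?thesis
        by (auto simp: h_of one_in_S M.smult_r_distr intro!: P_three[of _ _ _ \<one>])
    next
      case (smult r x n)
      then obtain a s where ab: "a \<in> carrier R" "s \<in> S" "x = fr a s"
        by (meson frac_E)
      have e: "frac_emb R S r \<otimes>\<^bsub>F\<^esub> x = fr (r \<otimes> a) s"
        using smult ab by (simp add: frac_emb frac_mult one_in_S)
      have "h (s \<otimes> v) (frag_of (frac_emb R S r \<otimes>\<^bsub>F\<^esub> x, n)) = h (s \<otimes> v) (frag_of (x, r \<odot>\<^bsub>M\<^esub> n))"
        if v: "v \<in> S" for v
      proof -
        have "h (s \<otimes> v) (frag_of (frac_emb R S r \<otimes>\<^bsub>F\<^esub> x, n)) = (r \<otimes> a \<otimes> v) \<odot>\<^bsub>M\<^esub> n"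
          using smult ab v e numer_frac_mult[of "r \<otimes> a" s v] by (simp add: h_of)
        also have "\<dots> = (a \<otimes> v) \<odot>\<^bsub>M\<^esub> (r \<odot>\<^bsub>M\<^esub> n)"
          using smult ab v M.smult_assoc1[of "a \<otimes> v" r n] by (simp add: m_ac)
        also have "\<dots> = h (s \<otimes> v) (frag_of (x, r \<odot>\<^bsub>M\<^esub> n))"
          using smult ab v numer_frac_mult[of a s v] by (simp add: h_of)
        finally show ?thesis .
      qed
      then have "\<forall>v\<in>S. h (s \<otimes> v) c = \<zero>\<^bsub>M\<^esub>"
        using smult ab by (auto intro!: h_diff_zero)
      moreover have "Poly_Mapping.keys c \<subseteq> carrier F \<times> carrier M"
        using subsetD[OF rels_carrier rel] by simp
      ultimately show ?thesis
        using ab unfolding P_def by blast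
    qed
  next
    case (diff c d)
    then obtain s t where st: "s \<in> S" "\<forall>v\<in>S. h (s \<otimes> v) c = \<zero>\<^bsub>M\<^esub>" "t \<in> S" "\<forall>v\<in>S. h (t \<otimes> v) d = \<zero>\<^bsub>M\<^esub>"
      and k: "Poly_Mapping.keys c \<subseteq> carrier F \<times> carrier M" "Poly_Mapping.keys d \<subseteq> carrier F \<times> carrier M"
      by (auto simp: P_def)
    have "h ((s \<otimes> t) \<otimes> v) (c - d) = \<zero>\<^bsub>M\<^esub>" if v: "v \<in> S" for v
    proof -
      have "(s \<otimes> t) \<otimes> v = s \<otimes> (t \<otimes> v)" "(s \<otimes> t) \<otimes> v = t \<otimes> (s \<otimes> v)"
        using st v by (simp_all add: m_ac)
      then have "h ((s \<otimes> t) \<otimes> v) c = \<zero>\<^bsub>M\<^esub>" "h ((s \<otimes> t) \<otimes> v) d = \<zero>\<^bsub>M\<^esub>"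
        using st v by (metis S_mult)+
      then show ?thesis using k by (intro h_diff_zero) auto
    qed
    then show "P (c - d)"
      using k keys_diff[of c d] st S_mult unfolding P_def by blast
  next
    show "P 0" using one_in_S by (auto simp: P_def h_zero)
  qed
  from this[OF assms(2)] obtain s where s: "s \<in> S" "\<forall>v\<in>S. h (s \<otimes> v) (frag_of (fr \<one> \<one>, m)) = \<zero>\<^bsub>M\<^esub>"
    by (auto simp: P_def)
  \<comment> \<open>Evaluating at the threshold itself turns the tensor of 1 and m into s m, so
    \<open>s\<close> is the annihilator sought.\<close>
  have "h (s \<otimes> \<one>) (frag_of (fr \<one> \<one>, m)) = numer (fr \<one> \<one>) (\<one> \<otimes> s) \<odot>\<^bsub>M\<^esub> m"
    using s m by (simp add: h_of one_in_S)
  also have "\<dots> = s \<odot>\<^bsub>M\<^esub> m"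
    using s numer_frac_mult[of \<one> \<one> s] by (simp add: one_in_S)
  finally show ?thesis using s one_in_S by metis
qed

lemma K_scale:
  assumes "x \<in> carrier F" "c \<in> K"
  shows "frag_extend (\<lambda>(y, n). frag_of (x \<otimes>\<^bsub>F\<^esub> y, n)) c \<in> K"
  using assms(2)
proof (induction rule: K_induct)
  case (rel c)
  then show ?case
  proof (cases rule: tens_relsE)
    case (add_left y z n)
    then show ?thesis
      using rel_add_left[of "x \<otimes>\<^bsub>F\<^esub> y" "x \<otimes>\<^bsub>F\<^esub> z" n] assms(1)
      by (simp add: frag_extend_diff F_r_distr)
  next
    case (add_right y n n')
    then show ?thesis
      using rel_add_right[of "x \<otimes>\<^bsub>F\<^esub> y" n n'] assms(1) by (simp add: frag_extend_diff)
  next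
    case (smult r y n)
    then show ?thesis
      using rel_smult[of r "x \<otimes>\<^bsub>F\<^esub> y" n] assms(1) F_mult_left_comm[of x "frac_emb R S r" y]
      by (simp add: frag_extend_diff)
  qed
qed (auto simp: frag_extend_diff K_diff K_zero)

lemma smult_T:
  "x \<odot>\<^bsub>T\<^esub> X = (\<Union>c\<in>X. cls (frag_extend (\<lambda>(y, n). frag_of (x \<otimes>\<^bsub>F\<^esub> y, n)) c))"
  by (simp add: tens_module_def Let_def)

lemma mfr_smult:
  assumes "r \<in> carrier R" "m \<in> carrier M" "s \<in> S"
  shows "fr r \<one> \<odot>\<^bsub>T\<^esub> mfr m s = mfr (r \<odot>\<^bsub>M\<^esub> m) s"
proof -
  define sc where "sc = frag_extend (\<lambda>(y, n :: 'm). frag_of (fr r \<one> \<otimes>\<^bsub>F\<^esub> y, n))"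
  have "cls (sc c) = mfr (r \<odot>\<^bsub>M\<^esub> m) s" if "c \<in> mfr m s" for c
  proof -
    have "sc (c - frag_of (fr \<one> s, m)) \<in> K"
      using that assms unfolding sc_def by (intro K_scale) (auto simp: one_in_S mfr_def cls_mem)
    then have "cls (sc c) = cls (sc (frag_of (fr \<one> s, m)))"
      unfolding sc_def by (simp add: frag_extend_diff cls_eq_iff)
    also have "\<dots> = mfr (r \<odot>\<^bsub>M\<^esub> m) s"
      using assms by (simp add: sc_def frac_mult one_in_S cls_frag_of)
    finally show ?thesis .
  qed
  moreover have "frag_of (fr \<one> s, m) \<in> mfr m s"
    by (simp add: mfr_def cls_self)
  ultimately show ?thesis
    unfolding smult_T sc_def by (intro UN_constant_on)
qed

text \<open>Scaling by \<open>s\<close> reduces to the tensor of 1 and m, where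
  \<open>one_tensor_eq_zero\<close> applies. Conversely an annihilator in \<open>S\<close> may be
  inserted into numerator and denominator, which makes the numerator zero.\<close>

lemma mfr_eq_zero_iff:
  assumes "m \<in> carrier M" "s \<in> S"
  shows "mfr m s = \<zero>\<^bsub>T\<^esub> \<longleftrightarrow> (\<exists>u\<in>S. u \<odot>\<^bsub>M\<^esub> m = \<zero>\<^bsub>M\<^esub>)"
proof
  assume "mfr m s = \<zero>\<^bsub>T\<^esub>"
  then have k: "frag_of (fr \<one> s, m) \<in> K"
    by (simp add: mfr_def zero_T cls_eq_iff)
  have "frac_emb R S s \<otimes>\<^bsub>F\<^esub> fr \<one> s = fr \<one> \<one>"
    using assms by (simp add: frac_emb frac_mult one_in_S frac_eq_iff)
  then have "frag_of (fr \<one> \<one>, m) \<in> K"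
    using K_scale[OF frac_emb_closed[of s] k] assms by simp
  then show "\<exists>u\<in>S. u \<odot>\<^bsub>M\<^esub> m = \<zero>\<^bsub>M\<^esub>"
    using one_tensor_eq_zero assms by auto
next
  assume "\<exists>u\<in>S. u \<odot>\<^bsub>M\<^esub> m = \<zero>\<^bsub>M\<^esub>"
  then obtain u where u: "u \<in> S" "u \<odot>\<^bsub>M\<^esub> m = \<zero>\<^bsub>M\<^esub>" by auto
  then show "mfr m s = \<zero>\<^bsub>T\<^esub>"
    using mfr_cancel[of m s u] assms by (simp add: mfr_zero S_mult)
qed

lemma mfr_eq_iff:
  assumes "m \<in> carrier M" "s \<in> S" "n \<in> carrier M" "t \<in> S"
  shows "mfr m s = mfr n t \<longleftrightarrow> (\<exists>u\<in>S. u \<odot>\<^bsub>M\<^esub> (t \<odot>\<^bsub>M\<^esub> m) = u \<odot>\<^bsub>M\<^esub> (s \<odot>\<^bsub>M\<^esub> n))"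
proof -
  interpret T: abelian_group T by (rule T_abelian_group)
  have "mfr m s = mfr n t \<longleftrightarrow> mfr (t \<odot>\<^bsub>M\<^esub> m) (s \<otimes> t) = mfr (s \<odot>\<^bsub>M\<^esub> n) (s \<otimes> t)"
    using assms mfr_cancel[of m s t] mfr_cancel[of n t s] by (simp add: m_comm)
  also have "\<dots> \<longleftrightarrow> mfr (t \<odot>\<^bsub>M\<^esub> m \<ominus>\<^bsub>M\<^esub> s \<odot>\<^bsub>M\<^esub> n) (s \<otimes> t) = \<zero>\<^bsub>T\<^esub>"
  proof -
    have "mfr (t \<odot>\<^bsub>M\<^esub> m \<ominus>\<^bsub>M\<^esub> s \<odot>\<^bsub>M\<^esub> n) (s \<otimes> t) \<oplus>\<^bsub>T\<^esub> mfr (s \<odot>\<^bsub>M\<^esub> n) (s \<otimes> t)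
        = mfr (t \<odot>\<^bsub>M\<^esub> m) (s \<otimes> t)"
      using assms by (simp add: mfr_add S_mult M.minus_eq M.a_assoc M.l_neg)
    then show ?thesis
      using assms T.add.r_cancel_one'[of "mfr (s \<odot>\<^bsub>M\<^esub> n) (s \<otimes> t)" "mfr (t \<odot>\<^bsub>M\<^esub> m \<ominus>\<^bsub>M\<^esub> s \<odot>\<^bsub>M\<^esub> n) (s \<otimes> t)"]
      by (auto simp: S_mult)
  qed
  also have "\<dots> \<longleftrightarrow> (\<exists>u\<in>S. u \<odot>\<^bsub>M\<^esub> (t \<odot>\<^bsub>M\<^esub> m \<ominus>\<^bsub>M\<^esub> s \<odot>\<^bsub>M\<^esub> n) = \<zero>\<^bsub>M\<^esub>)"
    using assms by (intro mfr_eq_zero_iff) (auto simp: S_mult)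
  also have "\<dots> \<longleftrightarrow> (\<exists>u\<in>S. u \<odot>\<^bsub>M\<^esub> (t \<odot>\<^bsub>M\<^esub> m) = u \<odot>\<^bsub>M\<^esub> (s \<odot>\<^bsub>M\<^esub> n))"
    using assms M.smult_r_diff M.minus_eq_zero_iff by (intro bex_cong refl) auto
  finally show ?thesis .
qed

end

section \<open>Bilinear maps, such as composition, on modules of fractions\<close>

locale fraction_bilinear = fraction_setting R S +
  M: fraction_module R S M + N: fraction_module R S N + L: fraction_module R S L
  for R :: "('r, 'k) ring_scheme" (structure) and S
    and M :: "('r, 'm) module" and N :: "('r, 'n) module" and L :: "('r, 'l) module" +
  fixes \<kappa> :: "'m \<Rightarrow> 'n \<Rightarrow> 'l"
  assumes \<kappa>_closed: "\<lbrakk>g \<in> carrier M; f \<in> carrier N\<rbrakk> \<Longrightarrow> \<kappa> g f \<in> carrier L"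
    and \<kappa>_add_left: "\<lbrakk>g \<in> carrier M; g' \<in> carrier M; f \<in> carrier N\<rbrakk> \<Longrightarrow>
      \<kappa> (g \<oplus>\<^bsub>M\<^esub> g') f = \<kappa> g f \<oplus>\<^bsub>L\<^esub> \<kappa> g' f"
    and \<kappa>_add_right: "\<lbrakk>g \<in> carrier M; f \<in> carrier N; f' \<in> carrier N\<rbrakk> \<Longrightarrow>
      \<kappa> g (f \<oplus>\<^bsub>N\<^esub> f') = \<kappa> g f \<oplus>\<^bsub>L\<^esub> \<kappa> g f'"
    and \<kappa>_smult_left: "\<lbrakk>r \<in> carrier R; g \<in> carrier M; f \<in> carrier N\<rbrakk> \<Longrightarrow>
      \<kappa> (r \<odot>\<^bsub>M\<^esub> g) f = r \<odot>\<^bsub>L\<^esub> \<kappa> g f"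
    and \<kappa>_smult_right: "\<lbrakk>r \<in> carrier R; g \<in> carrier M; f \<in> carrier N\<rbrakk> \<Longrightarrow>
      \<kappa> g (r \<odot>\<^bsub>N\<^esub> f) = r \<odot>\<^bsub>L\<^esub> \<kappa> g f"
begin

definition bil where
  "bil d c = frag_extend (\<lambda>(x, g). frag_extend (\<lambda>(y, f). frag_of (x \<otimes>\<^bsub>F\<^esub> y, \<kappa> g f)) c) d"

lemma bil_diff_left: "bil (d - d') c = bil d c - bil d' c"
  by (simp add: bil_def frag_extend_diff)

lemma bil_diff_right: "bil d (c - c') = bil d c - bil d c'"
  unfolding bil_def case_prod_beta frag_extend_diff frag_extend_fun_diff ..

lemma bil_zero: "bil 0 c = 0" "bil d 0 = 0"
  unfolding bil_def case_prod_beta frag_extend_0 frag_extend_fun_zero by (rule refl)+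

lemma bil_of: "bil (frag_of (x, g)) (frag_of (y, f)) = frag_of (x \<otimes>\<^bsub>F\<^esub> y, \<kappa> g f)"
  by (simp add: bil_def)

text \<open>By additivity in both arguments it suffices to pair a defining relation with a single
  generator; the result is a defining relation of the target.\<close>

lemma bil_left:
  assumes "d \<in> M.K" "Poly_Mapping.keys c \<subseteq> carrier F \<times> carrier N"
  shows "bil d c \<in> L.K"
  using assms(2)
proof (induction c rule: free_Abelian_group_induct[consumes 1, case_names zero diff of])
  case (of p)
  obtain y f where p: "p = (y, f)" "y \<in> carrier F" "f \<in> carrier N" using of by auto
  show ?case
    using assms(1) unfolding p(1)
  proof (induction rule: M.K_induct)
    case (rel c)
    then show ?case
    proof (cases rule: tens_relsE)
      case (add_left x x' g)
      then show ?thesis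
        using L.rel_add_left[of "x \<otimes>\<^bsub>F\<^esub> y" "x' \<otimes>\<^bsub>F\<^esub> y" "\<kappa> g f"] p
        by (simp add: bil_diff_left bil_of F_l_distr \<kappa>_closed)
    next
      case (add_right x g g')
      then show ?thesis
        using L.rel_add_right[of "x \<otimes>\<^bsub>F\<^esub> y" "\<kappa> g f" "\<kappa> g' f"] p
        by (simp add: bil_diff_left bil_of \<kappa>_add_left \<kappa>_closed)
    next
      case (smult r x g)
      then show ?thesis
        using L.rel_smult[of r "x \<otimes>\<^bsub>F\<^esub> y" "\<kappa> g f"] p
        by (simp add: bil_diff_left bil_of F_mult_assoc \<kappa>_smult_left \<kappa>_closed)
    qed
  qed (auto simp: bil_diff_left bil_zero L.K_diff L.K_zero)
qed (auto simp: bil_diff_right bil_zero L.K_diff L.K_zero)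

lemma bil_right:
  assumes "c \<in> N.K" "Poly_Mapping.keys d \<subseteq> carrier F \<times> carrier M"
  shows "bil d c \<in> L.K"
  using assms(2)
proof (induction d rule: free_Abelian_group_induct[consumes 1, case_names zero diff of])
  case (of p)
  obtain x g where p: "p = (x, g)" "x \<in> carrier F" "g \<in> carrier M" using of by auto
  show ?case
    using assms(1) unfolding p(1)
  proof (induction rule: N.K_induct)
    case (rel c)
    then show ?case
    proof (cases rule: tens_relsE)
      case (add_left y y' f)
      then show ?thesis
        using L.rel_add_left[of "x \<otimes>\<^bsub>F\<^esub> y" "x \<otimes>\<^bsub>F\<^esub> y'" "\<kappa> g f"] p
        by (simp add: bil_diff_right bil_of F_r_distr \<kappa>_closed)
    next
      case (add_right y f f')
      then show ?thesis
        using L.rel_add_right[of "x \<otimes>\<^bsub>F\<^esub> y" "\<kappa> g f" "\<kappa> g f'"] p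
        by (simp add: bil_diff_right bil_of \<kappa>_add_right \<kappa>_closed)
    next
      case (smult r y f)
      then show ?thesis
        using L.rel_smult[of r "x \<otimes>\<^bsub>F\<^esub> y" "\<kappa> g f"] p F_mult_left_comm[of x "frac_emb R S r" y]
        by (simp add: bil_diff_right bil_of \<kappa>_smult_right \<kappa>_closed)
    qed
  qed (auto simp: bil_diff_right bil_zero L.K_diff L.K_zero)
qed (auto simp: bil_diff_left bil_zero L.K_diff L.K_zero)

text \<open>Changing representatives changes the value by
  \<open>bil (d - ?d) c + bil ?d (c - ?c)\<close>, and both terms are relations by
  \<open>bil_left\<close> and \<open>bil_right\<close>. So the double union is the class obtained
  from the two standard representatives.\<close>

lemma mfrac_bil:
  assumes "g \<in> carrier M" "f \<in> carrier N" "s \<in> S" "t \<in> S"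
  shows "(\<Union>d\<in>mfrac R S M g s. \<Union>c\<in>mfrac R S N f t. tens_class R F (frac_emb R S) L
     (frag_extend (\<lambda>(x, g). frag_extend (\<lambda>(y, f). frag_of (x \<otimes>\<^bsub>F\<^esub> y, \<kappa> g f)) c) d))
    = mfrac R S L (\<kappa> g f) (s \<otimes> t)"
proof -
  let ?d = "frag_of (fr \<one> s, g)" and ?c = "frag_of (fr \<one> t, f)"
  have "L.cls (bil d c) = mfrac R S L (\<kappa> g f) (s \<otimes> t)"
    if "d \<in> mfrac R S M g s" "c \<in> mfrac R S N f t" for d c
  proof -
    have dc: "d - ?d \<in> M.K" "c - ?c \<in> N.K"
      using that by (simp_all add: M.mfr_def N.mfr_def M.cls_mem N.cls_mem)
    have "Poly_Mapping.keys (c - ?c + ?c) \<subseteq> carrier F \<times> carrier N"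
      using N.K_carrier[OF dc(2)] assms by (intro keys_add_subset) auto
    then have "bil (d - ?d) c + bil ?d (c - ?c) \<in> L.K"
      using dc assms by (intro L.K_add bil_left bil_right) auto
    then have "bil d c - bil ?d ?c \<in> L.K"
      by (simp add: bil_diff_left bil_diff_right)
    then have "L.cls (bil d c) = L.cls (bil ?d ?c)" by (simp add: L.cls_eq_iff)
    then show ?thesis
      using assms by (simp add: bil_of L.mfr_def frac_mult)
  qed
  then show ?thesis
    unfolding bil_def
    by (intro UN_constant_on[of ?d] UN_constant_on[of ?c]) (auto simp: M.mfr_def N.mfr_def M.cls_self N.cls_self)
qed

end

section \<open>Enlarging the set of denominators\<close>

locale fraction_change = S: fraction_setting R S + T: fraction_setting R T +
  MS: fraction_module R S M + MT: fraction_module R T M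
  for R :: "('r, 'k) ring_scheme" (structure) and S T and M :: "('r, 'm) module" +
  assumes S_sub_T: "S \<subseteq> T"
begin

lemma frac_change_frac:
  assumes "a \<in> carrier R" "s \<in> S"
  shows "frac_change R T (fraction R S a s) = fraction R T a s"
proof -
  have "fraction R T b t = fraction R T a s" if "(b, t) \<in> fraction R S a s" for b t
    using that assms S_sub_T by (subst T.frac_eq_iff) (auto simp: S.mem_frac_iff)
  note rep_indep = this
  have "(a, s) \<in> fraction R S a s"
    using assms by (simp add: S.mem_frac_iff)
  then show ?thesis
    unfolding frac_change_def by (rule UN_pair) (rule rep_indep)
qed

lemma frac_change_closed: "x \<in> carrier S.F \<Longrightarrow> frac_change R T x \<in> carrier T.F"
  using S_sub_T by (elim S.frac_E) (auto simp: frac_change_frac)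

lemma frac_change_add:
  assumes "x \<in> carrier S.F" "y \<in> carrier S.F"
  shows "frac_change R T (x \<oplus>\<^bsub>S.F\<^esub> y) = frac_change R T x \<oplus>\<^bsub>T.F\<^esub> frac_change R T y"
proof -
  obtain a s b t where "a \<in> carrier R" "s \<in> S" "b \<in> carrier R" "t \<in> S" "x = S.fr a s" "y = S.fr b t"
    using assms by (meson S.frac_E)
  then show ?thesis
    using S_sub_T by (simp add: S.frac_add T.frac_add frac_change_frac S.S_mult subset_eq)
qed

lemma frac_change_mult:
  assumes "x \<in> carrier S.F" "y \<in> carrier S.F"
  shows "frac_change R T (x \<otimes>\<^bsub>S.F\<^esub> y) = frac_change R T x \<otimes>\<^bsub>T.F\<^esub> frac_change R T y"
proof -
  obtain a s b t where "a \<in> carrier R" "s \<in> S" "b \<in> carrier R" "t \<in> S" "x = S.fr a s" "y = S.fr b t"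
    using assms by (meson S.frac_E)
  then show ?thesis
    using S_sub_T by (simp add: S.frac_mult T.frac_mult frac_change_frac S.S_mult subset_eq)
qed

lemma frac_change_emb: "r \<in> carrier R \<Longrightarrow> frac_change R T (frac_emb R S r) = frac_emb R T r"
  by (simp add: S.frac_emb T.frac_emb frac_change_frac S.one_in_S)

lemma K_change:
  assumes "c \<in> MS.K"
  shows "frag_extend (\<lambda>(x, m). frag_of (frac_change R T x, m)) c \<in> MT.K"
  using assms
proof (induction rule: MS.K_induct)
  case (rel c)
  then show ?case
  proof (cases rule: tens_relsE)
    case (add_left x y m)
    then show ?thesis
      using MT.rel_add_left[of "frac_change R T x" "frac_change R T y" m]
      by (simp add: frag_extend_diff frac_change_add frac_change_closed)
  next
    case (add_right x m n)
    then show ?thesis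
      using MT.rel_add_right[of "frac_change R T x" m n]
      by (simp add: frag_extend_diff frac_change_closed)
  next
    case (smult r x m)
    then show ?thesis
      using MT.rel_smult[of r "frac_change R T x" m]
      by (simp add: frag_extend_diff frac_change_mult frac_change_closed frac_change_emb)
  qed
qed (auto simp: frag_extend_diff MT.K_diff MT.K_zero)

lemma tens_change_mfrac:
  assumes "m \<in> carrier M" "s \<in> S"
  shows "tens_change R T M (mfrac R S M m s) = mfrac R T M m s"
proof -
  let ?c = "frag_of (S.fr \<one> s, m)"
  define ch where "ch = frag_extend (\<lambda>(x, m :: 'm). frag_of (frac_change R T x, m))"
  have "MT.cls (ch c) = mfrac R T M m s" if "c \<in> mfrac R S M m s" for c
  proof -
    have "ch (c - ?c) \<in> MT.K"
      using that unfolding ch_def by (intro K_change) (auto simp: MS.mfr_def MS.cls_mem)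
    then have "MT.cls (ch c) = MT.cls (ch ?c)"
      unfolding ch_def by (simp add: frag_extend_diff MT.cls_eq_iff)
    then show ?thesis
      using assms by (simp add: ch_def frac_change_frac MT.mfr_def)
  qed
  moreover have "?c \<in> mfrac R S M m s" by (simp add: MS.mfr_def MS.cls_self)
  ultimately show ?thesis
    unfolding tens_change_def ch_def by (intro UN_constant_on)
qed

end

section \<open>Calculations in a category\<close>

context r_category
begin

lemma Hom_abelian_group: "\<lbrakk>A \<in> Obj C; B \<in> Obj C\<rbrakk> \<Longrightarrow> abelian_group (Hom C A B)"
  by (rule module.axioms(2)[OF Hom_module])

lemma zero_closed' [simp]: "\<lbrakk>A \<in> Obj C; B \<in> Obj C\<rbrakk> \<Longrightarrow> \<zero>\<^bsub>Hom C A B\<^esub> \<in> carrier (Hom C A B)"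
  using Hom_abelian_group by (rule abelian_group.axioms(1)[THEN abelian_monoid.zero_closed])

lemma add_closed' [simp]:
  "\<lbrakk>A \<in> Obj C; B \<in> Obj C; f \<in> carrier (Hom C A B); g \<in> carrier (Hom C A B)\<rbrakk>
    \<Longrightarrow> f \<oplus>\<^bsub>Hom C A B\<^esub> g \<in> carrier (Hom C A B)"
  using abelian_group.axioms(1)[OF Hom_abelian_group] by (simp add: abelian_monoid.a_closed)

lemma add_comm':
  "\<lbrakk>A \<in> Obj C; B \<in> Obj C; f \<in> carrier (Hom C A B); g \<in> carrier (Hom C A B)\<rbrakk>
    \<Longrightarrow> f \<oplus>\<^bsub>Hom C A B\<^esub> g = g \<oplus>\<^bsub>Hom C A B\<^esub> f"
  using abelian_group.axioms(1)[OF Hom_abelian_group] by (simp add: abelian_monoid.a_comm)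

lemma add_assoc':
  "\<lbrakk>A \<in> Obj C; B \<in> Obj C; f \<in> carrier (Hom C A B); g \<in> carrier (Hom C A B); h \<in> carrier (Hom C A B)\<rbrakk>
    \<Longrightarrow> (f \<oplus>\<^bsub>Hom C A B\<^esub> g) \<oplus>\<^bsub>Hom C A B\<^esub> h = f \<oplus>\<^bsub>Hom C A B\<^esub> (g \<oplus>\<^bsub>Hom C A B\<^esub> h)"
  using abelian_group.axioms(1)[OF Hom_abelian_group] by (simp add: abelian_monoid.a_assoc)

lemma add_lcomm':
  "\<lbrakk>A \<in> Obj C; B \<in> Obj C; f \<in> carrier (Hom C A B); g \<in> carrier (Hom C A B); h \<in> carrier (Hom C A B)\<rbrakk>
    \<Longrightarrow> f \<oplus>\<^bsub>Hom C A B\<^esub> (g \<oplus>\<^bsub>Hom C A B\<^esub> h) = g \<oplus>\<^bsub>Hom C A B\<^esub> (f \<oplus>\<^bsub>Hom C A B\<^esub> h)"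
  using abelian_group.axioms(1)[OF Hom_abelian_group] by (simp add: abelian_monoid.a_lcomm)

lemmas add_ac' = add_assoc' add_comm' add_lcomm'

lemma add_zero' [simp]:
  "\<lbrakk>A \<in> Obj C; B \<in> Obj C; f \<in> carrier (Hom C A B)\<rbrakk> \<Longrightarrow> f \<oplus>\<^bsub>Hom C A B\<^esub> \<zero>\<^bsub>Hom C A B\<^esub> = f"
  "\<lbrakk>A \<in> Obj C; B \<in> Obj C; f \<in> carrier (Hom C A B)\<rbrakk> \<Longrightarrow> \<zero>\<^bsub>Hom C A B\<^esub> \<oplus>\<^bsub>Hom C A B\<^esub> f = f"
  using abelian_group.axioms(1)[OF Hom_abelian_group]
  by (simp_all add: abelian_monoid.l_zero abelian_monoid.r_zero)

lemma minus_closed' [simp]: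
  "\<lbrakk>A \<in> Obj C; B \<in> Obj C; f \<in> carrier (Hom C A B); g \<in> carrier (Hom C A B)\<rbrakk>
    \<Longrightarrow> f \<ominus>\<^bsub>Hom C A B\<^esub> g \<in> carrier (Hom C A B)"
  using Hom_abelian_group by (simp add: abelian_group.minus_closed)

lemma minus_eq_zero':
  "\<lbrakk>A \<in> Obj C; B \<in> Obj C; f \<in> carrier (Hom C A B); g \<in> carrier (Hom C A B)\<rbrakk>
    \<Longrightarrow> f \<ominus>\<^bsub>Hom C A B\<^esub> g = \<zero>\<^bsub>Hom C A B\<^esub> \<longleftrightarrow> f = g"
  using Hom_abelian_group by (simp add: abelian_group.minus_eq_zero_iff)

lemma minus_add_cancel':
  assumes "A \<in> Obj C" "B \<in> Obj C" "f \<in> carrier (Hom C A B)" "g \<in> carrier (Hom C A B)"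
  shows "(f \<ominus>\<^bsub>Hom C A B\<^esub> g) \<oplus>\<^bsub>Hom C A B\<^esub> g = f"
proof -
  interpret H: abelian_group "Hom C A B" using assms by (intro Hom_abelian_group)
  show ?thesis using assms by (simp add: H.minus_eq H.a_assoc H.l_neg)
qed

lemma add_right_cancel':
  assumes "A \<in> Obj C" "B \<in> Obj C" "f \<in> carrier (Hom C A B)" "g \<in> carrier (Hom C A B)" "h \<in> carrier (Hom C A B)"
  shows "f \<oplus>\<^bsub>Hom C A B\<^esub> h = g \<oplus>\<^bsub>Hom C A B\<^esub> h \<longleftrightarrow> f = g"
proof -
  interpret H: abelian_group "Hom C A B" using assms by (intro Hom_abelian_group)
  show ?thesis using assms by simp
qed

lemma smult_closed' [simp]:
  "\<lbrakk>A \<in> Obj C; B \<in> Obj C; r \<in> carrier R; f \<in> carrier (Hom C A B)\<rbrakk>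
    \<Longrightarrow> r \<odot>\<^bsub>Hom C A B\<^esub> f \<in> carrier (Hom C A B)"
  by (rule module.smult_closed[OF Hom_module])

lemma smult_add_right:
  "\<lbrakk>A \<in> Obj C; B \<in> Obj C; r \<in> carrier R; f \<in> carrier (Hom C A B); g \<in> carrier (Hom C A B)\<rbrakk>
    \<Longrightarrow> r \<odot>\<^bsub>Hom C A B\<^esub> (f \<oplus>\<^bsub>Hom C A B\<^esub> g) = r \<odot>\<^bsub>Hom C A B\<^esub> f \<oplus>\<^bsub>Hom C A B\<^esub> r \<odot>\<^bsub>Hom C A B\<^esub> g"
  by (rule module.smult_r_distr[OF Hom_module])

lemma smult_add_left:
  "\<lbrakk>A \<in> Obj C; B \<in> Obj C; r \<in> carrier R; t \<in> carrier R; f \<in> carrier (Hom C A B)\<rbrakk>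
    \<Longrightarrow> (r \<oplus> t) \<odot>\<^bsub>Hom C A B\<^esub> f = r \<odot>\<^bsub>Hom C A B\<^esub> f \<oplus>\<^bsub>Hom C A B\<^esub> t \<odot>\<^bsub>Hom C A B\<^esub> f"
  by (rule module.smult_l_distr[OF Hom_module])

lemma smult_smult:
  "\<lbrakk>A \<in> Obj C; B \<in> Obj C; r \<in> carrier R; t \<in> carrier R; f \<in> carrier (Hom C A B)\<rbrakk>
    \<Longrightarrow> r \<odot>\<^bsub>Hom C A B\<^esub> (t \<odot>\<^bsub>Hom C A B\<^esub> f) = (r \<otimes> t) \<odot>\<^bsub>Hom C A B\<^esub> f"
  using Hom_module[of A B] by (simp add: module.smult_assoc1)

lemma smult_one' [simp]:
  "\<lbrakk>A \<in> Obj C; B \<in> Obj C; f \<in> carrier (Hom C A B)\<rbrakk> \<Longrightarrow> \<one> \<odot>\<^bsub>Hom C A B\<^esub> f = f"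
  by (rule module.smult_one[OF Hom_module])

lemma smult_zero_right [simp]:
  "\<lbrakk>A \<in> Obj C; B \<in> Obj C; r \<in> carrier R\<rbrakk> \<Longrightarrow> r \<odot>\<^bsub>Hom C A B\<^esub> \<zero>\<^bsub>Hom C A B\<^esub> = \<zero>\<^bsub>Hom C A B\<^esub>"
  by (rule module.smult_r_null[OF Hom_module])

lemma smult_zero_left [simp]:
  "\<lbrakk>A \<in> Obj C; B \<in> Obj C; f \<in> carrier (Hom C A B)\<rbrakk> \<Longrightarrow> \<zero> \<odot>\<^bsub>Hom C A B\<^esub> f = \<zero>\<^bsub>Hom C A B\<^esub>"
  by (rule module.smult_l_null[OF Hom_module])

lemma smult_diff:
  "\<lbrakk>A \<in> Obj C; B \<in> Obj C; r \<in> carrier R; f \<in> carrier (Hom C A B); g \<in> carrier (Hom C A B)\<rbrakk>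
    \<Longrightarrow> r \<odot>\<^bsub>Hom C A B\<^esub> (f \<ominus>\<^bsub>Hom C A B\<^esub> g) = r \<odot>\<^bsub>Hom C A B\<^esub> f \<ominus>\<^bsub>Hom C A B\<^esub> r \<odot>\<^bsub>Hom C A B\<^esub> g"
  by (rule module.smult_r_diff[OF Hom_module])

lemma smult_diff_zero_iff:
  "\<lbrakk>A \<in> Obj C; B \<in> Obj C; r \<in> carrier R; f \<in> carrier (Hom C A B); g \<in> carrier (Hom C A B)\<rbrakk>
    \<Longrightarrow> r \<odot>\<^bsub>Hom C A B\<^esub> (f \<ominus>\<^bsub>Hom C A B\<^esub> g) = \<zero>\<^bsub>Hom C A B\<^esub> \<longleftrightarrow> r \<odot>\<^bsub>Hom C A B\<^esub> f = r \<odot>\<^bsub>Hom C A B\<^esub> g"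
  by (simp add: smult_diff minus_eq_zero')

declare Comp_closed [simp] Ident_closed [simp] Comp_Ident_right [simp] Comp_Ident_left [simp]

lemma Comp_zero_right [simp]:
  assumes "A \<in> Obj C" "B \<in> Obj C" "D \<in> Obj C" "g \<in> carrier (Hom C B D)"
  shows "Comp C A B D g \<zero>\<^bsub>Hom C A B\<^esub> = \<zero>\<^bsub>Hom C A D\<^esub>"
  using Comp_smult_right[of A B D "\<zero>\<^bsub>Hom C A B\<^esub>" g \<zero>] assms by simp

lemma Comp_zero_left [simp]:
  assumes "A \<in> Obj C" "B \<in> Obj C" "D \<in> Obj C" "f \<in> carrier (Hom C A B)"
  shows "Comp C A B D \<zero>\<^bsub>Hom C B D\<^esub> f = \<zero>\<^bsub>Hom C A D\<^esub>"
  using Comp_smult_left[of A B D f "\<zero>\<^bsub>Hom C B D\<^esub>" \<zero>] assms by simp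

lemmas Comp_lin = Comp_add_right Comp_add_left Comp_smult_right Comp_smult_left

end


text \<open>After inverting \<open>S\<close>, the object \<open>A\<close> becomes the image of the idempotent \<open>\<epsilon>/s\<close> of \<open>X\<close>.\<close>

definition loc_retract ::
  "('r, 'k) ring_scheme \<Rightarrow> 'r set \<Rightarrow> ('o, 'r, 'm) mcat \<Rightarrow> 'o \<Rightarrow> 'o \<Rightarrow> 'm \<Rightarrow> 'r \<Rightarrow> bool"
where
  "loc_retract R S C A X \<epsilon> s \<longleftrightarrow> A \<in> Obj C \<and> X \<in> Obj C \<and>
     (\<exists>p\<in>carrier (Hom C A X). \<exists>i\<in>carrier (Hom C X A). \<exists>u\<in>S.
        Comp C A X A i p = u \<odot>\<^bsub>Hom C A A\<^esub> Ident C A \<and>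
        s \<odot>\<^bsub>Hom C X X\<^esub> Comp C X A X p i = u \<odot>\<^bsub>Hom C X X\<^esub> \<epsilon> \<and>
        Comp C A X X \<epsilon> p = s \<odot>\<^bsub>Hom C A X\<^esub> p \<and> Comp C X X A i \<epsilon> = s \<odot>\<^bsub>Hom C X A\<^esub> i)"

lemma loc_retractI:
  assumes "A \<in> Obj C" "X \<in> Obj C" "p \<in> carrier (Hom C A X)" "i \<in> carrier (Hom C X A)" "u \<in> S"
    "Comp C A X A i p = u \<odot>\<^bsub>Hom C A A\<^esub> Ident C A"
    "s \<odot>\<^bsub>Hom C X X\<^esub> Comp C X A X p i = u \<odot>\<^bsub>Hom C X X\<^esub> \<epsilon>"
    "Comp C A X X \<epsilon> p = s \<odot>\<^bsub>Hom C A X\<^esub> p" "Comp C X X A i \<epsilon> = s \<odot>\<^bsub>Hom C X A\<^esub> i"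
  shows "loc_retract R S C A X \<epsilon> s"
  using assms unfolding loc_retract_def by blast

text \<open>For \<epsilon> the identity and s = 1 the retract is all of \<open>B\<close>. Treating
  isomorphism as this special case lets the same gluing construction serve objects of the category
  and idempotents that exist only locally.\<close>

abbreviation "loc_iso R S C A B \<equiv> loc_retract R S C A B (Ident C B) \<one>\<^bsub>R\<^esub>"

context r_category
begin

lemma loc_iso_iff:
  assumes "S \<subseteq> carrier R"
  shows "loc_iso R S C A B \<longleftrightarrow> A \<in> Obj C \<and> B \<in> Obj C \<and>
     (\<exists>p\<in>carrier (Hom C A B). \<exists>i\<in>carrier (Hom C B A). \<exists>u\<in>S.
        Comp C A B A i p = u \<odot>\<^bsub>Hom C A A\<^esub> Ident C A \<and>
        Comp C B A B p i = u \<odot>\<^bsub>Hom C B B\<^esub> Ident C B)"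
  unfolding loc_retract_def
  by (intro conj_cong refl bex_cong) simp_all

lemma loc_iso_refl:
  assumes "A \<in> Obj C" "S \<subseteq> carrier R" "\<one> \<in> S"
  shows "loc_iso R S C A A"
  using assms unfolding loc_iso_iff[OF assms(2)]
  by (auto intro!: bexI[of _ "Ident C A"] bexI[of _ \<one>])

lemma loc_iso_sym:
  assumes "loc_iso R S C A B" "S \<subseteq> carrier R"
  shows "loc_iso R S C B A"
  using assms unfolding loc_iso_iff[OF assms(2)] by blast

text \<open>Composing the two pairs of morphisms multiplies their scalars. Its purpose is to carry
  retract data from \<open>B\<close> over to an object that has already been glued to agree with
  \<open>B\<close> where \<open>S\<close> is inverted.\<close>

lemma loc_retract_trans:
  assumes "loc_iso R S C A B" "loc_retract R S C B X \<epsilon> s" "S \<subseteq> carrier R" "s \<in> carrier R"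
    "\<epsilon> \<in> carrier (Hom C X X)" and S: "\<And>u v. u \<in> S \<Longrightarrow> v \<in> S \<Longrightarrow> u \<otimes> v \<in> S"
  shows "loc_retract R S C A X \<epsilon> s"
proof -
  obtain f g u where fg: "A \<in> Obj C" "B \<in> Obj C" "f \<in> carrier (Hom C A B)" "g \<in> carrier (Hom C B A)" "u \<in> S"
      "Comp C A B A g f = u \<odot>\<^bsub>Hom C A A\<^esub> Ident C A" "Comp C B A B f g = u \<odot>\<^bsub>Hom C B B\<^esub> Ident C B"
    using assms(1) unfolding loc_iso_iff[OF assms(3)] by blast
  obtain p i v where pi: "X \<in> Obj C" "p \<in> carrier (Hom C B X)" "i \<in> carrier (Hom C X B)" "v \<in> S"
      "Comp C B X B i p = v \<odot>\<^bsub>Hom C B B\<^esub> Ident C B"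
      "s \<odot>\<^bsub>Hom C X X\<^esub> Comp C X B X p i = v \<odot>\<^bsub>Hom C X X\<^esub> \<epsilon>"
      "Comp C B X X \<epsilon> p = s \<odot>\<^bsub>Hom C B X\<^esub> p" "Comp C X X B i \<epsilon> = s \<odot>\<^bsub>Hom C X B\<^esub> i"
    using assms(2) unfolding loc_retract_def by blast
  have uv: "u \<in> carrier R" "v \<in> carrier R" using fg pi assms(3) by auto
  let ?p = "Comp C A B X p f" and ?i = "Comp C X B A g i"
  have "Comp C A X A ?i ?p = Comp C A B A (Comp C B B A g (Comp C B X B i p)) f"
    using fg(1-4) pi(1-4) by (simp add: Comp_assoc)
  also have "\<dots> = (u \<otimes> v) \<odot>\<^bsub>Hom C A A\<^esub> Ident C A"
    using fg pi(1-4) uv by (simp add: pi(5) Comp_lin smult_smult m_comm)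
  finally have 1: "Comp C A X A ?i ?p = (u \<otimes> v) \<odot>\<^bsub>Hom C A A\<^esub> Ident C A" .
  have "Comp C X A X ?p ?i = Comp C X B X (Comp C B B X p (Comp C B A B f g)) i"
    using fg(1-4) pi(1-4) by (simp add: Comp_assoc)
  also have "\<dots> = u \<odot>\<^bsub>Hom C X X\<^esub> Comp C X B X p i"
    using fg pi(1-4) uv by (simp add: Comp_lin)
  finally have "s \<odot>\<^bsub>Hom C X X\<^esub> Comp C X A X ?p ?i = u \<odot>\<^bsub>Hom C X X\<^esub> (s \<odot>\<^bsub>Hom C X X\<^esub> Comp C X B X p i)"
    using fg(1-5) pi(1-4) uv assms(4) by (simp add: smult_smult m_comm)
  also have "\<dots> = (u \<otimes> v) \<odot>\<^bsub>Hom C X X\<^esub> \<epsilon>"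
    using pi uv assms(5) by (simp add: smult_smult)
  finally have 2: "s \<odot>\<^bsub>Hom C X X\<^esub> Comp C X A X ?p ?i = (u \<otimes> v) \<odot>\<^bsub>Hom C X X\<^esub> \<epsilon>" .
  have 3: "Comp C A X X \<epsilon> ?p = s \<odot>\<^bsub>Hom C A X\<^esub> ?p"
    using fg(1-4) pi assms(4,5) by (simp add: Comp_assoc Comp_lin)
  have 4: "Comp C X X A ?i \<epsilon> = s \<odot>\<^bsub>Hom C X A\<^esub> ?i"
    using fg(1-4) pi assms(4,5) by (simp add: Comp_assoc[symmetric] Comp_lin)
  show ?thesis
    by (rule loc_retractI[OF _ _ _ _ _ 1 2 3 4]) (use fg(1-5) pi(1-4) S in auto)
qed

lemma loc_iso_trans:
  assumes "loc_iso R S C A B" "loc_iso R S C B D" "S \<subseteq> carrier R"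
    and "\<And>u v. u \<in> S \<Longrightarrow> v \<in> S \<Longrightarrow> u \<otimes> v \<in> S"
  shows "loc_iso R S C A D"
  using assms(2) by (intro loc_retract_trans[OF assms(1,2,3) _ _ assms(4)]) (auto simp: loc_retract_def)

lemma loc_retract_mono:
  "loc_retract R S C A X \<epsilon> s \<Longrightarrow> S \<subseteq> T \<Longrightarrow> loc_retract R T C A X \<epsilon> s"
  unfolding loc_retract_def by blast

end

section \<open>Nilpotent errors and torsion\<close>

primrec endo_pow :: "('o, 'r, 'm) mcat \<Rightarrow> 'o \<Rightarrow> 'm \<Rightarrow> nat \<Rightarrow> 'm" where
  "endo_pow C A f 0 = Ident C A"
| "endo_pow C A f (Suc n) = Comp C A A A (endo_pow C A f n) f"

context r_category
begin

lemma endo_pow_closed [simp]: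
  "A \<in> Obj C \<Longrightarrow> f \<in> carrier (Hom C A A) \<Longrightarrow> endo_pow C A f n \<in> carrier (Hom C A A)"
  by (induction n) auto

lemma alt_prod_closed [simp]:
  "\<lbrakk>A \<in> Obj C; B \<in> Obj C; a \<in> carrier (Hom C A B); \<And>n. b n \<in> carrier (Hom C B A)\<rbrakk>
    \<Longrightarrow> alt_prod C A B a b n \<in> carrier (Hom C A B)"
  by (induction n) auto

text \<open>The constant sequence of identities tests an essentially nilpotent endomorphism for
  plain nilpotency. The exponent is \<open>Suc n\<close> because \<open>alt_prod\<close> starts with
  the morphism itself.\<close>

lemma alt_prod_Ident:
  assumes "A \<in> Obj C" "f \<in> carrier (Hom C A A)"
  shows "alt_prod C A A f (\<lambda>_. Ident C A) n = endo_pow C A f (Suc n)"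
  using assms by (induction n) auto

lemma nilrad_nilpotent:
  assumes "A \<in> Obj C" "f \<in> nilrad C A A"
  shows "\<exists>n. endo_pow C A f n = \<zero>\<^bsub>Hom C A A\<^esub>"
proof -
  have f: "f \<in> carrier (Hom C A A)" using assms by (simp add: nilrad_def)
  have "\<exists>n. alt_prod C A A f (\<lambda>_. Ident C A) n = \<zero>\<^bsub>Hom C A A\<^esub>"
    using assms by (auto simp: nilrad_def)
  then show ?thesis using alt_prod_Ident[OF assms(1) f] by metis
qed

lemma endo_pow_mono:
  assumes "A \<in> Obj C" "f \<in> carrier (Hom C A A)" "endo_pow C A f m = \<zero>\<^bsub>Hom C A A\<^esub>" "m \<le> n"
  shows "endo_pow C A f n = \<zero>\<^bsub>Hom C A A\<^esub>"
  using assms(4,3) by (induction rule: dec_induct) (use assms in auto)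

lemma endo_pow_intertwine:
  assumes "A \<in> Obj C" "B \<in> Obj C" "f \<in> carrier (Hom C A A)" "g \<in> carrier (Hom C B B)"
    "\<alpha> \<in> carrier (Hom C A B)" "Comp C A A B \<alpha> f = Comp C A B B g \<alpha>"
  shows "Comp C A A B \<alpha> (endo_pow C A f n) = Comp C A B B (endo_pow C B g n) \<alpha>"
proof (induction n)
  case (Suc n)
  have "Comp C A A B \<alpha> (endo_pow C A f (Suc n)) = Comp C A A B (Comp C A A B \<alpha> (endo_pow C A f n)) f"
    using assms(1-5) by (simp add: Comp_assoc)
  also have "\<dots> = Comp C A B B (endo_pow C B g n) (Comp C A A B \<alpha> f)"
    unfolding Suc using assms(1-5) by (simp add: Comp_assoc)
  also have "\<dots> = Comp C A B B (endo_pow C B g (Suc n)) \<alpha>"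
    unfolding assms(6) using assms(1-5) by (simp add: Comp_assoc)
  finally show ?case .
qed (use assms in simp)

lemma smult_minus_cancel:
  assumes "A \<in> Obj C" "B \<in> Obj C" "c \<in> carrier R" "f \<in> carrier (Hom C A B)" "g \<in> carrier (Hom C A B)"
  shows "c \<odot>\<^bsub>Hom C A B\<^esub> f \<oplus>\<^bsub>Hom C A B\<^esub> (\<ominus> c \<odot>\<^bsub>Hom C A B\<^esub> f \<oplus>\<^bsub>Hom C A B\<^esub> g) = g"
proof -
  have "c \<odot>\<^bsub>Hom C A B\<^esub> f \<oplus>\<^bsub>Hom C A B\<^esub> \<ominus> c \<odot>\<^bsub>Hom C A B\<^esub> f = \<zero>\<^bsub>Hom C A B\<^esub>"
    using assms by (simp add: smult_add_left[symmetric] R.r_neg)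
  then show ?thesis using assms by (simp add: add_assoc'[symmetric])
qed

text \<open>Since \<open>\<beta>\<alpha> = a + \<nu>\<close> and \<open>\<alpha>\<beta> = a + \<mu>\<close> with \<open>\<alpha>\<nu> = \<mu>\<alpha>\<close>, a truncated geometric series in \<open>\<nu>\<close> times \<open>\<beta>\<close> is
  inverse to \<open>\<alpha>\<close> up to \<open>a ^ k\<close> and multiples of \<open>\<nu> ^ k\<close>, \<open>\<mu> ^ k\<close>.\<close>

lemma geometric_quasi_inverse:
  fixes a
  assumes AB: "A \<in> Obj C" "B \<in> Obj C" "\<alpha> \<in> carrier (Hom C A B)" "\<beta> \<in> carrier (Hom C B A)" "a \<in> carrier R"
    and "\<nu> \<in> carrier (Hom C A A)" "\<mu> \<in> carrier (Hom C B B)"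
    and \<nu>: "Comp C A B A \<beta> \<alpha> = \<nu> \<oplus>\<^bsub>Hom C A A\<^esub> a \<odot>\<^bsub>Hom C A A\<^esub> Ident C A"
    and \<mu>: "Comp C B A B \<alpha> \<beta> = \<mu> \<oplus>\<^bsub>Hom C B B\<^esub> a \<odot>\<^bsub>Hom C B B\<^esub> Ident C B"
  shows "\<exists>g\<in>carrier (Hom C B A). \<exists>c\<in>carrier R.
    Comp C A B A g \<alpha> \<oplus>\<^bsub>Hom C A A\<^esub> c \<odot>\<^bsub>Hom C A A\<^esub> endo_pow C A \<nu> k = a [^] k \<odot>\<^bsub>Hom C A A\<^esub> Ident C A \<and>
    Comp C B A B \<alpha> g \<oplus>\<^bsub>Hom C B B\<^esub> c \<odot>\<^bsub>Hom C B B\<^esub> endo_pow C B \<mu> k = a [^] k \<odot>\<^bsub>Hom C B B\<^esub> Ident C B"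
proof (induction k)
  case 0
  show ?case
    using assms by (intro bexI[of _ "\<zero>\<^bsub>Hom C B A\<^esub>"] bexI[of _ \<one>]) auto
next
  case (Suc k)
  then obtain g c where g: "g \<in> carrier (Hom C B A)" "c \<in> carrier R"
    and gA: "Comp C A B A g \<alpha> \<oplus>\<^bsub>Hom C A A\<^esub> c \<odot>\<^bsub>Hom C A A\<^esub> endo_pow C A \<nu> k = a [^] k \<odot>\<^bsub>Hom C A A\<^esub> Ident C A"
    and gB: "Comp C B A B \<alpha> g \<oplus>\<^bsub>Hom C B B\<^esub> c \<odot>\<^bsub>Hom C B B\<^esub> endo_pow C B \<mu> k = a [^] k \<odot>\<^bsub>Hom C B B\<^esub> Ident C B"
    by auto
  let ?N = "endo_pow C A \<nu> k" and ?M = "endo_pow C B \<mu> k"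
  \<comment> \<open>From g \<alpha> + c \<nu>^k = a^k, multiply by a and substitute a \<nu>^k =
    \<nu>^k \<beta> \<alpha> - \<nu>^(k+1). This produces the new quasi-inverse a g + c \<nu>^k
    \<beta> and the new coefficient -c.\<close>
  let ?g = "a \<odot>\<^bsub>Hom C B A\<^esub> g \<oplus>\<^bsub>Hom C B A\<^esub> c \<odot>\<^bsub>Hom C B A\<^esub> Comp C B A A ?N \<beta>"
  \<comment> \<open>Both sides are \<alpha> \<beta> \<alpha> minus a \<alpha>.\<close>
  have inter: "Comp C A A B \<alpha> \<nu> = Comp C A B B \<mu> \<alpha>"
  proof -
    have "Comp C A A B \<alpha> \<nu> \<oplus>\<^bsub>Hom C A B\<^esub> a \<odot>\<^bsub>Hom C A B\<^esub> \<alpha> = Comp C A A B \<alpha> (Comp C A B A \<beta> \<alpha>)"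
      unfolding \<nu> using assms(1-7) by (simp add: Comp_lin)
    also have "\<dots> = Comp C A B B (Comp C B A B \<alpha> \<beta>) \<alpha>"
      using assms(1-7) by (simp add: Comp_assoc)
    also have "\<dots> = Comp C A B B \<mu> \<alpha> \<oplus>\<^bsub>Hom C A B\<^esub> a \<odot>\<^bsub>Hom C A B\<^esub> \<alpha>"
      unfolding \<mu> using assms(1-7) by (simp add: Comp_lin)
    finally show ?thesis using assms(1-7) by (simp add: add_right_cancel')
  qed
  have M\<alpha>: "Comp C A A B \<alpha> ?N = Comp C A B B ?M \<alpha>"
    by (rule endo_pow_intertwine[OF AB(1,2) assms(6,7) AB(3) inter])
  have A: "Comp C A B A ?g \<alpha> \<oplus>\<^bsub>Hom C A A\<^esub> (\<ominus> c) \<odot>\<^bsub>Hom C A A\<^esub> endo_pow C A \<nu> (Suc k) = a [^] Suc k \<odot>\<^bsub>Hom C A A\<^esub> Ident C A"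
  proof -
    have "Comp C A A A ?N (Comp C A B A \<beta> \<alpha>) = endo_pow C A \<nu> (Suc k) \<oplus>\<^bsub>Hom C A A\<^esub> a \<odot>\<^bsub>Hom C A A\<^esub> ?N"
      unfolding \<nu> using assms(1-7) by (simp add: Comp_lin)
    then have e: "Comp C A B A (Comp C B A A ?N \<beta>) \<alpha> = endo_pow C A \<nu> (Suc k) \<oplus>\<^bsub>Hom C A A\<^esub> a \<odot>\<^bsub>Hom C A A\<^esub> ?N"
      using assms(1-7) by (simp add: Comp_assoc del: endo_pow.simps)
    have P: "endo_pow C A \<nu> (Suc k) \<in> carrier (Hom C A A)" using assms by (intro endo_pow_closed)
    have "Comp C A B A ?g \<alpha> \<oplus>\<^bsub>Hom C A A\<^esub> (\<ominus> c) \<odot>\<^bsub>Hom C A A\<^esub> endo_pow C A \<nu> (Suc k)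
        = a \<odot>\<^bsub>Hom C A A\<^esub> Comp C A B A g \<alpha> \<oplus>\<^bsub>Hom C A A\<^esub>
          (c \<odot>\<^bsub>Hom C A A\<^esub> (endo_pow C A \<nu> (Suc k) \<oplus>\<^bsub>Hom C A A\<^esub> a \<odot>\<^bsub>Hom C A A\<^esub> ?N) \<oplus>\<^bsub>Hom C A A\<^esub> (\<ominus> c) \<odot>\<^bsub>Hom C A A\<^esub> endo_pow C A \<nu> (Suc k))"
      using assms(1-7) g P by (simp add: Comp_lin e add_assoc' del: endo_pow.simps)
    also have "c \<odot>\<^bsub>Hom C A A\<^esub> (endo_pow C A \<nu> (Suc k) \<oplus>\<^bsub>Hom C A A\<^esub> a \<odot>\<^bsub>Hom C A A\<^esub> ?N) \<oplus>\<^bsub>Hom C A A\<^esub> (\<ominus> c) \<odot>\<^bsub>Hom C A A\<^esub> endo_pow C A \<nu> (Suc k)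
        = (c \<oplus> \<ominus> c) \<odot>\<^bsub>Hom C A A\<^esub> endo_pow C A \<nu> (Suc k) \<oplus>\<^bsub>Hom C A A\<^esub> a \<odot>\<^bsub>Hom C A A\<^esub> (c \<odot>\<^bsub>Hom C A A\<^esub> ?N)"
      using assms(1-7) g P
      by (simp add: smult_add_right smult_add_left smult_smult m_comm add_ac' smult_minus_cancel del: endo_pow.simps)
    also have "a \<odot>\<^bsub>Hom C A A\<^esub> Comp C A B A g \<alpha> \<oplus>\<^bsub>Hom C A A\<^esub> \<dots> = a \<odot>\<^bsub>Hom C A A\<^esub> (Comp C A B A g \<alpha> \<oplus>\<^bsub>Hom C A A\<^esub> c \<odot>\<^bsub>Hom C A A\<^esub> ?N)"
      using assms(1-7) g P by (simp add: smult_add_right R.r_neg del: endo_pow.simps)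
    also have "\<dots> = a [^] Suc k \<odot>\<^bsub>Hom C A A\<^esub> Ident C A"
      unfolding gA using assms(1-7) by (simp add: smult_smult m_comm)
    finally show ?thesis .
  qed
  have B: "Comp C B A B \<alpha> ?g \<oplus>\<^bsub>Hom C B B\<^esub> (\<ominus> c) \<odot>\<^bsub>Hom C B B\<^esub> endo_pow C B \<mu> (Suc k) = a [^] Suc k \<odot>\<^bsub>Hom C B B\<^esub> Ident C B"
  proof -
    have "Comp C B A B \<alpha> (Comp C B A A ?N \<beta>) = Comp C B B B ?M (Comp C B A B \<alpha> \<beta>)"
      using assms(1-7) M\<alpha> by (simp add: Comp_assoc)
    also have "\<dots> = endo_pow C B \<mu> (Suc k) \<oplus>\<^bsub>Hom C B B\<^esub> a \<odot>\<^bsub>Hom C B B\<^esub> ?M"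
      unfolding \<mu> using assms(1-7) by (simp add: Comp_lin)
    finally have e: "Comp C B A B \<alpha> (Comp C B A A ?N \<beta>) = endo_pow C B \<mu> (Suc k) \<oplus>\<^bsub>Hom C B B\<^esub> a \<odot>\<^bsub>Hom C B B\<^esub> ?M" .
    have P: "endo_pow C B \<mu> (Suc k) \<in> carrier (Hom C B B)" using assms by (intro endo_pow_closed)
    have "Comp C B A B \<alpha> ?g \<oplus>\<^bsub>Hom C B B\<^esub> (\<ominus> c) \<odot>\<^bsub>Hom C B B\<^esub> endo_pow C B \<mu> (Suc k)
        = a \<odot>\<^bsub>Hom C B B\<^esub> Comp C B A B \<alpha> g \<oplus>\<^bsub>Hom C B B\<^esub>
          (c \<odot>\<^bsub>Hom C B B\<^esub> (endo_pow C B \<mu> (Suc k) \<oplus>\<^bsub>Hom C B B\<^esub> a \<odot>\<^bsub>Hom C B B\<^esub> ?M) \<oplus>\<^bsub>Hom C B B\<^esub> (\<ominus> c) \<odot>\<^bsub>Hom C B B\<^esub> endo_pow C B \<mu> (Suc k))"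
      using assms(1-7) g P by (simp add: Comp_lin e add_assoc' del: endo_pow.simps)
    also have "c \<odot>\<^bsub>Hom C B B\<^esub> (endo_pow C B \<mu> (Suc k) \<oplus>\<^bsub>Hom C B B\<^esub> a \<odot>\<^bsub>Hom C B B\<^esub> ?M) \<oplus>\<^bsub>Hom C B B\<^esub> (\<ominus> c) \<odot>\<^bsub>Hom C B B\<^esub> endo_pow C B \<mu> (Suc k)
        = (c \<oplus> \<ominus> c) \<odot>\<^bsub>Hom C B B\<^esub> endo_pow C B \<mu> (Suc k) \<oplus>\<^bsub>Hom C B B\<^esub> a \<odot>\<^bsub>Hom C B B\<^esub> (c \<odot>\<^bsub>Hom C B B\<^esub> ?M)"
      using assms(1-7) g P
      by (simp add: smult_add_right smult_add_left smult_smult m_comm add_ac' smult_minus_cancel del: endo_pow.simps)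
    also have "a \<odot>\<^bsub>Hom C B B\<^esub> Comp C B A B \<alpha> g \<oplus>\<^bsub>Hom C B B\<^esub> \<dots> = a \<odot>\<^bsub>Hom C B B\<^esub> (Comp C B A B \<alpha> g \<oplus>\<^bsub>Hom C B B\<^esub> c \<odot>\<^bsub>Hom C B B\<^esub> ?M)"
      using assms(1-7) g P by (simp add: smult_add_right R.r_neg del: endo_pow.simps)
    also have "\<dots> = a [^] Suc k \<odot>\<^bsub>Hom C B B\<^esub> Ident C B"
      unfolding gB using assms(1-7) by (simp add: smult_smult m_comm)
    finally show ?thesis .
  qed
  show ?case
    using A B g assms(1-7) by (intro bexI[of _ ?g] bexI[of _ "\<ominus> c"] conjI) simp_all
qed

text \<open>Beyond the nilpotency exponents of both errors the remainder terms of the geometric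
  series vanish. A power replaces \<open>a\<close>, which is harmless: a prime ideal containing it
  contains \<open>a\<close>.\<close>

lemma quasi_inverse_exact:
  assumes "A \<in> Obj C" "B \<in> Obj C" "quasi_inverse R C A B \<alpha> \<beta> a"
  shows "\<exists>n::nat. \<exists>g\<in>carrier (Hom C B A).
    Comp C A B A g \<alpha> = a [^] n \<odot>\<^bsub>Hom C A A\<^esub> Ident C A \<and>
    Comp C B A B \<alpha> g = a [^] n \<odot>\<^bsub>Hom C B B\<^esub> Ident C B"
proof -
  let ?\<nu> = "Comp C A B A \<beta> \<alpha> \<ominus>\<^bsub>Hom C A A\<^esub> a \<odot>\<^bsub>Hom C A A\<^esub> Ident C A"
  let ?\<mu> = "Comp C B A B \<alpha> \<beta> \<ominus>\<^bsub>Hom C B B\<^esub> a \<odot>\<^bsub>Hom C B B\<^esub> Ident C B"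
  have q: "\<alpha> \<in> carrier (Hom C A B)" "\<beta> \<in> carrier (Hom C B A)" "a \<in> carrier R"
      "?\<nu> \<in> nilrad C A A" "?\<mu> \<in> nilrad C B B"
    using assms(3) by (auto simp: quasi_inverse_def congruent_nil_def)
  obtain m n where mn: "endo_pow C A ?\<nu> m = \<zero>\<^bsub>Hom C A A\<^esub>" "endo_pow C B ?\<mu> n = \<zero>\<^bsub>Hom C B B\<^esub>"
    using nilrad_nilpotent q assms(1,2) by meson
  let ?k = "max m n"
  have z: "endo_pow C A ?\<nu> ?k = \<zero>\<^bsub>Hom C A A\<^esub>" "endo_pow C B ?\<mu> ?k = \<zero>\<^bsub>Hom C B B\<^esub>"
    using endo_pow_mono[OF assms(1) _ mn(1), of ?k] endo_pow_mono[OF assms(2) _ mn(2), of ?k] q(1-3) assms(1,2)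
    by simp_all
  show ?thesis
    using geometric_quasi_inverse[OF assms(1,2) q(1-3), of ?\<nu> ?\<mu> ?k] q(1-3) assms(1,2)
    unfolding z by (auto simp: minus_add_cancel')
qed

text \<open>Essential nilpotency after inverting \<open>S\<close>, expressed without leaving the
  category: the products need to vanish only up to a scalar in \<open>S\<close>, which may depend on
  the sequence. For S = {1} this is the condition in \<open>nilrad\<close>.\<close>

definition loc_nil :: "'r set \<Rightarrow> 'o \<Rightarrow> 'm \<Rightarrow> bool" where
  "loc_nil S A t \<longleftrightarrow> (\<forall>b\<in>UNIV \<rightarrow> carrier (Hom C A A). \<exists>n. \<exists>u\<in>S.
     u \<odot>\<^bsub>Hom C A A\<^esub> alt_prod C A A t b n = \<zero>\<^bsub>Hom C A A\<^esub>)"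

lemma alt_prod_killed_mono:
  assumes "A \<in> Obj C" "t \<in> carrier (Hom C A A)" "\<And>n. b n \<in> carrier (Hom C A A)" "u \<in> carrier R"
    "u \<odot>\<^bsub>Hom C A A\<^esub> alt_prod C A A t b m = \<zero>\<^bsub>Hom C A A\<^esub>" "m \<le> n"
  shows "u \<odot>\<^bsub>Hom C A A\<^esub> alt_prod C A A t b n = \<zero>\<^bsub>Hom C A A\<^esub>"
  using assms(6,5)
proof (induction rule: dec_induct)
  case (step n)
  have "u \<odot>\<^bsub>Hom C A A\<^esub> alt_prod C A A t b (Suc n)
      = Comp C A A A (u \<odot>\<^bsub>Hom C A A\<^esub> alt_prod C A A t b n) (Comp C A A A (b n) t)"
    using assms(1-4) by (simp add: Comp_smult_left)
  then show ?case using step assms(1-4) by simp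
qed

text \<open>As i p = c, the map f to p f i is multiplicative up to the factor c. Conjugating
  \<open>t\<close> and all \<open>b n\<close> multiplies the conjugated product by c^(2n), two
  factors for each further step. Applying i on the left and p on the right recovers the original
  product times c^2.\<close>

lemma loc_nil_transfer:
  assumes "A \<in> Obj C" "X \<in> Obj C" "p \<in> carrier (Hom C A X)" "i \<in> carrier (Hom C X A)"
    "t \<in> carrier (Hom C A A)" "c \<in> carrier R" "S \<subseteq> carrier R"
    and ip: "Comp C A X A i p = c \<odot>\<^bsub>Hom C A A\<^esub> Ident C A"
    and nil: "loc_nil S X (Comp C X A X p (Comp C X A A t i))"
    and b: "\<And>n. b n \<in> carrier (Hom C A A)"
  shows "\<exists>n. \<exists>u\<in>S. \<exists>k::nat. (u \<otimes> c [^] k) \<odot>\<^bsub>Hom C A A\<^esub> alt_prod C A A t b n = \<zero>\<^bsub>Hom C A A\<^esub>"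
proof -
  define conj where "conj f = Comp C X A X p (Comp C X A A f i)" for f
  have conj_closed [simp]: "conj f \<in> carrier (Hom C X X)" if "f \<in> carrier (Hom C A A)" for f
    using that assms(1-4) by (simp add: conj_def)
  have conj_comp: "Comp C X X X (conj f) (conj g) = c \<odot>\<^bsub>Hom C X X\<^esub> conj (Comp C A A A f g)"
    if fg: "f \<in> carrier (Hom C A A)" "g \<in> carrier (Hom C A A)" for f g
  proof -
    have "Comp C X X X (conj f) (conj g)
        = Comp C X A X (Comp C A A X (Comp C A A X p f) (Comp C A X A i p)) (Comp C X A A g i)"
      using fg assms(1-4) unfolding conj_def by (simp add: Comp_assoc)
    also have "\<dots> = c \<odot>\<^bsub>Hom C X X\<^esub> conj (Comp C A A A f g)"
      unfolding ip using fg assms(1-6) unfolding conj_def by (simp add: Comp_lin Comp_assoc)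
    finally show ?thesis .
  qed
  have prod: "alt_prod C X X (conj t) (\<lambda>n. conj (b n)) n = c [^] (2 * n) \<odot>\<^bsub>Hom C X X\<^esub> conj (alt_prod C A A t b n)" for n
  proof (induction n)
    case 0
    show ?case using assms by simp
  next
    case (Suc n)
    have "alt_prod C X X (conj t) (\<lambda>n. conj (b n)) (Suc n)
        = Comp C X X X (c [^] (2 * n) \<odot>\<^bsub>Hom C X X\<^esub> conj (alt_prod C A A t b n)) (c \<odot>\<^bsub>Hom C X X\<^esub> conj (Comp C A A A (b n) t))"
      using Suc assms(5) b by (simp add: conj_comp)
    also have "\<dots> = (c [^] (2 * n) \<otimes> (c \<otimes> c)) \<odot>\<^bsub>Hom C X X\<^esub> conj (alt_prod C A A t b (Suc n))"
      using assms(1,2,5,6) b by (simp add: conj_comp Comp_lin smult_smult m_ac)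
    finally show ?case using assms(6) by (simp add: m_assoc)
  qed
  have "(\<lambda>n. conj (b n)) \<in> UNIV \<rightarrow> carrier (Hom C X X)" using b by auto
  then obtain n u where u: "u \<in> S" "u \<odot>\<^bsub>Hom C X X\<^esub> alt_prod C X X (conj t) (\<lambda>n. conj (b n)) n = \<zero>\<^bsub>Hom C X X\<^esub>"
    using nil unfolding loc_nil_def conj_def by blast
  have uR: "u \<in> carrier R" using u assms(7) by auto
  let ?P = "alt_prod C A A t b n"
  have P: "?P \<in> carrier (Hom C A A)" using assms(1,5) b by simp
  have "Comp C A X A i (Comp C A X X (conj ?P) p) = Comp C A A A (Comp C A X A i p) (Comp C A A A ?P (Comp C A X A i p))"
    using assms(1-4) P unfolding conj_def by (simp add: Comp_assoc)
  also have "\<dots> = (c \<otimes> c) \<odot>\<^bsub>Hom C A A\<^esub> ?P"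
    unfolding ip using assms(1,6) P by (simp add: Comp_lin smult_smult)
  finally have cc: "Comp C A X A i (Comp C A X X (conj ?P) p) = (c \<otimes> c) \<odot>\<^bsub>Hom C A A\<^esub> ?P" .
  have "(u \<otimes> c [^] (2 * n)) \<odot>\<^bsub>Hom C X X\<^esub> conj ?P = \<zero>\<^bsub>Hom C X X\<^esub>"
    using u(2) uR assms(2,6) P unfolding prod by (simp add: smult_smult)
  then have "Comp C A X A i (Comp C A X X ((u \<otimes> c [^] (2 * n)) \<odot>\<^bsub>Hom C X X\<^esub> conj ?P) p) = \<zero>\<^bsub>Hom C A A\<^esub>"
    using assms(1-4) by simp
  then have "(u \<otimes> c [^] (2 * n)) \<odot>\<^bsub>Hom C A A\<^esub> ((c \<otimes> c) \<odot>\<^bsub>Hom C A A\<^esub> ?P) = \<zero>\<^bsub>Hom C A A\<^esub>"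
    using assms(1-4,6) P uR by (simp add: Comp_lin cc)
  then have "(u \<otimes> c [^] (2 * n + 2)) \<odot>\<^bsub>Hom C A A\<^esub> ?P = \<zero>\<^bsub>Hom C A A\<^esub>"
    using assms(1,6) P uR by (simp add: smult_smult m_assoc)
  then show ?thesis using u(1) by blast
qed

lemma tors_conj:
  assumes "A \<in> Obj C" "X \<in> Obj C" "p \<in> carrier (Hom C A X)" "i \<in> carrier (Hom C X A)" "t \<in> tors R C A A"
  shows "Comp C X A X p (Comp C X A A t i) \<in> tors R C X X"
proof -
  obtain r where r: "t \<in> carrier (Hom C A A)" "r \<in> carrier R - {\<zero>}" "r \<odot>\<^bsub>Hom C A A\<^esub> t = \<zero>\<^bsub>Hom C A A\<^esub>"
    using assms(5) by (auto simp: tors_def)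
  have "r \<odot>\<^bsub>Hom C X X\<^esub> Comp C X A X p (Comp C X A A t i) = Comp C X A X p (Comp C X A A (r \<odot>\<^bsub>Hom C A A\<^esub> t) i)"
    using r(1,2) assms(1-4) by (simp add: Comp_lin)
  also have "\<dots> = \<zero>\<^bsub>Hom C X X\<^esub>" unfolding r(3) using assms(1-4) by simp
  finally show ?thesis using r(1,2) assms(1-4) by (auto simp: tors_def)
qed

lemma torsion_reduced_loc_nil:
  assumes "torsion_reduced R C B" "t \<in> tors R C B B"
  shows "loc_nil {\<one>} B t"
  unfolding loc_nil_def
proof
  fix b :: "nat \<Rightarrow> 'm" assume b: "b \<in> UNIV \<rightarrow> carrier (Hom C B B)"
  have "B \<in> Obj C" "t \<in> nilrad C B B" using assms by (auto simp: torsion_reduced_def)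
  then show "\<exists>n. \<exists>u\<in>{\<one>}. u \<odot>\<^bsub>Hom C B B\<^esub> alt_prod C B B t b n = \<zero>\<^bsub>Hom C B B\<^esub>"
    using b by (auto simp: nilrad_def Pi_iff smult_one' alt_prod_closed)
qed

end

section \<open>Vanishing of morphisms from vanishing at every maximal ideal\<close>

locale dedekind_category = dedekind_domain R + r_category R C
  for R :: "('r, 'k) ring_scheme" (structure) and C :: "('o, 'r, 'm) mcat"
begin

lemma annihilator_ideal:
  assumes "A \<in> Obj C" "B \<in> Obj C" "f \<in> carrier (Hom C A B)"
  shows "ideal {r \<in> carrier R. r \<odot>\<^bsub>Hom C A B\<^esub> f = \<zero>\<^bsub>Hom C A B\<^esub>} R"
proof (rule idealI[OF ring_axioms])
  have "\<ominus> r \<odot>\<^bsub>Hom C A B\<^esub> f = \<zero>\<^bsub>Hom C A B\<^esub>" if "r \<in> carrier R" "r \<odot>\<^bsub>Hom C A B\<^esub> f = \<zero>\<^bsub>Hom C A B\<^esub>" for r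
    using smult_add_left[of A B r "\<ominus> r" f] assms that by (simp add: r_neg)
  then show "subgroup {r \<in> carrier R. r \<odot>\<^bsub>Hom C A B\<^esub> f = \<zero>\<^bsub>Hom C A B\<^esub>} (add_monoid R)"
    using assms by unfold_locales (auto simp: smult_add_left a_inv_def[symmetric])
next
  fix r x assume rx: "r \<in> {r \<in> carrier R. r \<odot>\<^bsub>Hom C A B\<^esub> f = \<zero>\<^bsub>Hom C A B\<^esub>}" "x \<in> carrier R"
  then have "(x \<otimes> r) \<odot>\<^bsub>Hom C A B\<^esub> f = \<zero>\<^bsub>Hom C A B\<^esub>"
    using assms by (simp add: smult_smult[symmetric])
  then show "x \<otimes> r \<in> {r \<in> carrier R. r \<odot>\<^bsub>Hom C A B\<^esub> f = \<zero>\<^bsub>Hom C A B\<^esub>}"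
    "r \<otimes> x \<in> {r \<in> carrier R. r \<odot>\<^bsub>Hom C A B\<^esub> f = \<zero>\<^bsub>Hom C A B\<^esub>}"
    using rx by (simp_all add: m_comm)
qed

text \<open>The annihilator of \<open>f\<close> is an ideal contained in no maximal ideal, so it
  contains 1.\<close>

lemma zero_if_locally_killed:
  assumes "A \<in> Obj C" "B \<in> Obj C" "f \<in> carrier (Hom C A B)"
    and loc: "\<And>\<qq>. \<qq> \<in> max_spec R \<Longrightarrow> \<exists>r\<in>carrier R - \<qq>. r \<odot>\<^bsub>Hom C A B\<^esub> f = \<zero>\<^bsub>Hom C A B\<^esub>"
  shows "f = \<zero>\<^bsub>Hom C A B\<^esub>"
proof (rule ccontr)
  assume "f \<noteq> \<zero>\<^bsub>Hom C A B\<^esub>"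
  then have "\<one> \<notin> {r \<in> carrier R. r \<odot>\<^bsub>Hom C A B\<^esub> f = \<zero>\<^bsub>Hom C A B\<^esub>}" using assms(1-3) by simp
  then obtain \<qq> where q: "maximalideal \<qq> R" "{r \<in> carrier R. r \<odot>\<^bsub>Hom C A B\<^esub> f = \<zero>\<^bsub>Hom C A B\<^esub>} \<subseteq> \<qq>"
    using exists_maximalideal[OF annihilator_ideal[OF assms(1-3)]] by blast
  then show False using loc[of \<qq>] by (auto simp: max_spec_def)
qed

end

section \<open>Gluing along an idempotent\<close>

locale biproduct = r_category R C
  for R :: "('r, 'k) ring_scheme" (structure) and C :: "('o, 'r, 'm) mcat" +
  fixes X B Y :: 'o and \<iota>\<^sub>1 \<pi>\<^sub>1 \<iota>\<^sub>2 \<pi>\<^sub>2 :: 'm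
  assumes Obj [simp]: "X \<in> Obj C" "B \<in> Obj C" "Y \<in> Obj C"
    and inj_closed [simp]: "\<iota>\<^sub>1 \<in> carrier (Hom C X Y)" "\<iota>\<^sub>2 \<in> carrier (Hom C B Y)"
    and proj_closed [simp]: "\<pi>\<^sub>1 \<in> carrier (Hom C Y X)" "\<pi>\<^sub>2 \<in> carrier (Hom C Y B)"
    and proj_inj [simp]: "Comp C X Y X \<pi>\<^sub>1 \<iota>\<^sub>1 = Ident C X" "Comp C B Y B \<pi>\<^sub>2 \<iota>\<^sub>2 = Ident C B"
      "Comp C X Y B \<pi>\<^sub>2 \<iota>\<^sub>1 = \<zero>\<^bsub>Hom C X B\<^esub>" "Comp C B Y X \<pi>\<^sub>1 \<iota>\<^sub>2 = \<zero>\<^bsub>Hom C B X\<^esub>"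
    and inj_proj: "Comp C Y X Y \<iota>\<^sub>1 \<pi>\<^sub>1 \<oplus>\<^bsub>Hom C Y Y\<^esub> Comp C Y B Y \<iota>\<^sub>2 \<pi>\<^sub>2 = Ident C Y"
begin

lemma proj_inj_comp [simp]:
  "\<lbrakk>Z \<in> Obj C; f \<in> carrier (Hom C Z X)\<rbrakk> \<Longrightarrow> Comp C Z Y X \<pi>\<^sub>1 (Comp C Z X Y \<iota>\<^sub>1 f) = f"
  "\<lbrakk>Z \<in> Obj C; f \<in> carrier (Hom C Z B)\<rbrakk> \<Longrightarrow> Comp C Z Y B \<pi>\<^sub>2 (Comp C Z B Y \<iota>\<^sub>2 f) = f"
  "\<lbrakk>Z \<in> Obj C; f \<in> carrier (Hom C Z X)\<rbrakk> \<Longrightarrow> Comp C Z Y B \<pi>\<^sub>2 (Comp C Z X Y \<iota>\<^sub>1 f) = \<zero>\<^bsub>Hom C Z B\<^esub>"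
  "\<lbrakk>Z \<in> Obj C; f \<in> carrier (Hom C Z B)\<rbrakk> \<Longrightarrow> Comp C Z Y X \<pi>\<^sub>1 (Comp C Z B Y \<iota>\<^sub>2 f) = \<zero>\<^bsub>Hom C Z X\<^esub>"
  by (simp_all add: Comp_assoc)

text \<open>The endomorphism of \<open>Y\<close> given by a 2 by 2 matrix with respect to the
  decomposition into \<open>X\<close> and \<open>B\<close>; the entry
  \<open>m\<^sub>1\<^sub>2\<close> goes from \<open>B\<close> to \<open>X\<close>.\<close>

definition blk :: "'m \<Rightarrow> 'm \<Rightarrow> 'm \<Rightarrow> 'm \<Rightarrow> 'm" where
  "blk m\<^sub>1\<^sub>1 m\<^sub>1\<^sub>2 m\<^sub>2\<^sub>1 m\<^sub>2\<^sub>2 =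
     (Comp C Y X Y \<iota>\<^sub>1 (Comp C Y X X m\<^sub>1\<^sub>1 \<pi>\<^sub>1) \<oplus>\<^bsub>Hom C Y Y\<^esub> Comp C Y X Y \<iota>\<^sub>1 (Comp C Y B X m\<^sub>1\<^sub>2 \<pi>\<^sub>2)) \<oplus>\<^bsub>Hom C Y Y\<^esub>
     (Comp C Y B Y \<iota>\<^sub>2 (Comp C Y X B m\<^sub>2\<^sub>1 \<pi>\<^sub>1) \<oplus>\<^bsub>Hom C Y Y\<^esub> Comp C Y B Y \<iota>\<^sub>2 (Comp C Y B B m\<^sub>2\<^sub>2 \<pi>\<^sub>2))"

lemma blk_closed [simp]:
  "\<lbrakk>m\<^sub>1\<^sub>1 \<in> carrier (Hom C X X); m\<^sub>1\<^sub>2 \<in> carrier (Hom C B X); m\<^sub>2\<^sub>1 \<in> carrier (Hom C X B); m\<^sub>2\<^sub>2 \<in> carrier (Hom C B B)\<rbrakk>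
    \<Longrightarrow> blk m\<^sub>1\<^sub>1 m\<^sub>1\<^sub>2 m\<^sub>2\<^sub>1 m\<^sub>2\<^sub>2 \<in> carrier (Hom C Y Y)"
  by (simp add: blk_def)

definition row :: "'o \<Rightarrow> 'm \<Rightarrow> 'm \<Rightarrow> 'm" where
  "row Z u v = Comp C Y X Z u \<pi>\<^sub>1 \<oplus>\<^bsub>Hom C Y Z\<^esub> Comp C Y B Z v \<pi>\<^sub>2"

definition col :: "'o \<Rightarrow> 'm \<Rightarrow> 'm \<Rightarrow> 'm" where
  "col Z u v = Comp C Z X Y \<iota>\<^sub>1 u \<oplus>\<^bsub>Hom C Z Y\<^esub> Comp C Z B Y \<iota>\<^sub>2 v"

lemma row_closed [simp]:
  "\<lbrakk>Z \<in> Obj C; u \<in> carrier (Hom C X Z); v \<in> carrier (Hom C B Z)\<rbrakk> \<Longrightarrow> row Z u v \<in> carrier (Hom C Y Z)"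
  by (simp add: row_def)

lemma col_closed [simp]:
  "\<lbrakk>Z \<in> Obj C; u \<in> carrier (Hom C Z X); v \<in> carrier (Hom C Z B)\<rbrakk> \<Longrightarrow> col Z u v \<in> carrier (Hom C Z Y)"
  by (simp add: col_def)

lemma col_row:
  assumes "Z \<in> Obj C" "u \<in> carrier (Hom C Z X)" "v \<in> carrier (Hom C Z B)"
    "u' \<in> carrier (Hom C X Z)" "v' \<in> carrier (Hom C B Z)"
  shows "Comp C Y Z Y (col Z u v) (row Z u' v') =
    blk (Comp C X Z X u u') (Comp C B Z X u v') (Comp C X Z B v u') (Comp C B Z B v v')"
  using assms by (simp add: blk_def row_def col_def Comp_lin Comp_assoc[symmetric] add_ac')

context
  fixes m\<^sub>1\<^sub>1 m\<^sub>1\<^sub>2 m\<^sub>2\<^sub>1 m\<^sub>2\<^sub>2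
  assumes m: "m\<^sub>1\<^sub>1 \<in> carrier (Hom C X X)" "m\<^sub>1\<^sub>2 \<in> carrier (Hom C B X)"
    "m\<^sub>2\<^sub>1 \<in> carrier (Hom C X B)" "m\<^sub>2\<^sub>2 \<in> carrier (Hom C B B)"
begin

lemma proj_blk:
  "Comp C Y Y X \<pi>\<^sub>1 (blk m\<^sub>1\<^sub>1 m\<^sub>1\<^sub>2 m\<^sub>2\<^sub>1 m\<^sub>2\<^sub>2) = row X m\<^sub>1\<^sub>1 m\<^sub>1\<^sub>2"
  "Comp C Y Y B \<pi>\<^sub>2 (blk m\<^sub>1\<^sub>1 m\<^sub>1\<^sub>2 m\<^sub>2\<^sub>1 m\<^sub>2\<^sub>2) = row B m\<^sub>2\<^sub>1 m\<^sub>2\<^sub>2"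
  using m by (simp_all add: blk_def row_def Comp_lin)

lemma blk_inj:
  "Comp C X Y Y (blk m\<^sub>1\<^sub>1 m\<^sub>1\<^sub>2 m\<^sub>2\<^sub>1 m\<^sub>2\<^sub>2) \<iota>\<^sub>1 = col X m\<^sub>1\<^sub>1 m\<^sub>2\<^sub>1"
  "Comp C B Y Y (blk m\<^sub>1\<^sub>1 m\<^sub>1\<^sub>2 m\<^sub>2\<^sub>1 m\<^sub>2\<^sub>2) \<iota>\<^sub>2 = col B m\<^sub>1\<^sub>2 m\<^sub>2\<^sub>2"
  using m by (simp_all add: blk_def col_def Comp_lin Comp_assoc[symmetric])

lemma smult_blk:
  "r \<in> carrier R \<Longrightarrow> r \<odot>\<^bsub>Hom C Y Y\<^esub> blk m\<^sub>1\<^sub>1 m\<^sub>1\<^sub>2 m\<^sub>2\<^sub>1 m\<^sub>2\<^sub>2 =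
     blk (r \<odot>\<^bsub>Hom C X X\<^esub> m\<^sub>1\<^sub>1) (r \<odot>\<^bsub>Hom C B X\<^esub> m\<^sub>1\<^sub>2) (r \<odot>\<^bsub>Hom C X B\<^esub> m\<^sub>2\<^sub>1) (r \<odot>\<^bsub>Hom C B B\<^esub> m\<^sub>2\<^sub>2)"
  using m by (simp add: blk_def Comp_lin smult_add_right)

lemma blk_add:
  assumes "n\<^sub>1\<^sub>1 \<in> carrier (Hom C X X)" "n\<^sub>1\<^sub>2 \<in> carrier (Hom C B X)"
    "n\<^sub>2\<^sub>1 \<in> carrier (Hom C X B)" "n\<^sub>2\<^sub>2 \<in> carrier (Hom C B B)"
  shows "blk m\<^sub>1\<^sub>1 m\<^sub>1\<^sub>2 m\<^sub>2\<^sub>1 m\<^sub>2\<^sub>2 \<oplus>\<^bsub>Hom C Y Y\<^esub> blk n\<^sub>1\<^sub>1 n\<^sub>1\<^sub>2 n\<^sub>2\<^sub>1 n\<^sub>2\<^sub>2 =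
    blk (m\<^sub>1\<^sub>1 \<oplus>\<^bsub>Hom C X X\<^esub> n\<^sub>1\<^sub>1) (m\<^sub>1\<^sub>2 \<oplus>\<^bsub>Hom C B X\<^esub> n\<^sub>1\<^sub>2) (m\<^sub>2\<^sub>1 \<oplus>\<^bsub>Hom C X B\<^esub> n\<^sub>2\<^sub>1) (m\<^sub>2\<^sub>2 \<oplus>\<^bsub>Hom C B B\<^esub> n\<^sub>2\<^sub>2)"
  using m assms by (simp add: blk_def Comp_lin add_ac')

end

lemma blk_Ident: "blk (Ident C X) \<zero>\<^bsub>Hom C B X\<^esub> \<zero>\<^bsub>Hom C X B\<^esub> (Ident C B) = Ident C Y"
  by (simp add: blk_def inj_proj)

text \<open>Insert the decomposition of the identity of \<open>Y\<close> between the factors. For f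
  = g = \<open>E\<close> the parts through \<open>X\<close> and through \<open>B\<close> are
  separately multiples of \<open>E\<close>, and each is needed on its own as well.\<close>

lemma sum_comp_split:
  assumes "f \<in> carrier (Hom C Y Y)" "g \<in> carrier (Hom C Y Y)"
  shows "Comp C Y Y Y f g =
    Comp C Y X Y (Comp C X Y Y f \<iota>\<^sub>1) (Comp C Y Y X \<pi>\<^sub>1 g) \<oplus>\<^bsub>Hom C Y Y\<^esub>
    Comp C Y B Y (Comp C B Y Y f \<iota>\<^sub>2) (Comp C Y Y B \<pi>\<^sub>2 g)"
proof -
  have "Comp C Y Y Y f g = Comp C Y Y Y f (Comp C Y Y Y
      (Comp C Y X Y \<iota>\<^sub>1 \<pi>\<^sub>1 \<oplus>\<^bsub>Hom C Y Y\<^esub> Comp C Y B Y \<iota>\<^sub>2 \<pi>\<^sub>2) g)"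
    unfolding inj_proj using assms by simp
  then show ?thesis using assms by (simp add: Comp_lin Comp_assoc[symmetric])
qed

end

text \<open>The idempotent \<open>E = [[x\<epsilon>, s\<gamma>], [z\<phi>, w]]\<close> of \<open>X \<oplus> B\<close>. Where \<open>w\<close> is invertible its image is \<open>B\<close>, where \<open>x\<close>
  and \<open>s\<close> are invertible its image is the image of the idempotent \<open>\<epsilon>/s\<close>.\<close>

locale glue = biproduct R C X B Y \<iota>\<^sub>1 \<pi>\<^sub>1 \<iota>\<^sub>2 \<pi>\<^sub>2
  for R :: "('r, 'k) ring_scheme" (structure) and C :: "('o, 'r, 'm) mcat"
    and X B Y \<iota>\<^sub>1 \<pi>\<^sub>1 \<iota>\<^sub>2 \<pi>\<^sub>2 +
  fixes \<epsilon> \<phi> \<gamma> s a x w z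
  assumes mor_closed [simp]: "\<epsilon> \<in> carrier (Hom C X X)" "\<phi> \<in> carrier (Hom C X B)" "\<gamma> \<in> carrier (Hom C B X)"
    and scalar_closed [simp]: "s \<in> carrier R" "a \<in> carrier R" "x \<in> carrier R" "w \<in> carrier R" "z \<in> carrier R"
    and \<epsilon>\<epsilon>: "Comp C X X X \<epsilon> \<epsilon> = s \<odot>\<^bsub>Hom C X X\<^esub> \<epsilon>"
    and \<phi>\<epsilon>: "Comp C X X B \<phi> \<epsilon> = s \<odot>\<^bsub>Hom C X B\<^esub> \<phi>"
    and \<epsilon>\<gamma>: "Comp C B X X \<epsilon> \<gamma> = s \<odot>\<^bsub>Hom C B X\<^esub> \<gamma>"
    and \<phi>\<gamma>: "Comp C B X B \<phi> \<gamma> = a \<odot>\<^bsub>Hom C B B\<^esub> Ident C B"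
    and \<gamma>\<phi>: "s \<odot>\<^bsub>Hom C X X\<^esub> Comp C X B X \<gamma> \<phi> = a \<odot>\<^bsub>Hom C X X\<^esub> \<epsilon>"
    and w_xs: "w \<oplus> x \<otimes> s = \<one>"
    and xw: "x \<otimes> w = a \<otimes> z"
begin

definition E :: 'm where
  "E = blk (x \<odot>\<^bsub>Hom C X X\<^esub> \<epsilon>) (s \<odot>\<^bsub>Hom C B X\<^esub> \<gamma>) (z \<odot>\<^bsub>Hom C X B\<^esub> \<phi>) (w \<odot>\<^bsub>Hom C B B\<^esub> Ident C B)"

lemma E_closed [simp]: "E \<in> carrier (Hom C Y Y)"
  by (simp add: E_def)

lemma proj_E:
  "Comp C Y Y X \<pi>\<^sub>1 E = row X (x \<odot>\<^bsub>Hom C X X\<^esub> \<epsilon>) (s \<odot>\<^bsub>Hom C B X\<^esub> \<gamma>)"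
  "Comp C Y Y B \<pi>\<^sub>2 E = row B (z \<odot>\<^bsub>Hom C X B\<^esub> \<phi>) (w \<odot>\<^bsub>Hom C B B\<^esub> Ident C B)"
  unfolding E_def by (simp_all add: proj_blk)

lemma E_inj:
  "Comp C X Y Y E \<iota>\<^sub>1 = col X (x \<odot>\<^bsub>Hom C X X\<^esub> \<epsilon>) (z \<odot>\<^bsub>Hom C X B\<^esub> \<phi>)"
  "Comp C B Y Y E \<iota>\<^sub>2 = col B (s \<odot>\<^bsub>Hom C B X\<^esub> \<gamma>) (w \<odot>\<^bsub>Hom C B B\<^esub> Ident C B)"
  unfolding E_def by (simp_all add: blk_inj)

text \<open>Only s \<gamma> \<phi>, not \<gamma> \<phi>, is known to be a multiple of \<epsilon>;
  the factor s in the upper right entry of \<open>E\<close> is there to supply it. Then a z = x w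
  makes the result w times the upper left entry of \<open>E\<close>.\<close>

lemma z\<gamma>\<phi>: "(z \<otimes> s) \<odot>\<^bsub>Hom C X X\<^esub> Comp C X B X \<gamma> \<phi> = (x \<otimes> w) \<odot>\<^bsub>Hom C X X\<^esub> \<epsilon>"
proof -
  have "(z \<otimes> s) \<odot>\<^bsub>Hom C X X\<^esub> Comp C X B X \<gamma> \<phi> = z \<odot>\<^bsub>Hom C X X\<^esub> (s \<odot>\<^bsub>Hom C X X\<^esub> Comp C X B X \<gamma> \<phi>)"
    by (simp add: smult_smult)
  also have "\<dots> = (x \<otimes> w) \<odot>\<^bsub>Hom C X X\<^esub> \<epsilon>"
    unfolding \<gamma>\<phi> by (simp add: smult_smult xw m_comm)
  finally show ?thesis .
qed

text \<open>The part of \<open>E\<close> squared through \<open>X\<close> is x s times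
  \<open>E\<close>, and the part through \<open>B\<close> is w times \<open>E\<close> by
  \<open>E_B_E\<close>. The scalars add up to 1, which gives idempotence, and each of them measures
  where the image of \<open>E\<close> can be compared with the corresponding summand.\<close>

lemma E_X_E:
  "Comp C Y X Y (Comp C X Y Y E \<iota>\<^sub>1) (Comp C Y Y X \<pi>\<^sub>1 E) = (x \<otimes> s) \<odot>\<^bsub>Hom C Y Y\<^esub> E"
proof -
  have "z \<otimes> s \<otimes> a = x \<otimes> s \<otimes> w"
  proof -
    have "z \<otimes> s \<otimes> a = s \<otimes> (a \<otimes> z)" by (simp add: m_ac)
    also have "\<dots> = x \<otimes> s \<otimes> w" by (simp add: xw[symmetric] m_ac)
    finally show ?thesis .
  qed
  then show ?thesis
    unfolding proj_E E_inj unfolding E_def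
    by (simp add: col_row smult_blk Comp_lin \<epsilon>\<epsilon> \<phi>\<epsilon> \<epsilon>\<gamma> \<phi>\<gamma> smult_smult) (simp add: m_ac)
qed

lemma E_B_E:
  "Comp C Y B Y (Comp C B Y Y E \<iota>\<^sub>2) (Comp C Y Y B \<pi>\<^sub>2 E) = w \<odot>\<^bsub>Hom C Y Y\<^esub> E"
  unfolding proj_E E_inj unfolding E_def
  using z\<gamma>\<phi> by (simp add: col_row smult_blk Comp_lin smult_smult m_comm)

lemma E_idem: "Comp C Y Y Y E E = E"
proof -
  have "Comp C Y Y Y E E = (x \<otimes> s) \<odot>\<^bsub>Hom C Y Y\<^esub> E \<oplus>\<^bsub>Hom C Y Y\<^esub> w \<odot>\<^bsub>Hom C Y Y\<^esub> E"
    by (simp add: sum_comp_split E_X_E E_B_E)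
  also have "\<dots> = (w \<oplus> x \<otimes> s) \<odot>\<^bsub>Hom C Y Y\<^esub> E"
    by (simp add: smult_add_left add_comm')
  finally show ?thesis by (simp add: w_xs)
qed

text \<open>Both entries of the first row of \<open>E\<close>, x \<epsilon> and s \<gamma>, are
  multiplied by s under composition with \<epsilon>. Hence the image of \<open>E\<close> maps into
  the part of \<open>X\<close> cut out by \<epsilon>/s.\<close>

lemma \<epsilon>_proj_E: "Comp C Y X X \<epsilon> (Comp C Y Y X \<pi>\<^sub>1 E) = s \<odot>\<^bsub>Hom C Y X\<^esub> Comp C Y Y X \<pi>\<^sub>1 E"
proof -
  have "Comp C Y X X \<epsilon> (row X u v) = row X (Comp C X X X \<epsilon> u) (Comp C B X X \<epsilon> v)"
    "s \<odot>\<^bsub>Hom C Y X\<^esub> row X u v = row X (s \<odot>\<^bsub>Hom C X X\<^esub> u) (s \<odot>\<^bsub>Hom C B X\<^esub> v)"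
    if "u \<in> carrier (Hom C X X)" "v \<in> carrier (Hom C B X)" for u v
    using that by (simp_all add: row_def Comp_lin Comp_assoc smult_add_right)
  then show ?thesis
    unfolding proj_E by (simp add: Comp_lin \<epsilon>\<epsilon> \<epsilon>\<gamma> smult_smult m_comm)
qed

end

locale glue_split = glue +
  fixes A r j
  assumes split_Obj [simp]: "A \<in> Obj C"
    and split_closed [simp]: "r \<in> carrier (Hom C Y A)" "j \<in> carrier (Hom C A Y)"
    and jr: "Comp C Y A Y j r = E" and rj: "Comp C A Y A r j = Ident C A"
begin

lemma rE: "Comp C Y Y A r E = r" and Ej: "Comp C A Y Y E j = j"
proof -
  have "Comp C Y Y A r E = Comp C Y A A (Comp C A Y A r j) r"
    unfolding jr[symmetric] by (simp add: Comp_assoc)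
  then show "Comp C Y Y A r E = r" by (simp add: rj)
  have "Comp C A Y Y E j = Comp C A A Y j (Comp C A Y A r j)"
    unfolding jr[symmetric] by (simp add: Comp_assoc)
  then show "Comp C A Y Y E j = j" by (simp add: rj)
qed

lemma conj_E:
  assumes "c \<in> carrier R"
  shows "Comp C A Y A r (Comp C A Y Y (c \<odot>\<^bsub>Hom C Y Y\<^esub> E) j) = c \<odot>\<^bsub>Hom C A A\<^esub> Ident C A"
  using assms by (simp add: Comp_lin Ej rj)

definition p_B where "p_B = Comp C A Y B \<pi>\<^sub>2 j"
definition i_B where "i_B = Comp C B Y A r \<iota>\<^sub>2"
definition p_X where "p_X = Comp C A Y X \<pi>\<^sub>1 j"
text \<open>The factor \<epsilon> forces the relation \<open>i_X_\<epsilon>\<close> required of a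
  retract; its price is one more factor s in the composite \<open>i_X_p_X\<close>.\<close>

definition i_X where "i_X = Comp C X Y A r (Comp C X X Y \<iota>\<^sub>1 \<epsilon>)"

lemma maps_closed [simp]:
  "p_B \<in> carrier (Hom C A B)" "i_B \<in> carrier (Hom C B A)"
  "p_X \<in> carrier (Hom C A X)" "i_X \<in> carrier (Hom C X A)"
  by (simp_all add: p_B_def i_B_def p_X_def i_X_def)

lemma p_B_i_B: "Comp C B A B p_B i_B = w \<odot>\<^bsub>Hom C B B\<^esub> Ident C B"
proof -
  have "Comp C B A B p_B i_B = Comp C B Y B \<pi>\<^sub>2 (Comp C B Y Y E \<iota>\<^sub>2)"
    unfolding p_B_def i_B_def jr[symmetric] by (simp add: Comp_assoc)
  then show ?thesis unfolding E_inj col_def by (simp add: Comp_lin)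
qed

lemma i_B_p_B: "Comp C A B A i_B p_B = w \<odot>\<^bsub>Hom C A A\<^esub> Ident C A"
proof -
  have "Comp C A B A i_B p_B = Comp C A B A (Comp C B Y A (Comp C Y Y A r E) \<iota>\<^sub>2) (Comp C A Y B \<pi>\<^sub>2 (Comp C A Y Y E j))"
    unfolding p_B_def i_B_def rE Ej ..
  also have "\<dots> = Comp C A Y A r (Comp C A Y Y (Comp C Y B Y (Comp C B Y Y E \<iota>\<^sub>2) (Comp C Y Y B \<pi>\<^sub>2 E)) j)"
    by (simp add: Comp_assoc)
  also have "\<dots> = w \<odot>\<^bsub>Hom C A A\<^esub> Ident C A"
    unfolding E_B_E by (rule conj_E) simp
  finally show ?thesis .
qed

lemma p_X_i_X: "Comp C X A X p_X i_X = (x \<otimes> s) \<odot>\<^bsub>Hom C X X\<^esub> \<epsilon>"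
proof -
  have "Comp C X A X p_X i_X = Comp C X X X (Comp C X Y X \<pi>\<^sub>1 (Comp C X Y Y E \<iota>\<^sub>1)) \<epsilon>"
    unfolding p_X_def i_X_def jr[symmetric] by (simp add: Comp_assoc)
  then show ?thesis unfolding E_inj col_def by (simp add: Comp_lin \<epsilon>\<epsilon> smult_smult)
qed

lemma \<epsilon>_p_X: "Comp C A X X \<epsilon> p_X = s \<odot>\<^bsub>Hom C A X\<^esub> p_X"
proof -
  have "Comp C A X X \<epsilon> (Comp C A Y X \<pi>\<^sub>1 (Comp C A Y Y E j)) = Comp C A Y X (Comp C Y X X \<epsilon> (Comp C Y Y X \<pi>\<^sub>1 E)) j"
    by (simp add: Comp_assoc)
  also have "\<dots> = s \<odot>\<^bsub>Hom C A X\<^esub> Comp C A Y X \<pi>\<^sub>1 (Comp C A Y Y E j)"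
    unfolding \<epsilon>_proj_E by (simp add: Comp_lin Comp_assoc)
  finally show ?thesis unfolding Ej p_X_def .
qed

lemma i_X_\<epsilon>: "Comp C X X A i_X \<epsilon> = s \<odot>\<^bsub>Hom C X A\<^esub> i_X"
  unfolding i_X_def by (simp add: Comp_assoc[symmetric] \<epsilon>\<epsilon> Comp_lin)

lemma i_X_p_X: "Comp C A X A i_X p_X = (x \<otimes> s \<otimes> s) \<odot>\<^bsub>Hom C A A\<^esub> Ident C A"
proof -
  have "Comp C A X A i_X p_X = Comp C A X A (Comp C X Y A r \<iota>\<^sub>1) (Comp C A X X \<epsilon> p_X)"
    unfolding i_X_def by (simp add: Comp_assoc)
  also have "\<dots> = s \<odot>\<^bsub>Hom C A A\<^esub> Comp C A X A (Comp C X Y A r \<iota>\<^sub>1) p_X"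
    unfolding \<epsilon>_p_X by (simp add: Comp_lin)
  also have "Comp C A X A (Comp C X Y A r \<iota>\<^sub>1) p_X
      = Comp C A X A (Comp C X Y A (Comp C Y Y A r E) \<iota>\<^sub>1) (Comp C A Y X \<pi>\<^sub>1 (Comp C A Y Y E j))"
    unfolding p_X_def rE Ej ..
  also have "\<dots> = Comp C A Y A r (Comp C A Y Y (Comp C Y X Y (Comp C X Y Y E \<iota>\<^sub>1) (Comp C Y Y X \<pi>\<^sub>1 E)) j)"
    by (simp add: Comp_assoc)
  also have "\<dots> = (x \<otimes> s) \<odot>\<^bsub>Hom C A A\<^esub> Ident C A"
    unfolding E_X_E by (rule conj_E) simp
  finally show ?thesis by (simp add: smult_smult m_comm)
qed

lemma loc_retract_X:
  assumes "x \<otimes> s \<otimes> s \<in> S"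
  shows "loc_retract R S C A X \<epsilon> s"
  by (rule loc_retractI[OF _ _ _ _ assms i_X_p_X _ \<epsilon>_p_X i_X_\<epsilon>])
    (simp_all add: p_X_i_X smult_smult m_ac)

lemma loc_iso_B:
  assumes "w \<in> S"
  shows "loc_iso R S C A B"
  by (rule loc_retractI[OF _ _ _ _ assms i_B_p_B]) (simp_all add: p_B_i_B)

text \<open>A second comparison with \<open>B\<close>, passing through \<open>X\<close> and then
  along \<phi> and \<gamma>. It serves where w is not invertible but a, x and s are. The scalar s in
  \<open>i_XB\<close> is needed because \<gamma> \<phi> is controlled only after multiplication by
  s.\<close>

definition p_XB where "p_XB = Comp C A X B \<phi> p_X"
definition i_XB where "i_XB = s \<odot>\<^bsub>Hom C B A\<^esub> Comp C B X A i_X \<gamma>"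

lemma maps_XB_closed [simp]: "p_XB \<in> carrier (Hom C A B)" "i_XB \<in> carrier (Hom C B A)"
  by (simp_all add: p_XB_def i_XB_def)

lemma i_XB_p_XB: "Comp C A B A i_XB p_XB = (a \<otimes> (x \<otimes> s \<otimes> s \<otimes> s)) \<odot>\<^bsub>Hom C A A\<^esub> Ident C A"
proof -
  have "Comp C A B A i_XB p_XB = Comp C A X A i_X (Comp C A X X (s \<odot>\<^bsub>Hom C X X\<^esub> Comp C X B X \<gamma> \<phi>) p_X)"
    unfolding i_XB_def p_XB_def by (simp add: Comp_lin Comp_assoc)
  also have "\<dots> = (a \<otimes> s) \<odot>\<^bsub>Hom C A A\<^esub> Comp C A X A i_X p_X"
    unfolding \<gamma>\<phi> by (simp add: Comp_lin \<epsilon>_p_X smult_smult)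
  also have "\<dots> = (a \<otimes> (x \<otimes> s \<otimes> s \<otimes> s)) \<odot>\<^bsub>Hom C A A\<^esub> Ident C A"
    unfolding i_X_p_X by (simp add: smult_smult m_ac)
  finally show ?thesis .
qed

lemma p_XB_i_XB: "Comp C B A B p_XB i_XB = (a \<otimes> (x \<otimes> s \<otimes> s \<otimes> s)) \<odot>\<^bsub>Hom C B B\<^esub> Ident C B"
proof -
  have "Comp C B A B p_XB i_XB = s \<odot>\<^bsub>Hom C B B\<^esub> Comp C B X B \<phi> (Comp C B X X (Comp C X A X p_X i_X) \<gamma>)"
    unfolding i_XB_def p_XB_def by (simp add: Comp_lin Comp_assoc)
  also have "\<dots> = (a \<otimes> (x \<otimes> s \<otimes> s \<otimes> s)) \<odot>\<^bsub>Hom C B B\<^esub> Ident C B"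
    unfolding p_X_i_X by (simp add: Comp_lin \<epsilon>\<gamma> \<phi>\<gamma> smult_smult m_ac)
  finally show ?thesis .
qed

lemma loc_iso_XB:
  assumes "a \<otimes> (x \<otimes> s \<otimes> s \<otimes> s) \<in> S"
  shows "loc_iso R S C A B"
  by (rule loc_retractI[OF _ _ _ _ assms i_XB_p_XB]) (simp_all add: p_XB_i_XB)

end

section \<open>Direct sums\<close>

text \<open>Exposes the injections and projections that \<open>direct_sum\<close> hides behind an
  existential quantifier, so that they can be fixed and composed.\<close>

definition sum_data ::
  "('o, 'r, 'm) mcat \<Rightarrow> 'o list \<Rightarrow> 'o \<Rightarrow> (nat \<Rightarrow> 'm) \<Rightarrow> (nat \<Rightarrow> 'm) \<Rightarrow> bool"
where
  "sum_data C Xs S \<iota> \<pi> \<longleftrightarrow> set Xs \<subseteq> Obj C \<and> S \<in> Obj C \<and>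
     (\<forall>i<length Xs. \<iota> i \<in> carrier (Hom C (Xs ! i) S) \<and> \<pi> i \<in> carrier (Hom C S (Xs ! i))) \<and>
     (\<forall>i<length Xs. \<forall>j<length Xs. Comp C (Xs ! i) S (Xs ! j) (\<pi> j) (\<iota> i) =
        (if i = j then Ident C (Xs ! i) else \<zero>\<^bsub>Hom C (Xs ! i) (Xs ! j)\<^esub>)) \<and>
     (\<Oplus>\<^bsub>Hom C S S\<^esub>i\<in>{..<length Xs}. Comp C S (Xs ! i) S (\<iota> i) (\<pi> i)) = Ident C S"

lemma direct_sum_iff: "direct_sum C Xs S \<longleftrightarrow> (\<exists>\<iota> \<pi>. sum_data C Xs S \<iota> \<pi>)"
  unfolding direct_sum_def sum_data_def by blast

lemma (in abelian_monoid) finsum_lessThan_Suc: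
  "(\<And>i. i \<le> n \<Longrightarrow> f i \<in> carrier G) \<Longrightarrow> (\<Oplus>i\<in>{..<Suc n}. f i) = f n \<oplus> (\<Oplus>i\<in>{..<n}. f i)"
  unfolding lessThan_Suc by (rule finsum_insert) (auto simp: less_imp_le)

lemma (in abelian_monoid) finsum_one: "f 0 \<in> carrier G \<Longrightarrow> (\<Oplus>i\<in>{..<Suc 0}. f i) = f 0"
  using finsum_lessThan_Suc[of 0 f] by simp

lemma (in abelian_monoid) finsum_two:
  assumes "f 0 \<in> carrier G" "f 1 \<in> carrier G"
  shows "(\<Oplus>i\<in>{..<Suc (Suc 0)}. f i) = f 0 \<oplus> f 1"
proof -
  have "f i \<in> carrier G" if "i \<le> Suc 0" for i
    using that assms by (cases i) auto
  then show ?thesis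
    using finsum_lessThan_Suc[of "Suc 0" f] assms by (simp add: finsum_one a_comm)
qed

lemma (in abelian_monoid) finsum_lessThan_add:
  fixes m n :: nat
  shows "(\<And>i. i < m + n \<Longrightarrow> f i \<in> carrier G) \<Longrightarrow>
    (\<Oplus>i\<in>{..<m + n}. f i) = (\<Oplus>i\<in>{..<m}. f i) \<oplus> (\<Oplus>i\<in>{..<n}. f (m + i))"
proof (induction n)
  case (Suc n)
  have 1: "(\<Oplus>i\<in>{..<m + Suc n}. f i) = f (m + n) \<oplus> (\<Oplus>i\<in>{..<m + n}. f i)"
    using Suc.prems finsum_lessThan_Suc[of "m + n" f] by simp
  have 2: "(\<Oplus>i\<in>{..<Suc n}. f (m + i)) = f (m + n) \<oplus> (\<Oplus>i\<in>{..<n}. f (m + i))"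
    using Suc.prems finsum_lessThan_Suc[of n "\<lambda>i. f (m + i)"] by simp
  have "(\<Oplus>i\<in>{..<m}. f i) \<in> carrier G" "(\<Oplus>i\<in>{..<n}. f (m + i)) \<in> carrier G" "f (m + n) \<in> carrier G"
    using Suc.prems by (auto intro!: finsum_closed)
  then show ?case
    unfolding 1 2 using Suc by (simp add: a_ac)
next
  case 0
  then have "(\<Oplus>i\<in>{..<m}. f i) \<in> carrier G" by (auto intro!: finsum_closed)
  then show ?case by simp
qed

lemma (in abelian_monoid) finsum_delta:
  assumes "k < (n::nat)" "x \<in> carrier G"
  shows "(\<Oplus>i\<in>{..<n}. if k = i then x else \<zero>) = x"
  using finsum_singleton[of k "{..<n}" "\<lambda>_. x"] assms by simp

context r_category
begin

lemma Hom_monoid: "\<lbrakk>A \<in> Obj C; B \<in> Obj C\<rbrakk> \<Longrightarrow> abelian_monoid (Hom C A B)"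
  using Hom_abelian_group by (rule abelian_group.axioms(1))

lemma finsum_closed' [simp]:
  assumes "A \<in> Obj C" "B \<in> Obj C" "\<And>i. i < n \<Longrightarrow> f i \<in> carrier (Hom C A B)"
  shows "(\<Oplus>\<^bsub>Hom C A B\<^esub>i\<in>{..<n::nat}. f i) \<in> carrier (Hom C A B)"
  using assms by (intro abelian_monoid.finsum_closed Hom_monoid) auto

lemma finsum_cong':
  assumes "A \<in> Obj C" "B \<in> Obj C" "\<And>i. i < n \<Longrightarrow> g i \<in> carrier (Hom C A B)" "\<And>i. i < n \<Longrightarrow> f i = g i"
  shows "(\<Oplus>\<^bsub>Hom C A B\<^esub>i\<in>{..<n::nat}. f i) = (\<Oplus>\<^bsub>Hom C A B\<^esub>i\<in>{..<n}. g i)"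
  using assms by (intro abelian_monoid.finsum_cong' Hom_monoid) auto

lemma finsum_additive:
  assumes "A \<in> Obj C" "B \<in> Obj C" "A' \<in> Obj C" "B' \<in> Obj C"
    and f: "\<And>i. i < n \<Longrightarrow> f i \<in> carrier (Hom C A B)"
    and h: "\<And>f. f \<in> carrier (Hom C A B) \<Longrightarrow> h f \<in> carrier (Hom C A' B')"
    and add: "\<And>f g. f \<in> carrier (Hom C A B) \<Longrightarrow> g \<in> carrier (Hom C A B) \<Longrightarrow>
        h (f \<oplus>\<^bsub>Hom C A B\<^esub> g) = h f \<oplus>\<^bsub>Hom C A' B'\<^esub> h g"
    and zero: "h \<zero>\<^bsub>Hom C A B\<^esub> = \<zero>\<^bsub>Hom C A' B'\<^esub>"
  shows "h (\<Oplus>\<^bsub>Hom C A B\<^esub>i\<in>{..<n::nat}. f i) = (\<Oplus>\<^bsub>Hom C A' B'\<^esub>i\<in>{..<n}. h (f i))"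
  using f
proof (induction n)
  case 0
  show ?case using assms(1-4) zero by (simp add: abelian_monoid.finsum_empty Hom_monoid)
next
  case (Suc n)
  then show ?case
    using assms(1-4) by (simp add: abelian_monoid.finsum_lessThan_Suc[OF Hom_monoid] add h)
qed

lemma Comp_finsum_right:
  assumes "A \<in> Obj C" "B \<in> Obj C" "D \<in> Obj C" "g \<in> carrier (Hom C B D)" "\<And>i. i < n \<Longrightarrow> f i \<in> carrier (Hom C A B)"
  shows "Comp C A B D g (\<Oplus>\<^bsub>Hom C A B\<^esub>i\<in>{..<n::nat}. f i) = (\<Oplus>\<^bsub>Hom C A D\<^esub>i\<in>{..<n}. Comp C A B D g (f i))"
  using assms by (intro finsum_additive) (auto simp: Comp_lin)

lemma Comp_finsum_left:
  assumes "A \<in> Obj C" "B \<in> Obj C" "D \<in> Obj C" "f \<in> carrier (Hom C A B)" "\<And>i. i < n \<Longrightarrow> g i \<in> carrier (Hom C B D)"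
  shows "Comp C A B D (\<Oplus>\<^bsub>Hom C B D\<^esub>i\<in>{..<n::nat}. g i) f = (\<Oplus>\<^bsub>Hom C A D\<^esub>i\<in>{..<n}. Comp C A B D (g i) f)"
  using assms by (intro finsum_additive[where h = "\<lambda>g. Comp C A B D g f"]) (auto simp: Comp_lin)

lemma sum_dataD:
  assumes "sum_data C Xs S \<iota> \<pi>"
  shows "set Xs \<subseteq> Obj C" "S \<in> Obj C"
    and "\<And>i. i < length Xs \<Longrightarrow> \<iota> i \<in> carrier (Hom C (Xs ! i) S)"
    and "\<And>i. i < length Xs \<Longrightarrow> \<pi> i \<in> carrier (Hom C S (Xs ! i))"
    and "\<And>i. i < length Xs \<Longrightarrow> Xs ! i \<in> Obj C"
    and "\<And>i j. i < length Xs \<Longrightarrow> j < length Xs \<Longrightarrow> Comp C (Xs ! i) S (Xs ! j) (\<pi> j) (\<iota> i) =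
        (if i = j then Ident C (Xs ! i) else \<zero>\<^bsub>Hom C (Xs ! i) (Xs ! j)\<^esub>)"
    and "(\<Oplus>\<^bsub>Hom C S S\<^esub>i\<in>{..<length Xs}. Comp C S (Xs ! i) S (\<iota> i) (\<pi> i)) = Ident C S"
proof -
  show "Xs ! i \<in> Obj C" if "i < length Xs" for i
    using assms nth_mem[OF that] by (auto simp: sum_data_def)
qed (use assms in \<open>simp_all add: sum_data_def\<close>)

lemma sum_data_single:
  "A \<in> Obj C \<Longrightarrow> sum_data C [A] A (\<lambda>_. Ident C A) (\<lambda>_. Ident C A)"
  by (simp add: sum_data_def abelian_monoid.finsum_one[OF Hom_monoid])

lemma direct_sum_single: "A \<in> Obj C \<Longrightarrow> direct_sum C [A] A"
  unfolding direct_sum_iff using sum_data_single by blast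

lemma biproduct_if_direct_sum:
  assumes "direct_sum C [X, B] Y"
  shows "\<exists>\<iota>\<^sub>1 \<pi>\<^sub>1 \<iota>\<^sub>2 \<pi>\<^sub>2. biproduct R C X B Y \<iota>\<^sub>1 \<pi>\<^sub>1 \<iota>\<^sub>2 \<pi>\<^sub>2"
proof -
  obtain \<iota> \<pi> where d: "sum_data C [X, B] Y \<iota> \<pi>" using assms by (auto simp: direct_sum_iff)
  note D = sum_dataD[OF d]
  have ob: "X \<in> Obj C" "B \<in> Obj C" "Y \<in> Obj C" using D(1,2) by auto
  have m: "\<iota> 0 \<in> carrier (Hom C X Y)" "\<iota> 1 \<in> carrier (Hom C B Y)"
      "\<pi> 0 \<in> carrier (Hom C Y X)" "\<pi> 1 \<in> carrier (Hom C Y B)"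
    using D(3)[of 0] D(3)[of 1] D(4)[of 0] D(4)[of 1] by auto
  have "biproduct R C X B Y (\<iota> 0) (\<pi> 0) (\<iota> 1) (\<pi> 1)"
  proof unfold_locales
    show "Comp C Y X Y (\<iota> 0) (\<pi> 0) \<oplus>\<^bsub>Hom C Y Y\<^esub> Comp C Y B Y (\<iota> 1) (\<pi> 1) = Ident C Y"
    proof -
      have "(\<Oplus>\<^bsub>Hom C Y Y\<^esub>i\<in>{..<Suc (Suc 0)}. Comp C Y ([X, B] ! i) Y (\<iota> i) (\<pi> i)) = Ident C Y"
        using D(7) by simp
      then show ?thesis
        using m ob by (subst (asm) abelian_monoid.finsum_two[OF Hom_monoid]) simp_all
    qed
  qed (use ob m D(6)[of 0 0] D(6)[of 1 1] D(6)[of 0 1] D(6)[of 1 0] in simp_all)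
  then show ?thesis by blast
qed

lemma (in biproduct) direct_sum: "direct_sum C [X, B] Y"
proof -
  let ?\<iota> = "\<lambda>i::nat. if i = 0 then \<iota>\<^sub>1 else \<iota>\<^sub>2" and ?\<pi> = "\<lambda>i::nat. if i = 0 then \<pi>\<^sub>1 else \<pi>\<^sub>2"
  have "sum_data C [X, B] Y ?\<iota> ?\<pi>"
    by (auto simp: sum_data_def less_Suc_eq abelian_monoid.finsum_two[OF Hom_monoid] inj_proj)
  then show ?thesis unfolding direct_sum_iff by blast
qed

end

context r_category
begin

lemma isomorphic_refl: "A \<in> Obj C \<Longrightarrow> isomorphic C A A"
  unfolding isomorphic_def by (auto intro!: bexI[of _ "Ident C A"])

lemma direct_sum_append:
  assumes "direct_sum C [U, V] S" "direct_sum C Xs U" "direct_sum C Ys V"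
  shows "direct_sum C (Xs @ Ys) S"
proof -
  obtain \<iota>\<^sub>1 \<pi>\<^sub>1 \<iota>\<^sub>2 \<pi>\<^sub>2 where "biproduct R C U V S \<iota>\<^sub>1 \<pi>\<^sub>1 \<iota>\<^sub>2 \<pi>\<^sub>2"
    using biproduct_if_direct_sum[OF assms(1)] by blast
  then interpret b: biproduct R C U V S \<iota>\<^sub>1 \<pi>\<^sub>1 \<iota>\<^sub>2 \<pi>\<^sub>2 .
  obtain \<iota> \<pi> \<kappa> \<rho> where X: "sum_data C Xs U \<iota> \<pi>" and Y: "sum_data C Ys V \<kappa> \<rho>"
    using assms by (auto simp: direct_sum_iff)
  note X = sum_dataD[OF X] and Y = sum_dataD[OF Y]
  let ?m = "length Xs" and ?n = "length Ys"
  define inj where "inj k = (if k < ?m then Comp C (Xs ! k) U S \<iota>\<^sub>1 (\<iota> k)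
      else Comp C (Ys ! (k - ?m)) V S \<iota>\<^sub>2 (\<kappa> (k - ?m)))" for k
  define proj where "proj k = (if k < ?m then Comp C S U (Xs ! k) (\<pi> k) \<pi>\<^sub>1
      else Comp C S V (Ys ! (k - ?m)) (\<rho> (k - ?m)) \<pi>\<^sub>2)" for k
  have cl: "inj k \<in> carrier (Hom C ((Xs @ Ys) ! k) S)" "proj k \<in> carrier (Hom C S ((Xs @ Ys) ! k))"
      "(Xs @ Ys) ! k \<in> Obj C" if "k < length (Xs @ Ys)" for k
    using that X(3,4,5)[of k] Y(3,4,5)[of "k - ?m"] by (auto simp: inj_def proj_def nth_append)
  have orth: "Comp C ((Xs @ Ys) ! i) S ((Xs @ Ys) ! j) (proj j) (inj i) =
      (if i = j then Ident C ((Xs @ Ys) ! i) else \<zero>\<^bsub>Hom C ((Xs @ Ys) ! i) ((Xs @ Ys) ! j)\<^esub>)"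
    if ij: "i < length (Xs @ Ys)" "j < length (Xs @ Ys)" for i j
  proof (cases "i < ?m")
    case i: True
    show ?thesis
    proof (cases "j < ?m")
      case True
      then show ?thesis
        using i X(3,5)[of i] X(4,5)[of j] X(6)[of i j]
        by (simp add: inj_def proj_def nth_append Comp_assoc[symmetric])
    next
      case False
      then show ?thesis
        using ij i X(3,5)[of i] Y(4,5)[of "j - ?m"]
        by (auto simp: inj_def proj_def nth_append Comp_assoc[symmetric])
    qed
  next
    case i: False
    then have i': "i - ?m < ?n" using ij by auto
    show ?thesis
    proof (cases "j < ?m")
      case True
      then show ?thesis
        using i i' Y(3,5)[of "i - ?m"] X(4,5)[of j]
        by (auto simp: inj_def proj_def nth_append Comp_assoc[symmetric])
    next
      case False
      then have j': "j - ?m < ?n" using ij by auto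
      show ?thesis
        using False i i' j' Y(3,5)[of "i - ?m"] Y(4,5)[of "j - ?m"] Y(6)[of "i - ?m" "j - ?m"]
        by (auto simp: inj_def proj_def nth_append Comp_assoc[symmetric])
    qed
  qed
  let ?f = "\<lambda>k. Comp C S ((Xs @ Ys) ! k) S (inj k) (proj k)"
  have "(\<Oplus>\<^bsub>Hom C S S\<^esub>i\<in>{..<length (Xs @ Ys)}. ?f i)
      = (\<Oplus>\<^bsub>Hom C S S\<^esub>i\<in>{..<?m}. ?f i) \<oplus>\<^bsub>Hom C S S\<^esub> (\<Oplus>\<^bsub>Hom C S S\<^esub>i\<in>{..<?n}. ?f (?m + i))"
    using cl by (simp add: abelian_monoid.finsum_lessThan_add[OF Hom_monoid])
  also have "(\<Oplus>\<^bsub>Hom C S S\<^esub>i\<in>{..<?m}. ?f i)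
      = (\<Oplus>\<^bsub>Hom C S S\<^esub>i\<in>{..<?m}. Comp C S U S \<iota>\<^sub>1 (Comp C S U U (Comp C U (Xs ! i) U (\<iota> i) (\<pi> i)) \<pi>\<^sub>1))"
    using X(3,4,5) by (intro finsum_cong') (simp_all add: inj_def proj_def nth_append Comp_assoc)
  also have "\<dots> = Comp C S U S \<iota>\<^sub>1 (Comp C S U U (Ident C U) \<pi>\<^sub>1)"
    unfolding X(7)[symmetric] using X(3,4,5) by (simp add: Comp_finsum_right Comp_finsum_left)
  also have "(\<Oplus>\<^bsub>Hom C S S\<^esub>i\<in>{..<?n}. ?f (?m + i))
      = (\<Oplus>\<^bsub>Hom C S S\<^esub>i\<in>{..<?n}. Comp C S V S \<iota>\<^sub>2 (Comp C S V V (Comp C V (Ys ! i) V (\<kappa> i) (\<rho> i)) \<pi>\<^sub>2))"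
    using Y(3,4,5) by (intro finsum_cong') (simp_all add: inj_def proj_def nth_append Comp_assoc)
  also have "\<dots> = Comp C S V S \<iota>\<^sub>2 (Comp C S V V (Ident C V) \<pi>\<^sub>2)"
    unfolding Y(7)[symmetric] using Y(3,4,5) by (simp add: Comp_finsum_right Comp_finsum_left)
  finally have "(\<Oplus>\<^bsub>Hom C S S\<^esub>i\<in>{..<length (Xs @ Ys)}. ?f i) = Ident C S"
    by (simp add: b.inj_proj)
  then have "sum_data C (Xs @ Ys) S inj proj"
    unfolding sum_data_def using cl orth X(1) Y(1) by auto
  then show ?thesis unfolding direct_sum_iff by blast
qed

lemma direct_sum_Cons:
  "\<lbrakk>direct_sum C [X, V] S; direct_sum C Ys V; X \<in> Obj C\<rbrakk> \<Longrightarrow> direct_sum C (X # Ys) S"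
  using direct_sum_append[of X V S "[X]" Ys] direct_sum_single by simp

text \<open>The canonical map \<open>f\<close> satisfies \<pi>' i f = \<pi> i, so g f collapses to
  the sum of all \<iota> i \<pi> i. With the two sums exchanged this gives the other half of an
  isomorphism.\<close>

lemma sum_comparison:
  assumes "sum_data C Xs S \<iota> \<pi>" "sum_data C Xs S' \<iota>' \<pi>'"
  defines "f \<equiv> (\<Oplus>\<^bsub>Hom C S S'\<^esub>i\<in>{..<length Xs}. Comp C S (Xs ! i) S' (\<iota>' i) (\<pi> i))"
    and "g \<equiv> (\<Oplus>\<^bsub>Hom C S' S\<^esub>i\<in>{..<length Xs}. Comp C S' (Xs ! i) S (\<iota> i) (\<pi>' i))"
  shows "Comp C S S' S g f = Ident C S"
proof -
  note X = sum_dataD[OF assms(1)] and X' = sum_dataD[OF assms(2)]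
  have f: "f \<in> carrier (Hom C S S')"
    unfolding f_def using X(2-5) X'(2-5) by simp
  have \<pi>f: "Comp C S S' (Xs ! i) (\<pi>' i) f = \<pi> i" if i: "i < length Xs" for i
  proof -
    have "Comp C S S' (Xs ! i) (\<pi>' i) f
        = (\<Oplus>\<^bsub>Hom C S (Xs ! i)\<^esub>j\<in>{..<length Xs}. Comp C S S' (Xs ! i) (\<pi>' i) (Comp C S (Xs ! j) S' (\<iota>' j) (\<pi> j)))"
      unfolding f_def using i X(2-5) X'(2-5) by (simp add: Comp_finsum_right)
    also have "\<dots> = (\<Oplus>\<^bsub>Hom C S (Xs ! i)\<^esub>j\<in>{..<length Xs}. if i = j then \<pi> i else \<zero>\<^bsub>Hom C S (Xs ! i)\<^esub>)"
      using i X(2-5) X'(2-6) by (intro finsum_cong') (auto simp: Comp_assoc)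
    also have "\<dots> = \<pi> i"
      using i X(2,4,5) by (intro abelian_monoid.finsum_delta[OF Hom_monoid]) auto
    finally show ?thesis .
  qed
  have "Comp C S S' S g f = (\<Oplus>\<^bsub>Hom C S S\<^esub>i\<in>{..<length Xs}. Comp C S S' S (Comp C S' (Xs ! i) S (\<iota> i) (\<pi>' i)) f)"
    unfolding g_def using f X(2-5) X'(2-5) by (simp add: Comp_finsum_left)
  also have "\<dots> = (\<Oplus>\<^bsub>Hom C S S\<^esub>i\<in>{..<length Xs}. Comp C S (Xs ! i) S (\<iota> i) (\<pi> i))"
    using f X(2-5) X'(2-5) \<pi>f by (intro finsum_cong') (auto simp: Comp_assoc[symmetric])
  finally show ?thesis unfolding X(7) .
qed

lemma direct_sum_unique:
  assumes "direct_sum C Xs S" "direct_sum C Xs S'"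
  shows "isomorphic C S S'"
proof -
  obtain \<iota> \<pi> \<iota>' \<pi>' where d: "sum_data C Xs S \<iota> \<pi>" "sum_data C Xs S' \<iota>' \<pi>'"
    using assms by (auto simp: direct_sum_iff)
  note X = sum_dataD[OF d(1)] and X' = sum_dataD[OF d(2)]
  show ?thesis
    unfolding isomorphic_def using X(2) X'(2) sum_comparison[OF d] sum_comparison[OF d(2,1)]
    by (auto intro!: bexI finsum_closed' Comp_closed X(2-5) X'(2-5))
qed

lemma direct_sum_transport:
  assumes "direct_sum C Xs S" "isomorphic C S S'"
  shows "direct_sum C Xs S'"
proof -
  obtain \<iota> \<pi> where d: "sum_data C Xs S \<iota> \<pi>" using assms by (auto simp: direct_sum_iff)
  note X = sum_dataD[OF d]
  obtain f g where fg: "S' \<in> Obj C" "f \<in> carrier (Hom C S S')" "g \<in> carrier (Hom C S' S)"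
      "Comp C S S' S g f = Ident C S" "Comp C S' S S' f g = Ident C S'"
    using assms(2) by (auto simp: isomorphic_def)
  let ?\<iota> = "\<lambda>i. Comp C (Xs ! i) S S' f (\<iota> i)" and ?\<pi> = "\<lambda>i. Comp C S' S (Xs ! i) (\<pi> i) g"
  have "Comp C (Xs ! i) S' (Xs ! j) (?\<pi> j) (?\<iota> i) = Comp C (Xs ! i) S (Xs ! j) (\<pi> j) (\<iota> i)"
    if "i < length Xs" "j < length Xs" for i j
  proof -
    have "Comp C (Xs ! i) S' (Xs ! j) (?\<pi> j) (?\<iota> i) = Comp C (Xs ! i) S (Xs ! j) (\<pi> j) (Comp C (Xs ! i) S S (Comp C S S' S g f) (\<iota> i))"
      using that fg(1-3) X(2-5) by (simp add: Comp_assoc)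
    then show ?thesis using that fg(1-4) X(2-5) by simp
  qed
  moreover have "(\<Oplus>\<^bsub>Hom C S' S'\<^esub>i\<in>{..<length Xs}. Comp C S' (Xs ! i) S' (?\<iota> i) (?\<pi> i)) = Ident C S'"
  proof -
    have "(\<Oplus>\<^bsub>Hom C S' S'\<^esub>i\<in>{..<length Xs}. Comp C S' (Xs ! i) S' (?\<iota> i) (?\<pi> i))
        = (\<Oplus>\<^bsub>Hom C S' S'\<^esub>i\<in>{..<length Xs}. Comp C S' S S' f (Comp C S' S S (Comp C S (Xs ! i) S (\<iota> i) (\<pi> i)) g))"
      using fg(1-3) X(2-5) by (intro finsum_cong') (simp_all add: Comp_assoc)
    also have "\<dots> = Comp C S' S S' f (Comp C S' S S (Ident C S) g)"
      unfolding X(7)[symmetric] using fg(1-3) X(2-5) by (simp add: Comp_finsum_right Comp_finsum_left)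
    finally show ?thesis using fg X(2) by simp
  qed
  ultimately have "sum_data C Xs S' ?\<iota> ?\<pi>"
    unfolding sum_data_def using fg(1-3) X(1-6) by auto
  then show ?thesis unfolding direct_sum_iff by blast
qed

lemma additiveE:
  assumes "fully_additive C" "set Xs \<subseteq> Obj C"
  obtains S where "direct_sum C Xs S" "S \<in> Obj C"
  using assms unfolding fully_additive_def additive_def direct_sum_def by blast

lemma splitE:
  assumes "fully_additive C" "Y \<in> Obj C" "e \<in> carrier (Hom C Y Y)" "Comp C Y Y Y e e = e"
  obtains A r j where "A \<in> Obj C" "r \<in> carrier (Hom C Y A)" "j \<in> carrier (Hom C A Y)"
    "Comp C Y A Y j r = e" "Comp C A Y A r j = Ident C A"
  using assms unfolding fully_additive_def idempotents_split_def by blast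

text \<open>The mixed composites vanish automatically: inserting 1 = j r + j' r' into r j' yields r
  j' = r j' + r j', and likewise for r' j.\<close>

lemma split_complement_biproduct:
  assumes ob: "Y \<in> Obj C" "A \<in> Obj C" "B \<in> Obj C"
    and m: "r \<in> carrier (Hom C Y A)" "j \<in> carrier (Hom C A Y)" "r' \<in> carrier (Hom C Y B)" "j' \<in> carrier (Hom C B Y)"
    and eq: "Comp C A Y A r j = Ident C A" "Comp C B Y B r' j' = Ident C B"
    and sum: "Comp C Y A Y j r \<oplus>\<^bsub>Hom C Y Y\<^esub> Comp C Y B Y j' r' = Ident C Y"
  shows "biproduct R C A B Y j r j' r'"
proof -
  have cancel: "Comp C V Y U u v = \<zero>\<^bsub>Hom C V U\<^esub>"
    if uv: "U \<in> Obj C" "V \<in> Obj C" "u \<in> carrier (Hom C Y U)" "v \<in> carrier (Hom C V Y)"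
      "u' \<in> carrier (Hom C U Y)" "v' \<in> carrier (Hom C Y V)"
      "Comp C U Y U u u' = Ident C U" "Comp C V Y V v' v = Ident C V"
      "Comp C Y U Y u' u \<oplus>\<^bsub>Hom C Y Y\<^esub> Comp C Y V Y v v' = Ident C Y" for U V u v u' v'
  proof -
    have "Comp C V Y U u v = Comp C V Y U u (Comp C V Y Y (Comp C Y U Y u' u \<oplus>\<^bsub>Hom C Y Y\<^esub> Comp C Y V Y v v') v)"
      unfolding uv(9) using uv(1-4) ob by simp
    also have "\<dots> = Comp C V U U (Comp C U Y U u u') (Comp C V Y U u v) \<oplus>\<^bsub>Hom C V U\<^esub> Comp C V V U (Comp C V Y U u v) (Comp C V Y V v' v)"
      using uv(1-6) ob by (simp add: Comp_lin Comp_assoc)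
    also have "\<dots> = Comp C V Y U u v \<oplus>\<^bsub>Hom C V U\<^esub> Comp C V Y U u v"
      unfolding uv(7,8) using uv(1-4) ob by simp
    finally show ?thesis
      using add_right_cancel'[of V U "Comp C V Y U u v" "\<zero>\<^bsub>Hom C V U\<^esub>" "Comp C V Y U u v"] uv(1-4) ob by simp
  qed
  show ?thesis
  proof unfold_locales
    show "Comp C B Y A r j' = \<zero>\<^bsub>Hom C B A\<^esub>"
      using cancel[OF ob(2,3) m(1,4,2,3) eq(1,2) sum] .
    have "Comp C Y B Y j' r' \<oplus>\<^bsub>Hom C Y Y\<^esub> Comp C Y A Y j r = Ident C Y"
      using sum ob m by (simp add: add_comm')
    then show "Comp C A Y B r' j = \<zero>\<^bsub>Hom C A B\<^esub>"
      using cancel[OF ob(3,2) m(3,2,4,1) eq(2,1)] by simp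
  qed (use ob m eq sum in simp_all)
qed

end

section \<open>Gluing one localisation\<close>

context dedekind_category
begin

lemma compl_max_subset: "\<qq> \<in> max_spec R \<Longrightarrow> carrier R - \<qq> \<subseteq> nonzeros R"
  using additive_subgroup.zero_closed[OF ideal.axioms(1)[OF max_specD(1)]] by auto

lemma loc_iso_at_trans:
  assumes "\<qq> \<in> max_spec R" "loc_iso R (carrier R - \<qq>) C A B" "loc_iso R (carrier R - \<qq>) C B D"
  shows "loc_iso R (carrier R - \<qq>) C A D"
  by (rule loc_iso_trans[OF assms(2,3)]) (use max_spec_mult_notin[OF assms(1)] in auto)

lemma loc_iso_at_sym: "loc_iso R (carrier R - \<qq>) C A B \<Longrightarrow> loc_iso R (carrier R - \<qq>) C B A"
  by (rule loc_iso_sym) auto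

lemma loc_iso_at_refl: "\<lbrakk>\<qq> \<in> max_spec R; A \<in> Obj C\<rbrakk> \<Longrightarrow> loc_iso R (carrier R - \<qq>) C A A"
  by (rule loc_iso_refl) (auto dest: max_specD(3))

lemma one_minus_notin:
  assumes "\<qq> \<in> max_spec R" "w \<in> carrier R" "y \<in> carrier R" "w \<oplus> y = \<one>" "w \<in> \<qq>"
  shows "y \<notin> \<qq>"
proof
  assume "y \<in> \<qq>"
  then have "w \<oplus> y \<in> \<qq>"
    using assms(5) by (intro additive_subgroup.a_closed[OF ideal.axioms(1)[OF max_specD(1)[OF assms(1)]]])
  then show False using assms(4) max_specD(3)[OF assms(1)] by simp
qed

lemma mult_notinD:
  assumes "\<qq> \<in> max_spec R" "x \<in> carrier R" "s \<in> carrier R" "x \<otimes> s \<notin> \<qq>"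
  shows "x \<notin> \<qq>" "s \<notin> \<qq>"
  using assms ideal.I_l_closed[OF max_specD(1)[OF assms(1)], of s x]
    ideal.I_r_closed[OF max_specD(1)[OF assms(1)], of x s] by auto

text \<open>Each scalar in \<open>K\<close> kills the alternating products from some length on. As
  \<open>K\<close> is finite there is a length at which all of them do, and since no maximal ideal
  contains \<open>K\<close>, the product of that length is zero.\<close>

lemma torsion_reducedI:
  assumes A: "A \<in> Obj C"
    and data: "\<And>t (b :: nat \<Rightarrow> 'm). t \<in> tors R C A A \<Longrightarrow> (\<And>n. b n \<in> carrier (Hom C A A)) \<Longrightarrow>
      \<exists>K. finite K \<and> K \<subseteq> carrier R \<and> (\<forall>\<qq>\<in>max_spec R. \<not> K \<subseteq> \<qq>) \<and>
        (\<forall>c\<in>K. \<exists>n. c \<odot>\<^bsub>Hom C A A\<^esub> alt_prod C A A t b n = \<zero>\<^bsub>Hom C A A\<^esub>)"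
  shows "torsion_reduced R C A"
proof -
  have "t \<in> nilrad C A A" if t: "t \<in> tors R C A A" for t
  proof -
    have tc: "t \<in> carrier (Hom C A A)" using t by (simp add: tors_def)
    have "\<exists>n. alt_prod C A A t b n = \<zero>\<^bsub>Hom C A A\<^esub>" if b: "b \<in> UNIV \<rightarrow> carrier (Hom C A A)" for b
    proof -
      have b': "b n \<in> carrier (Hom C A A)" for n using b by auto
      obtain K where K: "finite K" "K \<subseteq> carrier R" "\<forall>\<qq>\<in>max_spec R. \<not> K \<subseteq> \<qq>"
        "\<forall>c\<in>K. \<exists>n. c \<odot>\<^bsub>Hom C A A\<^esub> alt_prod C A A t b n = \<zero>\<^bsub>Hom C A A\<^esub>"
        using data[of t b, OF t b'] by blast
      obtain m where m: "\<And>c. c \<in> K \<Longrightarrow> c \<odot>\<^bsub>Hom C A A\<^esub> alt_prod C A A t b (m c) = \<zero>\<^bsub>Hom C A A\<^esub>"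
        using K(4) by metis
      define N where "N = Max (insert 0 (m ` K))"
      have kill: "c \<odot>\<^bsub>Hom C A A\<^esub> alt_prod C A A t b N = \<zero>\<^bsub>Hom C A A\<^esub>" if c: "c \<in> K" for c
      proof (rule alt_prod_killed_mono[OF A tc b' _ m[OF c]])
        show "c \<in> carrier R" using c K by auto
        show "m c \<le> N" unfolding N_def using K(1) c by (intro Max_ge) auto
      qed
      have "alt_prod C A A t b N = \<zero>\<^bsub>Hom C A A\<^esub>"
      proof (rule zero_if_locally_killed[OF A A])
        show "alt_prod C A A t b N \<in> carrier (Hom C A A)" using A tc b' by simp
      next
        fix \<qq> assume "\<qq> \<in> max_spec R"
        then obtain c where "c \<in> K" "c \<notin> \<qq>" using K(3) by blast
        then show "\<exists>r\<in>carrier R - \<qq>. r \<odot>\<^bsub>Hom C A A\<^esub> alt_prod C A A t b N = \<zero>\<^bsub>Hom C A A\<^esub>"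
          using kill K(2) by blast
      qed
      then show ?thesis ..
    qed
    then show ?thesis using tc by (simp add: nilrad_def)
  qed
  then show ?thesis using A by (auto simp: torsion_reduced_def)
qed

text \<open>\<open>loc_nil_transfer\<close> with S = {1}: torsion of \<open>B\<close> is essentially
  nilpotent in the category itself, so only powers of the scalar c are left over.\<close>

lemma retract_kills:
  assumes "A \<in> Obj C" "torsion_reduced R C B" "p \<in> carrier (Hom C A B)" "i \<in> carrier (Hom C B A)" "c \<in> carrier R"
    "Comp C A B A i p = c \<odot>\<^bsub>Hom C A A\<^esub> Ident C A" "t \<in> tors R C A A" "\<And>n. b n \<in> carrier (Hom C A A)"
  shows "\<exists>n. \<exists>k::nat. c [^] k \<odot>\<^bsub>Hom C A A\<^esub> alt_prod C A A t b n = \<zero>\<^bsub>Hom C A A\<^esub>"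
proof -
  have B: "B \<in> Obj C" using assms(2) by (simp add: torsion_reduced_def)
  have t: "t \<in> carrier (Hom C A A)" using assms(7) by (simp add: tors_def)
  have "loc_nil {\<one>} B (Comp C B A B p (Comp C B A A t i))"
    by (rule torsion_reduced_loc_nil[OF assms(2) tors_conj[OF assms(1) B assms(3,4,7)]])
  from loc_nil_transfer[where b = b, OF assms(1) B assms(3,4) t assms(5) _ assms(6) this assms(8)]
  show ?thesis using assms(5) by auto
qed

text \<open>\<open>ret\<close> provides a, \<phi> and \<gamma> for the idempotent \<open>E\<close>,
  and \<open>glue_scalars\<close> provides x, w and z. The condition \<open>nil\<close> is torsion
  reducedness of the image of \<epsilon>/s over the localisation at \<pp>, translated into the
  category; it handles torsion at \<pp>, where the new object is modelled on \<epsilon>/s instead of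
  \<open>B\<close>.\<close>

lemma glue_at:
  assumes fa: "fully_additive C" and p: "\<pp> \<in> max_spec R" and B: "torsion_reduced R C B" and X: "X \<in> Obj C"
    and \<epsilon>: "\<epsilon> \<in> carrier (Hom C X X)" "Comp C X X X \<epsilon> \<epsilon> = s \<odot>\<^bsub>Hom C X X\<^esub> \<epsilon>"
    and s: "s \<in> carrier R" "s \<notin> \<pp>"
    and ret: "loc_retract R (nonzeros R) C B X \<epsilon> s"
    and nil: "\<And>\<tau>. \<tau> \<in> tors R C X X \<Longrightarrow> Comp C X X X \<epsilon> \<tau> = s \<odot>\<^bsub>Hom C X X\<^esub> \<tau> \<Longrightarrow>
       Comp C X X X \<tau> \<epsilon> = s \<odot>\<^bsub>Hom C X X\<^esub> \<tau> \<Longrightarrow> loc_nil (carrier R - \<pp>) X \<tau>"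
  shows "\<exists>A. torsion_reduced R C A \<and> loc_retract R (carrier R - \<pp>) C A X \<epsilon> s \<and>
    loc_iso R (nonzeros R) C A B \<and> (\<forall>\<qq>\<in>max_spec R. \<qq> \<noteq> \<pp> \<longrightarrow> loc_iso R (carrier R - \<qq>) C A B)"
proof -
  obtain \<gamma> \<phi> a where d: "B \<in> Obj C" "\<gamma> \<in> carrier (Hom C B X)" "\<phi> \<in> carrier (Hom C X B)" "a \<in> nonzeros R"
      "Comp C B X B \<phi> \<gamma> = a \<odot>\<^bsub>Hom C B B\<^esub> Ident C B"
      "s \<odot>\<^bsub>Hom C X X\<^esub> Comp C X B X \<gamma> \<phi> = a \<odot>\<^bsub>Hom C X X\<^esub> \<epsilon>"
      "Comp C B X X \<epsilon> \<gamma> = s \<odot>\<^bsub>Hom C B X\<^esub> \<gamma>" "Comp C X X B \<phi> \<epsilon> = s \<odot>\<^bsub>Hom C X B\<^esub> \<phi>"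
    using ret unfolding loc_retract_def by blast
  obtain x w z where xwz: "x \<in> carrier R" "x \<notin> \<pp>" "w \<in> carrier R" "z \<in> carrier R" "w \<oplus> x \<otimes> s = \<one>" "x \<otimes> w = a \<otimes> z"
    and x: "\<And>\<qq>. \<qq> \<in> max_spec R \<Longrightarrow> \<qq> \<noteq> \<pp> \<Longrightarrow> a \<in> \<qq> \<Longrightarrow> x \<in> \<qq>"
    using glue_scalars[OF p s, of a] d(4) by auto
  have aR: "a \<in> carrier R" using d by auto
  obtain Y where Y: "direct_sum C [X, B] Y" "Y \<in> Obj C"
    using additiveE[OF fa, of "[X, B]"] X d(1) by auto
  obtain \<iota>\<^sub>1 \<pi>\<^sub>1 \<iota>\<^sub>2 \<pi>\<^sub>2 where bip: "biproduct R C X B Y \<iota>\<^sub>1 \<pi>\<^sub>1 \<iota>\<^sub>2 \<pi>\<^sub>2"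
    using biproduct_if_direct_sum[OF Y(1)] by blast
  interpret biproduct R C X B Y \<iota>\<^sub>1 \<pi>\<^sub>1 \<iota>\<^sub>2 \<pi>\<^sub>2 by (rule bip)
  interpret g: glue R C X B Y \<iota>\<^sub>1 \<pi>\<^sub>1 \<iota>\<^sub>2 \<pi>\<^sub>2 \<epsilon> \<phi> \<gamma> s a x w z
    by unfold_locales (use \<epsilon> s d xwz in auto)
  obtain A r j where "A \<in> Obj C" "r \<in> carrier (Hom C Y A)" "j \<in> carrier (Hom C A Y)"
    "Comp C Y A Y j r = g.E" "Comp C A Y A r j = Ident C A"
    using splitE[OF fa Y(2) g.E_closed g.E_idem] by blast
  then interpret h: glue_split R C X B Y \<iota>\<^sub>1 \<pi>\<^sub>1 \<iota>\<^sub>2 \<pi>\<^sub>2 \<epsilon> \<phi> \<gamma> s a x w z A r j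
    by unfold_locales
  \<comment> \<open>If w is in \<qq>, then x and s are not. Were a in \<qq> as well, then for \<qq>
    different from \<pp> the choice of x would put x into \<qq>.\<close>
  have cases: "w \<notin> \<qq> \<or> a \<otimes> (x \<otimes> s \<otimes> s \<otimes> s) \<notin> \<qq> \<or> \<qq> = \<pp>" if q: "\<qq> \<in> max_spec R" for \<qq>
  proof (rule ccontr)
    assume neg: "\<not> ?thesis"
    then have "x \<otimes> s \<notin> \<qq>" using one_minus_notin[OF q xwz(3) _ xwz(5)] xwz s by auto
    then have xs: "x \<notin> \<qq>" "s \<notin> \<qq>" using mult_notinD[OF q xwz(1) s(1)] by auto
    have "a \<in> \<qq>"
    proof (rule ccontr)
      assume "a \<notin> \<qq>"
      then have "a \<otimes> (x \<otimes> s \<otimes> s \<otimes> s) \<notin> \<qq>"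
        using xs aR xwz s by (intro max_spec_mult_notin[OF q]) auto
      then show False using neg by auto
    qed
    then show False using x[OF q] neg xs by auto
  qed
  \<comment> \<open>Three comparisons each give a killing scalar: with \<open>B\<close> directly a
    power of w, with \<open>B\<close> through \<open>X\<close> a power of a x s s s, and with
    \<open>X\<close> itself a scalar outside \<pp>. By \<open>cases\<close> no maximal ideal
    contains all three.\<close>
  have "torsion_reduced R C A"
  proof (rule torsion_reducedI[OF h.split_Obj])
    fix t and b :: "nat \<Rightarrow> 'm" assume t: "t \<in> tors R C A A" and b: "\<And>n. b n \<in> carrier (Hom C A A)"
    have tc: "t \<in> carrier (Hom C A A)" using t by (simp add: tors_def)
    obtain n\<^sub>1 k\<^sub>1 where 1: "w [^] (k\<^sub>1::nat) \<odot>\<^bsub>Hom C A A\<^esub> alt_prod C A A t b n\<^sub>1 = \<zero>\<^bsub>Hom C A A\<^esub>"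
      using retract_kills[where b = b, OF h.split_Obj B h.maps_closed(1,2) xwz(3) h.i_B_p_B t b] by blast
    let ?c = "a \<otimes> (x \<otimes> s \<otimes> s \<otimes> s)"
    have cR: "?c \<in> carrier R" using aR xwz s by simp
    obtain n\<^sub>2 k\<^sub>2 where 2: "?c [^] (k\<^sub>2::nat) \<odot>\<^bsub>Hom C A A\<^esub> alt_prod C A A t b n\<^sub>2 = \<zero>\<^bsub>Hom C A A\<^esub>"
      using retract_kills[where b = b, OF h.split_Obj B h.maps_XB_closed cR h.i_XB_p_XB t b] by blast
    \<comment> \<open>The conjugate of t by \<open>h.p_X\<close> and \<open>h.i_X\<close> is a
      torsion endomorphism that \<epsilon>/s fixes from both sides, that is, a torsion endomorphism
      of the image of \<epsilon>/s; this is what \<open>nil\<close> speaks about.\<close>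
    let ?\<tau> = "Comp C X A X h.p_X (Comp C X A A t h.i_X)"
    have "loc_nil (carrier R - \<pp>) X ?\<tau>"
    proof (rule nil)
      show "?\<tau> \<in> tors R C X X" by (rule tors_conj[OF h.split_Obj X h.maps_closed(3,4) t])
      show "Comp C X X X \<epsilon> ?\<tau> = s \<odot>\<^bsub>Hom C X X\<^esub> ?\<tau>"
        using X tc s by (simp add: Comp_assoc h.\<epsilon>_p_X Comp_lin)
      show "Comp C X X X ?\<tau> \<epsilon> = s \<odot>\<^bsub>Hom C X X\<^esub> ?\<tau>"
        using X tc s by (simp add: Comp_assoc[symmetric] h.i_X_\<epsilon> Comp_lin)
    qed
    from loc_nil_transfer[where b = b, OF h.split_Obj X h.maps_closed(3,4) tc _ _ h.i_X_p_X this b]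
    obtain n\<^sub>3 k\<^sub>3 u where 3: "u \<in> carrier R - \<pp>"
        "(u \<otimes> (x \<otimes> s \<otimes> s) [^] (k\<^sub>3::nat)) \<odot>\<^bsub>Hom C A A\<^esub> alt_prod C A A t b n\<^sub>3 = \<zero>\<^bsub>Hom C A A\<^esub>"
      using xwz s by auto
    let ?d = "u \<otimes> (x \<otimes> s \<otimes> s) [^] k\<^sub>3"
    have dp: "?d \<notin> \<pp>"
      using 3(1) xwz s by (intro max_spec_mult_notin[OF p] max_spec_pow_notin[OF p]) auto
    show "\<exists>K. finite K \<and> K \<subseteq> carrier R \<and> (\<forall>\<qq>\<in>max_spec R. \<not> K \<subseteq> \<qq>) \<and>
        (\<forall>c\<in>K. \<exists>n. c \<odot>\<^bsub>Hom C A A\<^esub> alt_prod C A A t b n = \<zero>\<^bsub>Hom C A A\<^esub>)"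
    proof (intro exI[of _ "{w [^] k\<^sub>1, ?c [^] k\<^sub>2, ?d}"] conjI ballI)
      show "{w [^] k\<^sub>1, ?c [^] k\<^sub>2, ?d} \<subseteq> carrier R" using 3(1) xwz s aR by auto
    next
      fix \<qq> assume q: "\<qq> \<in> max_spec R"
      show "\<not> {w [^] k\<^sub>1, ?c [^] k\<^sub>2, ?d} \<subseteq> \<qq>"
        using cases[OF q] max_spec_pow_notin[OF q xwz(3)] max_spec_pow_notin[OF q cR] dp by auto
    qed (use 1 2 3(2) in auto)
  qed
  moreover have "loc_retract R (carrier R - \<pp>) C A X \<epsilon> s"
  proof (rule h.loc_retract_X)
    have "x \<otimes> s \<otimes> s \<notin> \<pp>" using xwz s by (intro max_spec_mult_notin[OF p]) auto
    then show "x \<otimes> s \<otimes> s \<in> carrier R - \<pp>" using xwz s by simp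
  qed
  moreover have "loc_iso R (carrier R - \<qq>) C A B" if q: "\<qq> \<in> max_spec R" "\<qq> \<noteq> \<pp>" for \<qq>
    using cases[OF q(1)] q(2) h.loc_iso_B[of "carrier R - \<qq>"] h.loc_iso_XB[of "carrier R - \<qq>"] xwz s aR by auto
  moreover have "loc_iso R (nonzeros R) C A B"
  proof (rule h.loc_iso_XB)
    have "x \<noteq> \<zero>" "s \<noteq> \<zero>" using xwz(2) s(2) compl_max_subset[OF p] xwz(1) s(1) by auto
    then show "a \<otimes> (x \<otimes> s \<otimes> s \<otimes> s) \<in> nonzeros R"
      using xwz(1) s(1) d(4) by (auto simp: integral_iff)
  qed
  ultimately show ?thesis by blast
qed

text \<open>The gluing of \<open>glue_at\<close> with \<epsilon> = 1 and s = 1, but keeping both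
  summands: \<open>E\<close> splits off \<open>A\<close>, and 1 - \<open>E\<close> splits off
  \<open>A'\<close>, which agrees with \<open>B\<close> at \<pp> and with \<open>X\<close>
  elsewhere. Thus the sum of \<open>X\<close> and \<open>B\<close> is redistributed and not
  changed.\<close>

lemma glue_pair:
  assumes fa: "fully_additive C" and p: "\<pp> \<in> max_spec R" and X: "torsion_reduced R C X" and B: "torsion_reduced R C B"
    and iso: "loc_iso R (nonzeros R) C B X"
  shows "\<exists>A A' Y. torsion_reduced R C A \<and> torsion_reduced R C A' \<and>
    direct_sum C [A, A'] Y \<and> direct_sum C [X, B] Y \<and>
    loc_iso R (carrier R - \<pp>) C A X \<and> loc_iso R (carrier R - \<pp>) C A' B \<and>
    (\<forall>\<qq>\<in>max_spec R. \<qq> \<noteq> \<pp> \<longrightarrow> loc_iso R (carrier R - \<qq>) C A B \<and> loc_iso R (carrier R - \<qq>) C A' X)"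
proof -
  have XO: "X \<in> Obj C" and BO: "B \<in> Obj C" using X B by (auto simp: torsion_reduced_def)
  obtain \<gamma> \<phi> a where d: "\<gamma> \<in> carrier (Hom C B X)" "\<phi> \<in> carrier (Hom C X B)" "a \<in> nonzeros R"
      "Comp C B X B \<phi> \<gamma> = a \<odot>\<^bsub>Hom C B B\<^esub> Ident C B"
      "Comp C X B X \<gamma> \<phi> = a \<odot>\<^bsub>Hom C X X\<^esub> Ident C X"
    using iso unfolding loc_iso_iff[OF Diff_subset] by blast
  have one: "\<one> \<in> carrier R" "\<one> \<notin> \<pp>" using max_specD(3)[OF p] by auto
  obtain x w z where xwz: "x \<in> carrier R" "x \<notin> \<pp>" "w \<in> carrier R" "z \<in> carrier R" "w \<oplus> x = \<one>" "x \<otimes> w = a \<otimes> z"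
    and x: "\<And>\<qq>. \<qq> \<in> max_spec R \<Longrightarrow> \<qq> \<noteq> \<pp> \<Longrightarrow> a \<in> \<qq> \<Longrightarrow> x \<in> \<qq>"
    using glue_scalars[OF p one, of a] d(3) by auto
  have aR: "a \<in> carrier R" using d by auto
  obtain Y where Y: "direct_sum C [X, B] Y" "Y \<in> Obj C"
    using additiveE[OF fa, of "[X, B]"] XO BO by auto
  obtain \<iota>\<^sub>1 \<pi>\<^sub>1 \<iota>\<^sub>2 \<pi>\<^sub>2 where bip: "biproduct R C X B Y \<iota>\<^sub>1 \<pi>\<^sub>1 \<iota>\<^sub>2 \<pi>\<^sub>2"
    using biproduct_if_direct_sum[OF Y(1)] by blast
  interpret biproduct R C X B Y \<iota>\<^sub>1 \<pi>\<^sub>1 \<iota>\<^sub>2 \<pi>\<^sub>2 by (rule bip)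
  interpret g: glue R C X B Y \<iota>\<^sub>1 \<pi>\<^sub>1 \<iota>\<^sub>2 \<pi>\<^sub>2 "Ident C X" \<phi> \<gamma> \<one> a x w z
    by unfold_locales (use d xwz XO BO in auto)
  have neg_smult: "(\<ominus> \<one>) \<odot>\<^bsub>Hom C U V\<^esub> ((\<ominus> \<one>) \<odot>\<^bsub>Hom C U V\<^esub> f) = f"
    if "U \<in> Obj C" "V \<in> Obj C" "f \<in> carrier (Hom C U V)" for U V f
    using that by (simp add: smult_smult l_minus)
  \<comment> \<open>1 - \<open>E\<close> has the same shape as \<open>E\<close>, with x and w
    exchanged and the signs of \<gamma>, a and z reversed. So every result on \<open>E\<close>
    applies to the complement.\<close>
  interpret g': glue R C X B Y \<iota>\<^sub>1 \<pi>\<^sub>1 \<iota>\<^sub>2 \<pi>\<^sub>2 "Ident C X" \<phi> "(\<ominus> \<one>) \<odot>\<^bsub>Hom C B X\<^esub> \<gamma>" \<one> "\<ominus> a" w x "\<ominus> z"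
  proof unfold_locales
    show "Comp C B X B \<phi> ((\<ominus> \<one>) \<odot>\<^bsub>Hom C B X\<^esub> \<gamma>) = (\<ominus> a) \<odot>\<^bsub>Hom C B B\<^esub> Ident C B"
      using d aR by (simp add: Comp_lin smult_smult l_minus)
    show "\<one> \<odot>\<^bsub>Hom C X X\<^esub> Comp C X B X ((\<ominus> \<one>) \<odot>\<^bsub>Hom C B X\<^esub> \<gamma>) \<phi> = (\<ominus> a) \<odot>\<^bsub>Hom C X X\<^esub> Ident C X"
      using d aR by (simp add: Comp_lin smult_smult l_minus)
    show "x \<oplus> w \<otimes> \<one> = \<one>" using xwz by (simp add: a_comm)
    show "w \<otimes> x = (\<ominus> a) \<otimes> (\<ominus> z)" using xwz aR by (simp add: m_comm l_minus r_minus)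
  qed (use d xwz aR in auto)
  obtain A r j where "A \<in> Obj C" "r \<in> carrier (Hom C Y A)" "j \<in> carrier (Hom C A Y)"
    "Comp C Y A Y j r = g.E" "Comp C A Y A r j = Ident C A"
    using splitE[OF fa Y(2) g.E_closed g.E_idem] by blast
  then interpret h: glue_split R C X B Y \<iota>\<^sub>1 \<pi>\<^sub>1 \<iota>\<^sub>2 \<pi>\<^sub>2 "Ident C X" \<phi> \<gamma> \<one> a x w z A r j
    by unfold_locales
  obtain A' r' j' where "A' \<in> Obj C" "r' \<in> carrier (Hom C Y A')" "j' \<in> carrier (Hom C A' Y)"
    "Comp C Y A' Y j' r' = g'.E" "Comp C A' Y A' r' j' = Ident C A'"
    using splitE[OF fa Y(2) g'.E_closed g'.E_idem] by blast
  then interpret h': glue_split R C X B Y \<iota>\<^sub>1 \<pi>\<^sub>1 \<iota>\<^sub>2 \<pi>\<^sub>2 "Ident C X" \<phi> "(\<ominus> \<one>) \<odot>\<^bsub>Hom C B X\<^esub> \<gamma>" \<one> "\<ominus> a" w x "\<ominus> z" A' r' j'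
    by unfold_locales
  have sum: "g.E \<oplus>\<^bsub>Hom C Y Y\<^esub> g'.E = Ident C Y"
  proof -
    have "g.E \<oplus>\<^bsub>Hom C Y Y\<^esub> g'.E = blk ((w \<oplus> x) \<odot>\<^bsub>Hom C X X\<^esub> Ident C X) ((\<one> \<oplus> \<ominus> \<one>) \<odot>\<^bsub>Hom C B X\<^esub> \<gamma>)
        ((z \<oplus> \<ominus> z) \<odot>\<^bsub>Hom C X B\<^esub> \<phi>) ((w \<oplus> x) \<odot>\<^bsub>Hom C B B\<^esub> Ident C B)"
      unfolding g.E_def g'.E_def using d(1,2) xwz(1-4)
      by (subst blk_add) (simp_all add: smult_add_left add_comm')
    also have "\<dots> = Ident C Y" using d(1,2) xwz by (simp add: r_neg blk_Ident)
    finally show ?thesis .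
  qed
  have "biproduct R C A A' Y j r j' r'"
    by (rule split_complement_biproduct)
      (use h.jr h'.jr h.rj h'.rj sum in simp_all)
  then have AA': "direct_sum C [A, A'] Y" by (rule biproduct.direct_sum)
  have cases: "w \<notin> \<qq> \<or> x \<notin> \<qq>" if "\<qq> \<in> max_spec R" for \<qq>
    using one_minus_notin[OF that xwz(3,1,5)] by auto
  have ip: "Comp C A X A h.i_X h.p_X = x \<odot>\<^bsub>Hom C A A\<^esub> Ident C A"
    "Comp C A' X A' h'.i_X h'.p_X = w \<odot>\<^bsub>Hom C A' A'\<^esub> Ident C A'"
    using h.i_X_p_X h'.i_X_p_X xwz by simp_all
  \<comment> \<open>Stated for an arbitrary object \<open>Z\<close> because both summands need it:
    \<open>A\<close> is compared with \<open>B\<close> by w and with \<open>X\<close> by x, while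
    for \<open>A'\<close> the two scalars trade places.\<close>
  have two: "\<exists>K. finite K \<and> K \<subseteq> carrier R \<and> (\<forall>\<qq>\<in>max_spec R. \<not> K \<subseteq> \<qq>) \<and>
        (\<forall>c\<in>K. \<exists>n. c \<odot>\<^bsub>Hom C Z Z\<^esub> alt_prod C Z Z t b n = \<zero>\<^bsub>Hom C Z Z\<^esub>)"
    if Z: "Z \<in> Obj C" and m: "p\<^sub>1 \<in> carrier (Hom C Z B)" "i\<^sub>1 \<in> carrier (Hom C B Z)"
      "p\<^sub>2 \<in> carrier (Hom C Z X)" "i\<^sub>2 \<in> carrier (Hom C X Z)" "c \<in> carrier R" "c' \<in> carrier R"
      and c: "\<And>\<qq>. \<qq> \<in> max_spec R \<Longrightarrow> c \<notin> \<qq> \<or> c' \<notin> \<qq>"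
      and e: "Comp C Z B Z i\<^sub>1 p\<^sub>1 = c \<odot>\<^bsub>Hom C Z Z\<^esub> Ident C Z" "Comp C Z X Z i\<^sub>2 p\<^sub>2 = c' \<odot>\<^bsub>Hom C Z Z\<^esub> Ident C Z"
      and t: "t \<in> tors R C Z Z" and b: "\<And>n. b n \<in> carrier (Hom C Z Z)" for Z p\<^sub>1 i\<^sub>1 p\<^sub>2 i\<^sub>2 c c' t and b :: "nat \<Rightarrow> 'm"
  proof -
    obtain n\<^sub>1 k\<^sub>1 where 1: "c [^] (k\<^sub>1::nat) \<odot>\<^bsub>Hom C Z Z\<^esub> alt_prod C Z Z t b n\<^sub>1 = \<zero>\<^bsub>Hom C Z Z\<^esub>"
      using retract_kills[where b = b, OF Z B m(1,2,5) e(1) t b] by blast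
    obtain n\<^sub>2 k\<^sub>2 where 2: "c' [^] (k\<^sub>2::nat) \<odot>\<^bsub>Hom C Z Z\<^esub> alt_prod C Z Z t b n\<^sub>2 = \<zero>\<^bsub>Hom C Z Z\<^esub>"
      using retract_kills[where b = b, OF Z X m(3,4,6) e(2) t b] by blast
    have "\<not> {c [^] k\<^sub>1, c' [^] k\<^sub>2} \<subseteq> \<qq>" if q: "\<qq> \<in> max_spec R" for \<qq>
      using c[OF q] max_spec_pow_notin[OF q] m(5,6) by auto
    then show ?thesis
      using 1 2 m(5,6)
      by (intro exI[of _ "{c [^] k\<^sub>1, c' [^] k\<^sub>2}"]) auto
  qed
  have "torsion_reduced R C A"
    by (rule torsion_reducedI[OF h.split_Obj], rule two[OF h.split_Obj h.maps_closed xwz(3,1) cases h.i_B_p_B ip(1)])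
  moreover have "torsion_reduced R C A'"
    by (rule torsion_reducedI[OF h'.split_Obj], rule two[OF h'.split_Obj h'.maps_closed xwz(1,3) _ h'.i_B_p_B ip(2)])
      (use cases in auto)
  moreover have "loc_iso R (carrier R - \<pp>) C A X" "loc_iso R (carrier R - \<pp>) C A' B"
    using xwz by (auto intro!: h.loc_retract_X h'.loc_iso_B)
  moreover have "loc_iso R (carrier R - \<qq>) C A B \<and> loc_iso R (carrier R - \<qq>) C A' X"
    if q: "\<qq> \<in> max_spec R" "\<qq> \<noteq> \<pp>" for \<qq>
  proof (cases "w \<in> \<qq>")
    case False
    then have "loc_iso R (carrier R - \<qq>) C A B" "loc_iso R (carrier R - \<qq>) C A' X"
      using xwz by (auto intro!: h.loc_iso_B h'.loc_retract_X)
    then show ?thesis by auto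
  next
    case True
    \<comment> \<open>With w in \<qq>, x is a unit at \<qq>, so the summands compare with the wrong
      partners: \<open>A\<close> with \<open>X\<close> and \<open>A'\<close> with \<open>B\<close>.
      But then a is outside \<qq> too, and \<phi>, \<gamma> identify \<open>X\<close> with
      \<open>B\<close> there.\<close>
    then have xq: "x \<notin> \<qq>" using cases[OF q(1)] by auto
    then have "a \<notin> \<qq>" using x[OF q] by auto
    then have BX: "loc_iso R (carrier R - \<qq>) C B X"
      unfolding loc_iso_iff[OF Diff_subset] using d XO BO by blast
    have "loc_iso R (carrier R - \<qq>) C A X" "loc_iso R (carrier R - \<qq>) C A' B"
      using xwz xq by (auto intro!: h.loc_retract_X h'.loc_iso_B)
    then show ?thesis using BX loc_iso_at_trans[OF q(1)] loc_iso_at_sym by blast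
  qed
  ultimately show ?thesis using AA' Y(1) by blast
qed

end

section \<open>Gluing at several primes\<close>

context dedekind_category
begin

text \<open>After the first prime is split off, the complement \<open>A'\<close> takes over the role
  of \<open>A\<close>: it is \<open>B\<close> at that prime and locally still \<open>A\<close> at
  all others. The induction hypothesis for \<open>A'\<close> and the remaining primes yields the
  other summands.\<close>

lemma glue_list:
  assumes fa: "fully_additive C" and B: "torsion_reduced R C B"
    and "torsion_reduced R C A" "loc_iso R (nonzeros R) C B A"
    and "ps \<noteq> []" "distinct ps" "set ps \<subseteq> max_spec R"
    and "\<And>\<qq>. \<qq> \<in> max_spec R \<Longrightarrow> \<qq> \<notin> set ps \<Longrightarrow> loc_iso R (carrier R - \<qq>) C A B"
  shows "\<exists>As. length As = length ps \<and>
    (\<forall>i<length ps. torsion_reduced R C (As ! i) \<and> loc_iso R (carrier R - ps ! i) C (As ! i) A \<and>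
      (\<forall>\<qq>\<in>max_spec R. \<qq> \<noteq> ps ! i \<longrightarrow> loc_iso R (carrier R - \<qq>) C (As ! i) B)) \<and>
    (\<exists>S. direct_sum C As S \<and> direct_sum C (A # replicate (length ps - 1) B) S)"
  using assms(3-)
proof (induction ps arbitrary: A)
  case Nil
  then show ?case by simp
next
  case (Cons \<pp> ps)
  have AO: "A \<in> Obj C" and BO: "B \<in> Obj C" using Cons.prems(1) B by (auto simp: torsion_reduced_def)
  have p: "\<pp> \<in> max_spec R" using Cons.prems(5) by auto
  show ?case
  proof (cases "ps = []")
    \<comment> \<open>At the last prime \<open>A\<close> is itself the required object, since it
      already agrees with \<open>B\<close> everywhere else. Only the earlier primes use up a copy of
      \<open>B\<close>, hence one copy fewer than there are primes.\<close>
    case True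
    have "loc_iso R (carrier R - \<qq>) C A B" if "\<qq> \<in> max_spec R" "\<qq> \<noteq> \<pp>" for \<qq>
      using Cons.prems(6) that True by simp
    then have "\<forall>\<qq>\<in>max_spec R. \<qq> \<noteq> \<pp> \<longrightarrow> loc_iso R (carrier R - \<qq>) C A B" by blast
    then have "\<forall>i<length [\<pp>]. torsion_reduced R C ([A] ! i) \<and> loc_iso R (carrier R - [\<pp>] ! i) C ([A] ! i) A \<and>
      (\<forall>\<qq>\<in>max_spec R. \<qq> \<noteq> [\<pp>] ! i \<longrightarrow> loc_iso R (carrier R - \<qq>) C ([A] ! i) B)"
      using Cons.prems(1) loc_iso_at_refl[OF p AO] by (simp only: list.size less_Suc0 nth_Cons_0 add_0 add_Suc_right One_nat_def) simp
    moreover have "direct_sum C (A # replicate (length [\<pp>] - 1) B) A" using direct_sum_single[OF AO] by simp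
    moreover have "direct_sum C [A] A" "length [A] = length [\<pp>]" using direct_sum_single[OF AO] by simp_all
    ultimately show ?thesis unfolding True by blast
  next
    case False
    obtain A\<^sub>1 A' Y where G: "torsion_reduced R C A\<^sub>1 \<and> torsion_reduced R C A' \<and>
        direct_sum C [A\<^sub>1, A'] Y \<and> direct_sum C [A, B] Y \<and>
        loc_iso R (carrier R - \<pp>) C A\<^sub>1 A \<and> loc_iso R (carrier R - \<pp>) C A' B \<and>
        (\<forall>\<qq>\<in>max_spec R. \<qq> \<noteq> \<pp> \<longrightarrow> loc_iso R (carrier R - \<qq>) C A\<^sub>1 B \<and> loc_iso R (carrier R - \<qq>) C A' A)"
      using glue_pair[OF fa p Cons.prems(1) B Cons.prems(2)] by (elim exE)
    have g: "torsion_reduced R C A\<^sub>1" "torsion_reduced R C A'"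
        "direct_sum C [A\<^sub>1, A'] Y" "direct_sum C [A, B] Y"
        "loc_iso R (carrier R - \<pp>) C A\<^sub>1 A" "loc_iso R (carrier R - \<pp>) C A' B"
        "\<And>\<qq>. \<qq> \<in> max_spec R \<Longrightarrow> \<qq> \<noteq> \<pp> \<Longrightarrow> loc_iso R (carrier R - \<qq>) C A\<^sub>1 B"
        "\<And>\<qq>. \<qq> \<in> max_spec R \<Longrightarrow> \<qq> \<noteq> \<pp> \<Longrightarrow> loc_iso R (carrier R - \<qq>) C A' A"
      using G by simp_all
    have AO1: "A\<^sub>1 \<in> Obj C" and AO': "A' \<in> Obj C" using g(1,2) by (auto simp: torsion_reduced_def)
    have A'B: "loc_iso R (carrier R - \<qq>) C A' B" if q: "\<qq> \<in> max_spec R" "\<qq> \<notin> set ps" for \<qq>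
    proof (cases "\<qq> = \<pp>")
      case True
      then show ?thesis using g(6) by simp
    next
      case False
      then have "loc_iso R (carrier R - \<qq>) C A B" using Cons.prems(6) q by simp
      then show ?thesis using loc_iso_at_trans[OF q(1) g(8)] q(1) False by blast
    qed
    \<comment> \<open>A comparison at a single prime suffices generically, because elements outside
      \<pp> are nonzero.\<close>
    have BA': "loc_iso R (nonzeros R) C B A'"
      by (rule loc_retract_mono[OF loc_iso_at_sym[OF g(6)] compl_max_subset[OF p]])
    have ps: "distinct ps" "set ps \<subseteq> max_spec R" using Cons.prems(4,5) by auto
    obtain As where H: "length As = length ps \<and>
      (\<forall>i<length ps. torsion_reduced R C (As ! i) \<and> loc_iso R (carrier R - ps ! i) C (As ! i) A' \<and>
        (\<forall>\<qq>\<in>max_spec R. \<qq> \<noteq> ps ! i \<longrightarrow> loc_iso R (carrier R - \<qq>) C (As ! i) B)) \<and>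
      (\<exists>S. direct_sum C As S \<and> direct_sum C (A' # replicate (length ps - 1) B) S)"
      by (rule exE[OF Cons.IH[OF g(2) BA' False ps]]) (assumption | rule A'B | rule that)+
    then obtain S where S: "direct_sum C As S" "direct_sum C (A' # replicate (length ps - 1) B) S"
      by (elim conjE exE)
    have As: "length As = length ps"
        "\<And>i. i < length ps \<Longrightarrow> torsion_reduced R C (As ! i)"
        "\<And>i. i < length ps \<Longrightarrow> loc_iso R (carrier R - ps ! i) C (As ! i) A'"
        "\<And>i \<qq>. i < length ps \<Longrightarrow> \<qq> \<in> max_spec R \<Longrightarrow> \<qq> \<noteq> ps ! i \<Longrightarrow> loc_iso R (carrier R - \<qq>) C (As ! i) B"
        "direct_sum C As S" "direct_sum C (A' # replicate (length ps - 1) B) S"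
      using H S by simp_all
    have SO: "S \<in> Obj C" using As(5) by (simp add: direct_sum_def)
    have "loc_iso R (carrier R - (\<pp> # ps) ! i) C ((A\<^sub>1 # As) ! i) A" if i: "i < length (\<pp> # ps)" for i
    proof (cases i)
      case 0
      then show ?thesis using g(5) by simp
    next
      case (Suc k)
      then have k: "k < length ps" using i by simp
      have q: "ps ! k \<in> max_spec R" "ps ! k \<noteq> \<pp>" using Cons.prems(4,5) nth_mem[OF k] by auto
      then show ?thesis using loc_iso_at_trans[OF q(1) As(3)[OF k] g(8)[OF q]] Suc by simp
    qed
    moreover have "loc_iso R (carrier R - \<qq>) C ((A\<^sub>1 # As) ! i) B"
      if i: "i < length (\<pp> # ps)" "\<qq> \<in> max_spec R" "\<qq> \<noteq> (\<pp> # ps) ! i" for i \<qq>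
      using i g(7)[of \<qq>] As(4)[of "i - 1" \<qq>] by (cases i) auto
    moreover have "torsion_reduced R C ((A\<^sub>1 # As) ! i)" if i: "i < length (\<pp> # ps)" for i
      using i g(1) As(2)[of "i - 1"] by (cases i) auto
    moreover have "\<exists>S. direct_sum C (A\<^sub>1 # As) S \<and> direct_sum C (A # replicate (length (\<pp> # ps) - 1) B) S"
    proof -
      \<comment> \<open>\<open>Y\<close> is a direct sum of \<open>A\<^sub>1\<close> and
        \<open>A'\<close> as well as of \<open>A\<close> and \<open>B\<close>. Adding the copies
        \<open>?Bs\<close> to it gives \<open>W\<close>, which is compared with the sum
        \<open>T\<close> of \<open>A\<^sub>1\<close> and the object \<open>S\<close> from the
        induction hypothesis.\<close>
      let ?Bs = "replicate (length ps - 1) B"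
      obtain T where T: "direct_sum C [A\<^sub>1, S] T" using additiveE[OF fa, of "[A\<^sub>1, S]"] AO1 SO by auto
      obtain Z where Z: "direct_sum C ?Bs Z" "Z \<in> Obj C"
      proof (rule additiveE[OF fa])
        show "set ?Bs \<subseteq> Obj C" using BO by (simp add: set_replicate_conv_if)
      qed
      have "Y \<in> Obj C" using g(3) by (simp add: direct_sum_def)
      then obtain W where W: "direct_sum C [Y, Z] W"
        using additiveE[OF fa, of "[Y, Z]"] Z(2) by auto
      have "direct_sum C ([A\<^sub>1, A'] @ ?Bs) W" by (rule direct_sum_append[OF W g(3) Z(1)])
      moreover have "direct_sum C (A\<^sub>1 # (A' # ?Bs)) T" by (rule direct_sum_Cons[OF T As(6) AO1])
      ultimately have "isomorphic C W T" by (intro direct_sum_unique) simp_all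
      moreover have "direct_sum C ([A, B] @ ?Bs) W" by (rule direct_sum_append[OF W g(4) Z(1)])
      ultimately have "direct_sum C ([A, B] @ ?Bs) T" by (rule direct_sum_transport[rotated])
      moreover have "B # ?Bs = replicate (length (\<pp> # ps) - 1) B"
        using False by (cases ps) auto
      moreover have "direct_sum C (A\<^sub>1 # As) T" by (rule direct_sum_Cons[OF T As(5) AO1])
      ultimately show ?thesis by auto
    qed
    ultimately show ?thesis
      using As(1) by (intro exI[of _ "A\<^sub>1 # As"]) simp
  qed
qed

text \<open>The primes are treated one at a time, the object glued so far replacing
  \<open>B\<close>. Keeping it generically isomorphic to \<open>B\<close> is the invariant that
  makes the data for the next prime applicable.\<close>

lemma glue_family:
  fixes \<pp> :: "nat \<Rightarrow> 'r set" and X :: "nat \<Rightarrow> 'o"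
  assumes fa: "fully_additive C" and B: "torsion_reduced R C B"
    and inj: "inj_on \<pp> {1..r}" and p: "\<And>i. i \<in> {1..r} \<Longrightarrow> \<pp> i \<in> max_spec R"
    and X: "\<And>i. i \<in> {1..r} \<Longrightarrow> X i \<in> Obj C"
    and \<epsilon>: "\<And>i. i \<in> {1..r} \<Longrightarrow> \<epsilon> i \<in> carrier (Hom C (X i) (X i))"
      "\<And>i. i \<in> {1..r} \<Longrightarrow> Comp C (X i) (X i) (X i) (\<epsilon> i) (\<epsilon> i) = s i \<odot>\<^bsub>Hom C (X i) (X i)\<^esub> \<epsilon> i"
    and s: "\<And>i. i \<in> {1..r} \<Longrightarrow> s i \<in> carrier R" "\<And>i. i \<in> {1..r} \<Longrightarrow> s i \<notin> \<pp> i"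
    and ret: "\<And>i. i \<in> {1..r} \<Longrightarrow> loc_retract R (nonzeros R) C B (X i) (\<epsilon> i) (s i)"
    and nil: "\<And>i \<tau>. i \<in> {1..r} \<Longrightarrow> \<tau> \<in> tors R C (X i) (X i) \<Longrightarrow>
       Comp C (X i) (X i) (X i) (\<epsilon> i) \<tau> = s i \<odot>\<^bsub>Hom C (X i) (X i)\<^esub> \<tau> \<Longrightarrow>
       Comp C (X i) (X i) (X i) \<tau> (\<epsilon> i) = s i \<odot>\<^bsub>Hom C (X i) (X i)\<^esub> \<tau> \<Longrightarrow> loc_nil (carrier R - \<pp> i) (X i) \<tau>"
  shows "\<exists>A. torsion_reduced R C A \<and> loc_iso R (nonzeros R) C A B \<and>
    (\<forall>i\<in>{1..r}. loc_retract R (carrier R - \<pp> i) C A (X i) (\<epsilon> i) (s i)) \<and>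
    (\<forall>\<qq>\<in>max_spec R. \<qq> \<notin> \<pp> ` {1..r} \<longrightarrow> loc_iso R (carrier R - \<qq>) C A B)"
proof -
  have nz: "u \<otimes> v \<in> nonzeros R" if "u \<in> nonzeros R" "v \<in> nonzeros R" for u v
    using that integral by auto
  have "\<exists>A. torsion_reduced R C A \<and> loc_iso R (nonzeros R) C A B \<and>
    (\<forall>i\<in>{1..n}. loc_retract R (carrier R - \<pp> i) C A (X i) (\<epsilon> i) (s i)) \<and>
    (\<forall>\<qq>\<in>max_spec R. \<qq> \<notin> \<pp> ` {1..n} \<longrightarrow> loc_iso R (carrier R - \<qq>) C A B)" if "n \<le> r" for n
    using that
  proof (induction n)
    case 0
    have "B \<in> Obj C" using B by (simp add: torsion_reduced_def)
    then show ?case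
      using B loc_iso_at_refl loc_iso_refl[of B "nonzeros R"] by (intro exI[of _ B]) auto
  next
    case (Suc n)
    let ?k = "Suc n"
    have k: "?k \<in> {1..r}" using Suc.prems by auto
    obtain A where A: "torsion_reduced R C A" "loc_iso R (nonzeros R) C A B"
        "\<And>i. i \<in> {1..n} \<Longrightarrow> loc_retract R (carrier R - \<pp> i) C A (X i) (\<epsilon> i) (s i)"
        "\<And>\<qq>. \<qq> \<in> max_spec R \<Longrightarrow> \<qq> \<notin> \<pp> ` {1..n} \<Longrightarrow> loc_iso R (carrier R - \<qq>) C A B"
      using Suc.IH Suc.prems by auto
    \<comment> \<open>The retract data given for \<open>B\<close> are transported to the current
      object along the generic isomorphism.\<close>
    have ret': "loc_retract R (nonzeros R) C A (X ?k) (\<epsilon> ?k) (s ?k)"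
      by (rule loc_retract_trans[OF A(2) ret[OF k] _ s(1)[OF k] \<epsilon>(1)[OF k]]) (use nz in auto)
    obtain A' where G: "torsion_reduced R C A' \<and> loc_retract R (carrier R - \<pp> ?k) C A' (X ?k) (\<epsilon> ?k) (s ?k) \<and>
        loc_iso R (nonzeros R) C A' A \<and>
        (\<forall>\<qq>\<in>max_spec R. \<qq> \<noteq> \<pp> ?k \<longrightarrow> loc_iso R (carrier R - \<qq>) C A' A)"
      by (rule exE[OF glue_at[OF fa p[OF k] A(1) X[OF k] \<epsilon>(1)[OF k] \<epsilon>(2)[OF k] s(1)[OF k] s(2)[OF k] ret']])
        (assumption | rule nil[OF k] | rule that)+
    have A': "torsion_reduced R C A'" "loc_retract R (carrier R - \<pp> ?k) C A' (X ?k) (\<epsilon> ?k) (s ?k)"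
        "loc_iso R (nonzeros R) C A' A"
        "\<And>\<qq>. \<qq> \<in> max_spec R \<Longrightarrow> \<qq> \<noteq> \<pp> ?k \<Longrightarrow> loc_iso R (carrier R - \<qq>) C A' A"
      using G by simp_all
    have "loc_iso R (nonzeros R) C A' B"
      by (rule loc_iso_trans[OF A'(3) A(2)]) (use nz in auto)
    moreover have "loc_retract R (carrier R - \<pp> i) C A' (X i) (\<epsilon> i) (s i)" if i: "i \<in> {1..Suc n}" for i
    proof (cases "i = ?k")
      case True
      then show ?thesis using A'(2) by simp
    next
      case False
      then have i': "i \<in> {1..n}" "i \<in> {1..r}" using i Suc.prems by auto
      \<comment> \<open>Distinctness matters here: gluing at the new prime leaves the localisation
        at every earlier one unchanged.\<close>
      have "\<pp> i \<noteq> \<pp> ?k" using inj_onD[OF inj _ i'(2) k] False by auto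
      then show ?thesis
        using max_spec_mult_notin[OF p[OF i'(2)]]
        by (intro loc_retract_trans[OF A'(4)[OF p[OF i'(2)]] A(3)[OF i'(1)] _ s(1)[OF i'(2)] \<epsilon>(1)[OF i'(2)]]) auto
    qed
    moreover have "loc_iso R (carrier R - \<qq>) C A' B" if q: "\<qq> \<in> max_spec R" "\<qq> \<notin> \<pp> ` {1..Suc n}" for \<qq>
    proof -
      have "\<qq> \<noteq> \<pp> ?k" "\<qq> \<notin> \<pp> ` {1..n}" using q(2) by auto
      then show ?thesis using loc_iso_at_trans[OF q(1) A'(4)[OF q(1)] A(4)[OF q(1)]] by simp
    qed
    ultimately show ?case using A'(1) by blast
  qed
  then show ?thesis by blast
qed

end

section \<open>Morphisms of the localised category\<close>

text \<open>The choice for a singleton list is the trivial one, so that the images of objects and morphisms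
  of \<open>C\<close> in a localisation are instances of the general form of an object or morphism.\<close>

definition sum_choice :: "('o, 'r, 'm) mcat \<Rightarrow> 'o list \<Rightarrow> 'o \<times> (nat \<Rightarrow> 'm) \<times> (nat \<Rightarrow> 'm)" where
  "sum_choice C Xs = (SOME d. (case d of (X, \<iota>, \<pi>) \<Rightarrow> sum_data C Xs X \<iota> \<pi> \<and>
     (\<forall>A. Xs = [A] \<longrightarrow> X = A \<and> \<iota> = (\<lambda>_. Ident C A) \<and> \<pi> = (\<lambda>_. Ident C A))))"

locale additive_category = r_category R C
  for R :: "('r, 'k) ring_scheme" (structure) and C :: "('o, 'r, 'm) mcat" +
  assumes additive: "additive C"
begin

definition "D Xs = fst (sum_choice C Xs)"
definition "inc Xs = fst (snd (sum_choice C Xs))"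
definition "prj Xs = snd (snd (sum_choice C Xs))"

lemma sum_choice:
  assumes "set Xs \<subseteq> Obj C"
  shows "sum_data C Xs (D Xs) (inc Xs) (prj Xs)"
    and "Xs = [A] \<Longrightarrow> D Xs = A \<and> inc Xs = (\<lambda>_. Ident C A) \<and> prj Xs = (\<lambda>_. Ident C A)"
proof -
  have "\<exists>d. (case d of (X, \<iota>, \<pi>) \<Rightarrow> sum_data C Xs X \<iota> \<pi> \<and>
     (\<forall>A. Xs = [A] \<longrightarrow> X = A \<and> \<iota> = (\<lambda>_. Ident C A) \<and> \<pi> = (\<lambda>_. Ident C A)))"
  proof (cases "\<exists>A. Xs = [A]")
    case True
    then obtain A where A: "Xs = [A]" by auto
    then have "sum_data C Xs A (\<lambda>_. Ident C A) (\<lambda>_. Ident C A)"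
      using sum_data_single[of A] assms by simp
    then show ?thesis using A by (intro exI[of _ "(A, (\<lambda>_. Ident C A), (\<lambda>_. Ident C A))"]) simp
  next
    case False
    obtain X \<iota> \<pi> where "sum_data C Xs X \<iota> \<pi>"
      using additive assms unfolding additive_def direct_sum_iff by meson
    then show ?thesis using False by (intro exI[of _ "(X, \<iota>, \<pi>)"]) simp
  qed
  from someI_ex[OF this]
  have "sum_data C Xs (D Xs) (inc Xs) (prj Xs) \<and>
     (\<forall>A. Xs = [A] \<longrightarrow> D Xs = A \<and> inc Xs = (\<lambda>_. Ident C A) \<and> prj Xs = (\<lambda>_. Ident C A))"
    unfolding sum_choice_def[symmetric] by (simp add: D_def inc_def prj_def case_prod_beta)
  then show "sum_data C Xs (D Xs) (inc Xs) (prj Xs)"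
    and "Xs = [A] \<Longrightarrow> D Xs = A \<and> inc Xs = (\<lambda>_. Ident C A) \<and> prj Xs = (\<lambda>_. Ident C A)"
    by blast+
qed

lemma D_single [simp]: "A \<in> Obj C \<Longrightarrow> D [A] = A"
  and inc_single [simp]: "A \<in> Obj C \<Longrightarrow> inc [A] i = Ident C A"
  and prj_single [simp]: "A \<in> Obj C \<Longrightarrow> prj [A] i = Ident C A"
  using sum_choice(2)[of "[A]" A] by auto

lemma D_Obj [simp]: "set Xs \<subseteq> Obj C \<Longrightarrow> D Xs \<in> Obj C"
  using sum_dataD(2)[OF sum_choice(1)] .

lemma nth_Obj [simp]: "set Xs \<subseteq> Obj C \<Longrightarrow> i < length Xs \<Longrightarrow> Xs ! i \<in> Obj C"
  using nth_mem by blast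

lemma inc_closed [simp]: "set Xs \<subseteq> Obj C \<Longrightarrow> i < length Xs \<Longrightarrow> inc Xs i \<in> carrier (Hom C (Xs ! i) (D Xs))"
  using sum_dataD(3)[OF sum_choice(1)] .

lemma prj_closed [simp]: "set Xs \<subseteq> Obj C \<Longrightarrow> i < length Xs \<Longrightarrow> prj Xs i \<in> carrier (Hom C (D Xs) (Xs ! i))"
  using sum_dataD(4)[OF sum_choice(1)] .

lemma prj_inc: "set Xs \<subseteq> Obj C \<Longrightarrow> i < length Xs \<Longrightarrow> j < length Xs \<Longrightarrow>
    Comp C (Xs ! i) (D Xs) (Xs ! j) (prj Xs j) (inc Xs i) =
      (if i = j then Ident C (Xs ! i) else \<zero>\<^bsub>Hom C (Xs ! i) (Xs ! j)\<^esub>)"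
  using sum_dataD(6)[OF sum_choice(1)] .

lemma inc_prj: "set Xs \<subseteq> Obj C \<Longrightarrow>
    (\<Oplus>\<^bsub>Hom C (D Xs) (D Xs)\<^esub>i\<in>{..<length Xs}. Comp C (D Xs) (Xs ! i) (D Xs) (inc Xs i) (prj Xs i)) = Ident C (D Xs)"
  using sum_dataD(7)[OF sum_choice(1)] .

text \<open>The matrix of a morphism between chosen direct sums, row index for the target and column
  index for the source as in \<open>sum_hull\<close>. It lets a formal direct sum be replaced by an
  actual object of the category.\<close>

definition entry :: "'o list \<Rightarrow> 'o list \<Rightarrow> 'm \<Rightarrow> nat \<Rightarrow> nat \<Rightarrow> 'm" where
  "entry Xs Ys f i j =
     Comp C (Xs ! j) (D Xs) (Ys ! i) (Comp C (D Xs) (D Ys) (Ys ! i) (prj Ys i) f) (inc Xs j)"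

lemma entry_closed [simp]:
  "\<lbrakk>set Xs \<subseteq> Obj C; set Ys \<subseteq> Obj C; f \<in> carrier (Hom C (D Xs) (D Ys)); i < length Ys; j < length Xs\<rbrakk>
    \<Longrightarrow> entry Xs Ys f i j \<in> carrier (Hom C (Xs ! j) (Ys ! i))"
  by (simp add: entry_def)

lemma entry_single [simp]:
  "\<lbrakk>A \<in> Obj C; B \<in> Obj C; f \<in> carrier (Hom C A B)\<rbrakk> \<Longrightarrow> entry [A] [B] f 0 0 = f"
  by (simp add: entry_def)

lemma entry_smult:
  "\<lbrakk>set Xs \<subseteq> Obj C; set Ys \<subseteq> Obj C; f \<in> carrier (Hom C (D Xs) (D Ys)); r \<in> carrier R; i < length Ys; j < length Xs\<rbrakk>
    \<Longrightarrow> entry Xs Ys (r \<odot>\<^bsub>Hom C (D Xs) (D Ys)\<^esub> f) i j = r \<odot>\<^bsub>Hom C (Xs ! j) (Ys ! i)\<^esub> entry Xs Ys f i j"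
  by (simp add: entry_def Comp_lin)

lemma entry_zero:
  "\<lbrakk>set Xs \<subseteq> Obj C; set Ys \<subseteq> Obj C; i < length Ys; j < length Xs\<rbrakk>
    \<Longrightarrow> entry Xs Ys \<zero>\<^bsub>Hom C (D Xs) (D Ys)\<^esub> i j = \<zero>\<^bsub>Hom C (Xs ! j) (Ys ! i)\<^esub>"
  by (simp add: entry_def)

text \<open>Matrix multiplication: the sum over k inserts the decomposition of the identity of
  \<open>D Ys\<close> between \<open>g\<close> and \<open>f\<close>.\<close>

lemma entry_Comp:
  assumes "set Xs \<subseteq> Obj C" "set Ys \<subseteq> Obj C" "set Zs \<subseteq> Obj C"
    "f \<in> carrier (Hom C (D Xs) (D Ys))" "g \<in> carrier (Hom C (D Ys) (D Zs))" "i < length Zs" "j < length Xs"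
  shows "(\<Oplus>\<^bsub>Hom C (Xs ! j) (Zs ! i)\<^esub>k\<in>{..<length Ys}. Comp C (Xs ! j) (Ys ! k) (Zs ! i) (entry Ys Zs g i k) (entry Xs Ys f k j))
    = entry Xs Zs (Comp C (D Xs) (D Ys) (D Zs) g f) i j"
proof -
  let ?g = "Comp C (D Ys) (D Zs) (Zs ! i) (prj Zs i) g" and ?f = "Comp C (Xs ! j) (D Xs) (D Ys) f (inc Xs j)"
  have gf: "?g \<in> carrier (Hom C (D Ys) (Zs ! i))" "?f \<in> carrier (Hom C (Xs ! j) (D Ys))"
    using assms by simp_all
  have "(\<Oplus>\<^bsub>Hom C (Xs ! j) (Zs ! i)\<^esub>k\<in>{..<length Ys}. Comp C (Xs ! j) (Ys ! k) (Zs ! i) (entry Ys Zs g i k) (entry Xs Ys f k j))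
      = (\<Oplus>\<^bsub>Hom C (Xs ! j) (Zs ! i)\<^esub>k\<in>{..<length Ys}. Comp C (Xs ! j) (D Ys) (Zs ! i) ?g
          (Comp C (Xs ! j) (D Ys) (D Ys) (Comp C (D Ys) (Ys ! k) (D Ys) (inc Ys k) (prj Ys k)) ?f))"
    using assms by (intro finsum_cong') (simp_all add: entry_def Comp_assoc)
  also have "\<dots> = Comp C (Xs ! j) (D Ys) (Zs ! i) ?g (Comp C (Xs ! j) (D Ys) (D Ys) (Ident C (D Ys)) ?f)"
    unfolding inc_prj[OF assms(2), symmetric] using assms gf by (simp add: Comp_finsum_right Comp_finsum_left)
  also have "\<dots> = entry Xs Zs (Comp C (D Xs) (D Ys) (D Zs) g f) i j"
    using assms by (simp add: entry_def Comp_assoc)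
  finally show ?thesis .
qed

text \<open>\<open>rec\<close> rebuilds a morphism from its entries by composing on both sides with
  the decompositions of the identities of source and target.\<close>

lemma entry_ext:
  assumes Xs: "set Xs \<subseteq> Obj C" and Ys: "set Ys \<subseteq> Obj C"
    and f: "f \<in> carrier (Hom C (D Xs) (D Ys))" and g: "g \<in> carrier (Hom C (D Xs) (D Ys))"
    and eq: "\<And>i j. i < length Ys \<Longrightarrow> j < length Xs \<Longrightarrow> entry Xs Ys f i j = entry Xs Ys g i j"
  shows "f = g"
proof -
  have rec: "h = (\<Oplus>\<^bsub>Hom C (D Xs) (D Ys)\<^esub>i\<in>{..<length Ys}. Comp C (D Xs) (Ys ! i) (D Ys) (inc Ys i)
      (\<Oplus>\<^bsub>Hom C (D Xs) (Ys ! i)\<^esub>j\<in>{..<length Xs}. Comp C (D Xs) (Xs ! j) (Ys ! i) (entry Xs Ys h i j) (prj Xs j)))"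
    if h: "h \<in> carrier (Hom C (D Xs) (D Ys))" for h
  proof -
    have inner: "(\<Oplus>\<^bsub>Hom C (D Xs) (Ys ! i)\<^esub>j\<in>{..<length Xs}. Comp C (D Xs) (Xs ! j) (Ys ! i) (entry Xs Ys h i j) (prj Xs j))
        = Comp C (D Xs) (D Ys) (Ys ! i) (prj Ys i) h" if i: "i < length Ys" for i
    proof -
      let ?h = "Comp C (D Xs) (D Ys) (Ys ! i) (prj Ys i) h"
      have hc: "?h \<in> carrier (Hom C (D Xs) (Ys ! i))" using Xs Ys h i by simp
      have "(\<Oplus>\<^bsub>Hom C (D Xs) (Ys ! i)\<^esub>j\<in>{..<length Xs}. Comp C (D Xs) (Xs ! j) (Ys ! i) (entry Xs Ys h i j) (prj Xs j))
        = (\<Oplus>\<^bsub>Hom C (D Xs) (Ys ! i)\<^esub>j\<in>{..<length Xs}. Comp C (D Xs) (D Xs) (Ys ! i) ?h (Comp C (D Xs) (Xs ! j) (D Xs) (inc Xs j) (prj Xs j)))"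
        using Xs Ys h i by (intro finsum_cong') (simp_all add: entry_def Comp_assoc)
      also have "\<dots> = Comp C (D Xs) (D Xs) (Ys ! i) ?h (Ident C (D Xs))"
        unfolding inc_prj[OF Xs, symmetric] using Xs Ys hc i by (simp add: Comp_finsum_right)
      finally show ?thesis using Xs Ys hc i by simp
    qed
    have "(\<Oplus>\<^bsub>Hom C (D Xs) (D Ys)\<^esub>i\<in>{..<length Ys}. Comp C (D Xs) (Ys ! i) (D Ys) (inc Ys i)
        (\<Oplus>\<^bsub>Hom C (D Xs) (Ys ! i)\<^esub>j\<in>{..<length Xs}. Comp C (D Xs) (Xs ! j) (Ys ! i) (entry Xs Ys h i j) (prj Xs j)))
      = (\<Oplus>\<^bsub>Hom C (D Xs) (D Ys)\<^esub>i\<in>{..<length Ys}. Comp C (D Xs) (D Ys) (D Ys) (Comp C (D Ys) (Ys ! i) (D Ys) (inc Ys i) (prj Ys i)) h)"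
      using Xs Ys h by (intro finsum_cong') (simp_all add: inner Comp_assoc)
    also have "\<dots> = Comp C (D Xs) (D Ys) (D Ys) (Ident C (D Ys)) h"
      unfolding inc_prj[OF Ys, symmetric] using Xs Ys h by (simp add: Comp_finsum_left)
    finally show ?thesis using Xs Ys h by simp
  qed
  have "(\<Oplus>\<^bsub>Hom C (D Xs) (D Ys)\<^esub>i\<in>{..<length Ys}. Comp C (D Xs) (Ys ! i) (D Ys) (inc Ys i)
      (\<Oplus>\<^bsub>Hom C (D Xs) (Ys ! i)\<^esub>j\<in>{..<length Xs}. Comp C (D Xs) (Xs ! j) (Ys ! i) (entry Xs Ys f i j) (prj Xs j)))
    = (\<Oplus>\<^bsub>Hom C (D Xs) (D Ys)\<^esub>i\<in>{..<length Ys}. Comp C (D Xs) (Ys ! i) (D Ys) (inc Ys i)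
      (\<Oplus>\<^bsub>Hom C (D Xs) (Ys ! i)\<^esub>j\<in>{..<length Xs}. Comp C (D Xs) (Xs ! j) (Ys ! i) (entry Xs Ys g i j) (prj Xs j)))"
    using Xs Ys g eq by (intro finsum_cong' arg_cong[where f = "Comp C _ _ _ _"]) simp_all
  then show ?thesis using rec[OF f] rec[OF g] by simp
qed

lemma entry_surj:
  assumes Xs: "set Xs \<subseteq> Obj C" and Ys: "set Ys \<subseteq> Obj C"
    and m: "\<And>i j. i < length Ys \<Longrightarrow> j < length Xs \<Longrightarrow> m i j \<in> carrier (Hom C (Xs ! j) (Ys ! i))"
  shows "\<exists>f\<in>carrier (Hom C (D Xs) (D Ys)). \<forall>i<length Ys. \<forall>j<length Xs. entry Xs Ys f i j = m i j"
proof -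
  let ?row = "\<lambda>i. \<Oplus>\<^bsub>Hom C (D Xs) (Ys ! i)\<^esub>j\<in>{..<length Xs}. Comp C (D Xs) (Xs ! j) (Ys ! i) (m i j) (prj Xs j)"
  let ?f = "\<Oplus>\<^bsub>Hom C (D Xs) (D Ys)\<^esub>i\<in>{..<length Ys}. Comp C (D Xs) (Ys ! i) (D Ys) (inc Ys i) (?row i)"
  have row: "?row i \<in> carrier (Hom C (D Xs) (Ys ! i))" if "i < length Ys" for i
    using Xs Ys m that by simp
  have f: "?f \<in> carrier (Hom C (D Xs) (D Ys))"
    using Xs Ys row by simp
  have "entry Xs Ys ?f i j = m i j" if i: "i < length Ys" and j: "j < length Xs" for i j
  proof -
    have "Comp C (D Xs) (D Ys) (Ys ! i) (prj Ys i) ?f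
        = (\<Oplus>\<^bsub>Hom C (D Xs) (Ys ! i)\<^esub>k\<in>{..<length Ys}. Comp C (D Xs) (D Ys) (Ys ! i) (prj Ys i) (Comp C (D Xs) (Ys ! k) (D Ys) (inc Ys k) (?row k)))"
      using Xs Ys row i by (subst Comp_finsum_right) simp_all
    also have "\<dots> = (\<Oplus>\<^bsub>Hom C (D Xs) (Ys ! i)\<^esub>k\<in>{..<length Ys}. if i = k then ?row i else \<zero>\<^bsub>Hom C (D Xs) (Ys ! i)\<^esub>)"
    proof (rule finsum_cong')
      fix k assume k: "k < length Ys"
      show "Comp C (D Xs) (D Ys) (Ys ! i) (prj Ys i) (Comp C (D Xs) (Ys ! k) (D Ys) (inc Ys k) (?row k))
          = (if i = k then ?row i else \<zero>\<^bsub>Hom C (D Xs) (Ys ! i)\<^esub>)"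
        using Xs Ys row[OF k] i k by (simp only: Comp_assoc D_Obj nth_Obj inc_closed prj_closed prj_inc) simp
    qed (use Xs Ys row i in auto)
    also have "\<dots> = ?row i"
      using Xs Ys row i by (intro abelian_monoid.finsum_delta[OF Hom_monoid]) auto
    finally have "entry Xs Ys ?f i j = Comp C (Xs ! j) (D Xs) (Ys ! i) (?row i) (inc Xs j)"
      by (simp add: entry_def)
    also have "\<dots> = (\<Oplus>\<^bsub>Hom C (Xs ! j) (Ys ! i)\<^esub>k\<in>{..<length Xs}. Comp C (Xs ! j) (D Xs) (Ys ! i) (Comp C (D Xs) (Xs ! k) (Ys ! i) (m i k) (prj Xs k)) (inc Xs j))"
      using Xs Ys m i j by (subst Comp_finsum_left) simp_all
    also have "\<dots> = (\<Oplus>\<^bsub>Hom C (Xs ! j) (Ys ! i)\<^esub>k\<in>{..<length Xs}. if j = k then m i j else \<zero>\<^bsub>Hom C (Xs ! j) (Ys ! i)\<^esub>)"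
      using Xs Ys m i j by (intro finsum_cong') (auto simp: Comp_assoc[symmetric] prj_inc)
    also have "\<dots> = m i j"
      using Xs Ys m i j by (intro abelian_monoid.finsum_delta[OF Hom_monoid]) auto
    finally show ?thesis .
  qed
  then show ?thesis using f by blast
qed

end

text \<open>A property stable under multiples holds for the product of finitely many witnesses. It
  supplies the common denominator and the common annihilator for all entries of a matrix.\<close>

lemma (in fraction_setting) common_multiple:
  assumes "finite I" "\<And>k. k \<in> I \<Longrightarrow> \<exists>s\<in>S. P k s"
    "\<And>k s t. k \<in> I \<Longrightarrow> s \<in> S \<Longrightarrow> t \<in> S \<Longrightarrow> P k s \<Longrightarrow> P k (t \<otimes> s)"
  shows "\<exists>s\<in>S. \<forall>k\<in>I. P k s"
  using assms
proof (induction I)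
  case empty
  then show ?case using one_in_S by auto
next
  case (insert k I)
  then obtain s where s: "s \<in> S" "\<forall>k\<in>I. P k s" by auto
  obtain t where t: "t \<in> S" "P k t" using insert.prems(1)[of k] by auto
  have "P i (t \<otimes> s)" if "i \<in> I" for i using insert.prems(2)[of i s t] s t that by auto
  moreover have "P k (t \<otimes> s)" using insert.prems(2)[of k t s] s t by (simp add: m_comm)
  ultimately show ?case using S_mult[OF t(1) s(1)] by (intro bexI[of _ "t \<otimes> s"]) auto
qed

section \<open>Localised morphisms as fractions of morphisms between chosen direct sums\<close>

locale localisation = fraction_setting R S + additive_category R C
  for R :: "('r, 'k) ring_scheme" (structure) and S and C :: "('o, 'r, 'm) mcat"
begin

lemma Hom_fraction_module:
  assumes "A \<in> Obj C" "B \<in> Obj C"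
  shows "fraction_module R S (Hom C A B)"
  using Hom_module[OF assms] fraction_setting_axioms by (simp add: fraction_module_def)

abbreviation "L \<equiv> frac_cat R S C"
abbreviation "frc A B \<equiv> mfrac R S (Hom C A B)"

lemma L_simps [simp]:
  "Obj L = Obj C" "Hom L A B = tens_module R F (frac_emb R S) (Hom C A B)"
  "Ident L A = frc A A (Ident C A) \<one>"
  by (simp_all add: frac_cat_def tens_cat_def mfrac_def one_F)

lemma frc_closed [simp]:
  "\<lbrakk>A \<in> Obj C; B \<in> Obj C; f \<in> carrier (Hom C A B); s \<in> S\<rbrakk> \<Longrightarrow> frc A B f s \<in> carrier (Hom L A B)"
  using fraction_module.mfr_closed[OF Hom_fraction_module] by simp

lemma frc_Comp:
  assumes "A \<in> Obj C" "B \<in> Obj C" "E \<in> Obj C" "f \<in> carrier (Hom C A B)" "g \<in> carrier (Hom C B E)" "s \<in> S" "t \<in> S"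
  shows "Comp L A B E (frc B E g t) (frc A B f s) = frc A E (Comp C A B E g f) (t \<otimes> s)"
proof -
  have "fraction_bilinear R S (Hom C B E) (Hom C A B) (Hom C A E) (Comp C A B E)"
    unfolding fraction_bilinear_def fraction_bilinear_axioms_def
    using assms(1-3) fraction_setting_axioms Hom_fraction_module by (simp add: Comp_lin)
  from fraction_bilinear.mfrac_bil[OF this assms(5,4,7,6)] show ?thesis
    by (simp add: frac_cat_def tens_cat_def)
qed

lemma L_monoid: "A \<in> Obj C \<Longrightarrow> B \<in> Obj C \<Longrightarrow> abelian_monoid (Hom L A B)"
  using abelian_group.axioms(1)[OF fraction_module.T_abelian_group[OF Hom_fraction_module]] by simp

lemma frc_finsum:
  assumes "A \<in> Obj C" "B \<in> Obj C" "s \<in> S" "\<And>i. i < n \<Longrightarrow> f i \<in> carrier (Hom C A B)"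
  shows "(\<Oplus>\<^bsub>Hom L A B\<^esub>i\<in>{..<n::nat}. frc A B (f i) s) = frc A B (\<Oplus>\<^bsub>Hom C A B\<^esub>i\<in>{..<n}. f i) s"
  using assms(4)
proof (induction n)
  case 0
  show ?case
    using assms(1-3) fraction_module.mfr_zero[OF Hom_fraction_module]
    by (simp add: abelian_monoid.finsum_empty[OF Hom_monoid] abelian_monoid.finsum_empty[OF L_monoid, simplified])
next
  case (Suc n)
  have "(\<Oplus>\<^bsub>Hom L A B\<^esub>i\<in>{..<Suc n}. frc A B (f i) s)
      = frc A B (f n) s \<oplus>\<^bsub>Hom L A B\<^esub> (\<Oplus>\<^bsub>Hom L A B\<^esub>i\<in>{..<n}. frc A B (f i) s)"
    using assms(1-3) Suc.prems
    by (intro abelian_monoid.finsum_lessThan_Suc[OF L_monoid] frc_closed) auto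
  also have "\<dots> = frc A B (f n \<oplus>\<^bsub>Hom C A B\<^esub> (\<Oplus>\<^bsub>Hom C A B\<^esub>i\<in>{..<n}. f i)) s"
    using assms(1-3) Suc fraction_module.mfr_add[OF Hom_fraction_module] by simp
  also have "f n \<oplus>\<^bsub>Hom C A B\<^esub> (\<Oplus>\<^bsub>Hom C A B\<^esub>i\<in>{..<n}. f i) = (\<Oplus>\<^bsub>Hom C A B\<^esub>i\<in>{..<Suc n}. f i)"
    using assms(1-3) Suc.prems by (intro abelian_monoid.finsum_lessThan_Suc[OF Hom_monoid, symmetric]) auto
  finally show ?case .
qed

abbreviation "H \<equiv> sum_hull L"

lemma H_simps:
  "Obj H = {Xs. set Xs \<subseteq> Obj C}"
  "carrier (Hom H Xs Ys) = {M \<in> carrier_mat (length Ys) (length Xs).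
      \<forall>i<length Ys. \<forall>j<length Xs. M $$ (i, j) \<in> carrier (Hom L (Xs ! j) (Ys ! i))}"
  "\<zero>\<^bsub>Hom H Xs Ys\<^esub> = mat (length Ys) (length Xs) (\<lambda>(i, j). \<zero>\<^bsub>Hom L (Xs ! j) (Ys ! i)\<^esub>)"
  "c \<odot>\<^bsub>Hom H Xs Ys\<^esub> M = mat (length Ys) (length Xs) (\<lambda>(i, j). c \<odot>\<^bsub>Hom L (Xs ! j) (Ys ! i)\<^esub> M $$ (i, j))"
  "Comp H Xs Ys Zs N M = mat (length Zs) (length Xs)
      (\<lambda>(i, j). \<Oplus>\<^bsub>Hom L (Xs ! j) (Zs ! i)\<^esub>k\<in>{..<length Ys}.
         Comp L (Xs ! j) (Ys ! k) (Zs ! i) (N $$ (i, k)) (M $$ (k, j)))"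
  "Ident H Xs = mat (length Xs) (length Xs)
      (\<lambda>(i, j). if i = j then Ident L (Xs ! i) else \<zero>\<^bsub>Hom L (Xs ! j) (Xs ! i)\<^esub>)"
  by (simp_all add: sum_hull_def)

text \<open>The morphism \<open>f/s\<close> between the formal direct sums \<open>Xs\<close> and \<open>Ys\<close>, for \<open>f\<close> between the chosen direct
  sums of these lists in \<open>C\<close>.\<close>

definition lmor :: "'o list \<Rightarrow> 'o list \<Rightarrow> 'm \<Rightarrow> 'r \<Rightarrow> ('r, 'm) lmor" where
  "lmor Xs Ys f s = mat (length Ys) (length Xs) (\<lambda>(i, j). frc (Xs ! j) (Ys ! i) (entry Xs Ys f i j) s)"

lemma lmor_closed [simp]:
  "\<lbrakk>set Xs \<subseteq> Obj C; set Ys \<subseteq> Obj C; f \<in> carrier (Hom C (D Xs) (D Ys)); s \<in> S\<rbrakk>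
    \<Longrightarrow> lmor Xs Ys f s \<in> carrier (Hom H Xs Ys)"
  unfolding H_simps lmor_def using frc_closed by (simp del: L_simps)

text \<open>Bring the finitely many entries to a common denominator; by \<open>entry_surj\<close>
  their numerators are then the entries of one morphism in the category.\<close>

lemma lmor_cases:
  assumes Xs: "set Xs \<subseteq> Obj C" and Ys: "set Ys \<subseteq> Obj C" and M: "M \<in> carrier (Hom H Xs Ys)"
  obtains f s where "f \<in> carrier (Hom C (D Xs) (D Ys))" "s \<in> S" "M = lmor Xs Ys f s"
proof -
  let ?I = "{..<length Ys} \<times> {..<length Xs}"
  have MH: "M $$ (i, j) \<in> carrier (Hom L (Xs ! j) (Ys ! i))" if "i < length Ys" "j < length Xs" for i j
    using M that unfolding H_simps by blast
  have dim: "M \<in> carrier_mat (length Ys) (length Xs)" using M unfolding H_simps by blast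
  have "\<exists>s\<in>S. \<forall>k\<in>?I. \<exists>m\<in>carrier (Hom C (Xs ! snd k) (Ys ! fst k)). M $$ k = frc (Xs ! snd k) (Ys ! fst k) m s"
  proof (rule common_multiple)
    fix k assume "k \<in> ?I"
    then obtain i j where k: "k = (i, j)" "i < length Ys" "j < length Xs" by auto
    have fm: "fraction_module R S (Hom C (Xs ! j) (Ys ! i))" using Xs Ys k by (intro Hom_fraction_module) auto
    show "\<exists>s\<in>S. \<exists>m\<in>carrier (Hom C (Xs ! snd k) (Ys ! fst k)). M $$ k = frc (Xs ! snd k) (Ys ! fst k) m s"
    proof -
      obtain m s where "m \<in> carrier (Hom C (Xs ! j) (Ys ! i))" "s \<in> S" "M $$ (i, j) = frc (Xs ! j) (Ys ! i) m s"
        using fraction_module.T_cases[OF fm, of "M $$ (i, j)"] MH[OF k(2,3)] by auto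
      then show ?thesis using k by auto
    qed
  next
    fix k s t assume k: "k \<in> ?I" and st: "s \<in> S" "t \<in> S"
      and "\<exists>m\<in>carrier (Hom C (Xs ! snd k) (Ys ! fst k)). M $$ k = frc (Xs ! snd k) (Ys ! fst k) m s"
    then obtain m where m: "m \<in> carrier (Hom C (Xs ! snd k) (Ys ! fst k))" "M $$ k = frc (Xs ! snd k) (Ys ! fst k) m s"
      by auto
    have ob: "Xs ! snd k \<in> Obj C" "Ys ! fst k \<in> Obj C" using Xs Ys k by auto
    have "M $$ k = frc (Xs ! snd k) (Ys ! fst k) (t \<odot>\<^bsub>Hom C (Xs ! snd k) (Ys ! fst k)\<^esub> m) (t \<otimes> s)"
      unfolding m(2) using fraction_module.mfr_cancel[OF Hom_fraction_module[OF ob] m(1) st] st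
      by (simp add: m_comm)
    then show "\<exists>m\<in>carrier (Hom C (Xs ! snd k) (Ys ! fst k)). M $$ k = frc (Xs ! snd k) (Ys ! fst k) m (t \<otimes> s)"
      using smult_closed'[OF ob S_closed[OF st(2)] m(1)] by blast
  qed simp
  then obtain s m where s: "s \<in> S" and m: "\<And>k. k \<in> ?I \<Longrightarrow> m k \<in> carrier (Hom C (Xs ! snd k) (Ys ! fst k))"
    "\<And>k. k \<in> ?I \<Longrightarrow> M $$ k = frc (Xs ! snd k) (Ys ! fst k) (m k) s"
    by metis
  obtain f where f: "f \<in> carrier (Hom C (D Xs) (D Ys))"
    "\<And>i j. i < length Ys \<Longrightarrow> j < length Xs \<Longrightarrow> entry Xs Ys f i j = m (i, j)"
    using entry_surj[OF Xs Ys, of "\<lambda>i j. m (i, j)"] m(1) by force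
  have "M = lmor Xs Ys f s"
    using dim f(2) m(2) by (intro eq_matI) (auto simp: lmor_def)
  then show ?thesis using that f(1) s by blast
qed

text \<open>Equality of each entry comes with its own annihilator. A common multiple works for all
  entries, and \<open>entry_ext\<close> turns the entrywise equations into one equation of
  morphisms.\<close>

lemma lmor_eq_iff:
  assumes Xs: "set Xs \<subseteq> Obj C" and Ys: "set Ys \<subseteq> Obj C"
    and f: "f \<in> carrier (Hom C (D Xs) (D Ys))" "s \<in> S" and g: "g \<in> carrier (Hom C (D Xs) (D Ys))" "t \<in> S"
  shows "lmor Xs Ys f s = lmor Xs Ys g t \<longleftrightarrow>
    (\<exists>u\<in>S. u \<odot>\<^bsub>Hom C (D Xs) (D Ys)\<^esub> (t \<odot>\<^bsub>Hom C (D Xs) (D Ys)\<^esub> f) = u \<odot>\<^bsub>Hom C (D Xs) (D Ys)\<^esub> (s \<odot>\<^bsub>Hom C (D Xs) (D Ys)\<^esub> g))"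
    (is "?lhs \<longleftrightarrow> (\<exists>u\<in>S. ?K u)")
proof -
  let ?E = "\<lambda>u i j. u \<odot>\<^bsub>Hom C (Xs ! j) (Ys ! i)\<^esub> (t \<odot>\<^bsub>Hom C (Xs ! j) (Ys ! i)\<^esub> entry Xs Ys f i j) =
      u \<odot>\<^bsub>Hom C (Xs ! j) (Ys ! i)\<^esub> (s \<odot>\<^bsub>Hom C (Xs ! j) (Ys ! i)\<^esub> entry Xs Ys g i j)"
  have entries: "?lhs \<longleftrightarrow> (\<forall>i<length Ys. \<forall>j<length Xs. \<exists>u\<in>S. ?E u i j)"
  proof -
    have "?lhs \<longleftrightarrow> (\<forall>i<length Ys. \<forall>j<length Xs. frc (Xs ! j) (Ys ! i) (entry Xs Ys f i j) s = frc (Xs ! j) (Ys ! i) (entry Xs Ys g i j) t)"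
      unfolding lmor_def by (auto simp: mat_eq_iff)
    then show ?thesis
      using Xs Ys f g fraction_module.mfr_eq_iff[OF Hom_fraction_module] by simp
  qed
  show ?thesis
  proof
    assume ?lhs
    then have ex: "\<exists>u\<in>S. ?E u i j" if "i < length Ys" "j < length Xs" for i j
      using that unfolding entries by (elim allE impE)
    have "\<exists>u\<in>S. \<forall>k\<in>{..<length Ys} \<times> {..<length Xs}. ?E u (fst k) (snd k)"
    proof (rule common_multiple)
      fix k assume "k \<in> {..<length Ys} \<times> {..<length Xs}"
      then show "\<exists>u\<in>S. ?E u (fst k) (snd k)" by (intro ex) auto
    next
      fix k u v assume k: "k \<in> {..<length Ys} \<times> {..<length Xs}" and uv: "u \<in> S" "v \<in> S" and E: "?E u (fst k) (snd k)"
      have ob: "Xs ! snd k \<in> Obj C" "Ys ! fst k \<in> Obj C" using Xs Ys k by auto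
      have "?E (v \<otimes> u) (fst k) (snd k) \<longleftrightarrow>
          v \<odot>\<^bsub>Hom C (Xs ! snd k) (Ys ! fst k)\<^esub> (u \<odot>\<^bsub>Hom C (Xs ! snd k) (Ys ! fst k)\<^esub> (t \<odot>\<^bsub>Hom C (Xs ! snd k) (Ys ! fst k)\<^esub> entry Xs Ys f (fst k) (snd k))) =
          v \<odot>\<^bsub>Hom C (Xs ! snd k) (Ys ! fst k)\<^esub> (u \<odot>\<^bsub>Hom C (Xs ! snd k) (Ys ! fst k)\<^esub> (s \<odot>\<^bsub>Hom C (Xs ! snd k) (Ys ! fst k)\<^esub> entry Xs Ys g (fst k) (snd k)))"
        using ob Xs Ys f g uv k by (auto simp: smult_smult m_assoc)
      then show "?E (v \<otimes> u) (fst k) (snd k)" using E by simp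
    qed simp
    then obtain u where u0: "u \<in> S" "\<forall>k\<in>{..<length Ys} \<times> {..<length Xs}. ?E u (fst k) (snd k)" by (elim bexE)
    have u: "u \<in> S" "?E u i j" if "i < length Ys" "j < length Xs" for i j
      using u0(1) bspec[OF u0(2), of "(i, j)"] that by simp_all
    have "?K u"
    proof (rule entry_ext[OF Xs Ys])
      fix i j assume ij: "i < length Ys" "j < length Xs"
      show "entry Xs Ys (u \<odot>\<^bsub>Hom C (D Xs) (D Ys)\<^esub> (t \<odot>\<^bsub>Hom C (D Xs) (D Ys)\<^esub> f)) i j =
          entry Xs Ys (u \<odot>\<^bsub>Hom C (D Xs) (D Ys)\<^esub> (s \<odot>\<^bsub>Hom C (D Xs) (D Ys)\<^esub> g)) i j"
        using Xs Ys f g u0(1) ij by (simp add: entry_smult u(2)[OF ij])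
    qed (use Xs Ys f g u0(1) in simp_all)
    then show "\<exists>u\<in>S. ?K u" using u0(1) by blast
  next
    assume "\<exists>u\<in>S. ?K u"
    then obtain u where u: "u \<in> S" "?K u" by auto
    have "?E u i j" if "i < length Ys" "j < length Xs" for i j
      using arg_cong[OF u(2), of "\<lambda>h. entry Xs Ys h i j"] Xs Ys f g u(1) that by (simp add: entry_smult)
    then show ?lhs unfolding entries using u(1) by blast
  qed
qed

lemma lmor_Comp:
  assumes "set Xs \<subseteq> Obj C" "set Ys \<subseteq> Obj C" "set Zs \<subseteq> Obj C"
    "f \<in> carrier (Hom C (D Xs) (D Ys))" "g \<in> carrier (Hom C (D Ys) (D Zs))" "s \<in> S" "t \<in> S"
  shows "Comp H Xs Ys Zs (lmor Ys Zs g t) (lmor Xs Ys f s) = lmor Xs Zs (Comp C (D Xs) (D Ys) (D Zs) g f) (t \<otimes> s)"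
proof -
  have "(\<Oplus>\<^bsub>Hom L (Xs ! j) (Zs ! i)\<^esub>k\<in>{..<length Ys}.
      Comp L (Xs ! j) (Ys ! k) (Zs ! i) (lmor Ys Zs g t $$ (i, k)) (lmor Xs Ys f s $$ (k, j)))
    = frc (Xs ! j) (Zs ! i) (entry Xs Zs (Comp C (D Xs) (D Ys) (D Zs) g f) i j) (t \<otimes> s)"
    if ij: "i < length Zs" "j < length Xs" for i j
  proof -
    have ob: "Xs ! j \<in> Obj C" "Zs ! i \<in> Obj C" using assms ij by auto
    have "(\<Oplus>\<^bsub>Hom L (Xs ! j) (Zs ! i)\<^esub>k\<in>{..<length Ys}.
        Comp L (Xs ! j) (Ys ! k) (Zs ! i) (lmor Ys Zs g t $$ (i, k)) (lmor Xs Ys f s $$ (k, j)))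
      = (\<Oplus>\<^bsub>Hom L (Xs ! j) (Zs ! i)\<^esub>k\<in>{..<length Ys}.
          frc (Xs ! j) (Zs ! i) (Comp C (Xs ! j) (Ys ! k) (Zs ! i) (entry Ys Zs g i k) (entry Xs Ys f k j)) (t \<otimes> s))"
      using assms ij ob S_mult
      by (intro abelian_monoid.finsum_cong'[OF L_monoid] refl Pi_I frc_closed) (auto simp: lmor_def frc_Comp simp del: L_simps)
    also have "\<dots> = frc (Xs ! j) (Zs ! i) (entry Xs Zs (Comp C (D Xs) (D Ys) (D Zs) g f) i j) (t \<otimes> s)"
      using assms ij ob S_mult by (subst frc_finsum) (simp_all add: entry_Comp)
    finally show ?thesis .
  qed
  then show ?thesis
    unfolding H_simps lmor_def[of Xs Zs] by (intro cong_mat) auto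
qed

lemma lmor_zero:
  assumes "set Xs \<subseteq> Obj C" "set Ys \<subseteq> Obj C"
  shows "\<zero>\<^bsub>Hom H Xs Ys\<^esub> = lmor Xs Ys \<zero>\<^bsub>Hom C (D Xs) (D Ys)\<^esub> \<one>"
  unfolding H_simps lmor_def
  using assms fraction_module.mfr_zero[OF Hom_fraction_module] one_in_S
  by (intro cong_mat) (auto simp: entry_zero)

lemma lmor_smult:
  assumes "set Xs \<subseteq> Obj C" "set Ys \<subseteq> Obj C" "f \<in> carrier (Hom C (D Xs) (D Ys))" "s \<in> S" "r \<in> carrier R"
  shows "fr r \<one> \<odot>\<^bsub>Hom H Xs Ys\<^esub> lmor Xs Ys f s = lmor Xs Ys (r \<odot>\<^bsub>Hom C (D Xs) (D Ys)\<^esub> f) s"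
  unfolding H_simps lmor_def
  using assms fraction_module.mfr_smult[OF Hom_fraction_module]
  by (intro cong_mat) (auto simp: entry_smult)

lemma lmor_eqI:
  assumes "set Xs \<subseteq> Obj C" "set Ys \<subseteq> Obj C"
    "f \<in> carrier (Hom C (D Xs) (D Ys))" "s \<in> S" "g \<in> carrier (Hom C (D Xs) (D Ys))" "t \<in> S"
    "t \<odot>\<^bsub>Hom C (D Xs) (D Ys)\<^esub> f = s \<odot>\<^bsub>Hom C (D Xs) (D Ys)\<^esub> g"
  shows "lmor Xs Ys f s = lmor Xs Ys g t"
  using assms one_in_S by (subst lmor_eq_iff) auto

abbreviation "LC \<equiv> loc_cat R S C"

lemma LC_simps:
  "(Xs, e) \<in> Obj LC \<longleftrightarrow> set Xs \<subseteq> Obj C \<and> e \<in> carrier (Hom H Xs Xs) \<and> Comp H Xs Xs Xs e e = e"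
  "carrier (Hom LC (Xs, e) (Ys, e')) = {g \<in> carrier (Hom H Xs Ys). Comp H Xs Ys Ys e' g = g \<and> Comp H Xs Xs Ys g e = g}"
  "Comp LC (Xs, e) (Ys, e') (Zs, e'') = Comp H Xs Ys Zs"
  "Ident LC (Xs, e) = e"
  "\<zero>\<^bsub>Hom LC (Xs, e) (Ys, e')\<^esub> = \<zero>\<^bsub>Hom H Xs Ys\<^esub>"
  "c \<odot>\<^bsub>Hom LC (Xs, e) (Ys, e')\<^esub> M = c \<odot>\<^bsub>Hom H Xs Ys\<^esub> M"
proof -
  have "Obj H = {Xs. set Xs \<subseteq> Obj C}" by (rule H_simps(1))
  then show "(Xs, e) \<in> Obj LC \<longleftrightarrow> set Xs \<subseteq> Obj C \<and> e \<in> carrier (Hom H Xs Xs) \<and> Comp H Xs Xs Xs e e = e"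
    by (simp add: loc_cat_def add_hull_def idem_hull_def)
qed (simp_all add: loc_cat_def add_hull_def idem_hull_def)

lemma loc_obj_eq:
  assumes "A \<in> Obj C"
  shows "loc_obj R S C A = ([A], lmor [A] [A] (Ident C A) \<one>)"
  unfolding loc_obj_def hull_obj_def lmor_def using assms
  by (simp, intro cong_mat) auto

lemma loc_mor_eq:
  assumes "A \<in> Obj C" "B \<in> Obj C" "f \<in> carrier (Hom C A B)"
  shows "loc_mor R S C A B f = lmor [A] [B] f \<one>"
  unfolding loc_mor_def hull_mor_def lmor_def using assms
  by (intro cong_mat) (auto simp: mfrac_def one_F)

lemma lmor_obj:
  assumes "set Xs \<subseteq> Obj C" "\<epsilon> \<in> carrier (Hom C (D Xs) (D Xs))" "s \<in> S"
    "Comp C (D Xs) (D Xs) (D Xs) \<epsilon> \<epsilon> = s \<odot>\<^bsub>Hom C (D Xs) (D Xs)\<^esub> \<epsilon>"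
  shows "(Xs, lmor Xs Xs \<epsilon> s) \<in> Obj LC"
proof -
  have "lmor Xs Xs (Comp C (D Xs) (D Xs) (D Xs) \<epsilon> \<epsilon>) (s \<otimes> s) = lmor Xs Xs \<epsilon> s"
    using assms S_mult by (intro lmor_eqI) (simp_all add: smult_smult)
  then show ?thesis using assms by (simp add: LC_simps lmor_Comp)
qed

text \<open>An idempotent fraction \<delta>/t satisfies its relation in the category only up to some
  u. Expanding the fraction by u t makes the relation exact, with numerator u t \<delta> and
  denominator u t t.\<close>

lemma LC_obj_cases:
  assumes "(Xs, E) \<in> Obj LC"
  obtains \<epsilon> s where "set Xs \<subseteq> Obj C" "\<epsilon> \<in> carrier (Hom C (D Xs) (D Xs))" "s \<in> S" "E = lmor Xs Xs \<epsilon> s"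
    "Comp C (D Xs) (D Xs) (D Xs) \<epsilon> \<epsilon> = s \<odot>\<^bsub>Hom C (D Xs) (D Xs)\<^esub> \<epsilon>"
proof -
  have Xs: "set Xs \<subseteq> Obj C" and E: "E \<in> carrier (Hom H Xs Xs)" "Comp H Xs Xs Xs E E = E"
    using assms by (auto simp: LC_simps)
  obtain \<delta> t where d: "\<delta> \<in> carrier (Hom C (D Xs) (D Xs))" "t \<in> S" "E = lmor Xs Xs \<delta> t"
    using lmor_cases[OF Xs Xs E(1)] by blast
  let ?X = "D Xs"
  have X: "?X \<in> Obj C" using Xs by simp
  have "lmor Xs Xs (Comp C ?X ?X ?X \<delta> \<delta>) (t \<otimes> t) = lmor Xs Xs \<delta> t"
    using E(2) d Xs by (simp add: lmor_Comp)
  then obtain u where u: "u \<in> S" "u \<odot>\<^bsub>Hom C ?X ?X\<^esub> (t \<odot>\<^bsub>Hom C ?X ?X\<^esub> Comp C ?X ?X ?X \<delta> \<delta>) = u \<odot>\<^bsub>Hom C ?X ?X\<^esub> ((t \<otimes> t) \<odot>\<^bsub>Hom C ?X ?X\<^esub> \<delta>)"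
    using d Xs S_mult by (subst (asm) lmor_eq_iff) auto
  let ?v = "u \<otimes> t"
  have v: "?v \<in> S" using u d S_mult by auto
  show ?thesis
  proof (rule that[OF Xs])
    show "?v \<odot>\<^bsub>Hom C ?X ?X\<^esub> \<delta> \<in> carrier (Hom C ?X ?X)" using X d v by simp
    show "?v \<otimes> t \<in> S" using v d S_mult by auto
    show "E = lmor Xs Xs (?v \<odot>\<^bsub>Hom C ?X ?X\<^esub> \<delta>) (?v \<otimes> t)"
      unfolding d(3) using Xs X d u v S_mult by (intro lmor_eqI) (simp_all add: smult_smult m_ac)
    have "Comp C ?X ?X ?X (?v \<odot>\<^bsub>Hom C ?X ?X\<^esub> \<delta>) (?v \<odot>\<^bsub>Hom C ?X ?X\<^esub> \<delta>)
        = ?v \<odot>\<^bsub>Hom C ?X ?X\<^esub> (u \<odot>\<^bsub>Hom C ?X ?X\<^esub> (t \<odot>\<^bsub>Hom C ?X ?X\<^esub> Comp C ?X ?X ?X \<delta> \<delta>))"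
      using X d u(1) by (simp add: Comp_lin smult_smult m_ac)
    also have "\<dots> = (?v \<otimes> t) \<odot>\<^bsub>Hom C ?X ?X\<^esub> (?v \<odot>\<^bsub>Hom C ?X ?X\<^esub> \<delta>)"
      unfolding u(2) using X d u(1) by (simp add: smult_smult m_ac)
    finally show "Comp C ?X ?X ?X (?v \<odot>\<^bsub>Hom C ?X ?X\<^esub> \<delta>) (?v \<odot>\<^bsub>Hom C ?X ?X\<^esub> \<delta>) = (?v \<otimes> t) \<odot>\<^bsub>Hom C ?X ?X\<^esub> (?v \<odot>\<^bsub>Hom C ?X ?X\<^esub> \<delta>)" .
  qed
qed

end

section \<open>Isomorphisms and torsion in the localised category\<close>

context localisation
begin

text \<open>The inverse isomorphisms are p/1 and i/u: i p = u gives the identity in one order, and s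
  p i = u \<epsilon> gives \<epsilon>/s in the other.\<close>

lemma isomorphic_if_loc_retract:
  assumes Xs: "set Xs \<subseteq> Obj C" and \<epsilon>: "\<epsilon> \<in> carrier (Hom C (D Xs) (D Xs))" and s: "s \<in> S"
    and idem: "Comp C (D Xs) (D Xs) (D Xs) \<epsilon> \<epsilon> = s \<odot>\<^bsub>Hom C (D Xs) (D Xs)\<^esub> \<epsilon>"
    and ret: "loc_retract R S C A (D Xs) \<epsilon> s"
  shows "isomorphic LC (loc_obj R S C A) (Xs, lmor Xs Xs \<epsilon> s)"
proof -
  let ?X = "D Xs"
  obtain p i u where d: "A \<in> Obj C" "?X \<in> Obj C" "p \<in> carrier (Hom C A ?X)" "i \<in> carrier (Hom C ?X A)" "u \<in> S"
      "Comp C A ?X A i p = u \<odot>\<^bsub>Hom C A A\<^esub> Ident C A"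
      "s \<odot>\<^bsub>Hom C ?X ?X\<^esub> Comp C ?X A ?X p i = u \<odot>\<^bsub>Hom C ?X ?X\<^esub> \<epsilon>"
      "Comp C A ?X ?X \<epsilon> p = s \<odot>\<^bsub>Hom C A ?X\<^esub> p" "Comp C ?X ?X A i \<epsilon> = s \<odot>\<^bsub>Hom C ?X A\<^esub> i"
    using ret unfolding loc_retract_def by blast
  have AO: "set [A] \<subseteq> Obj C" using d(1) by simp
  let ?A = "lmor [A] [A] (Ident C A) \<one>" and ?E = "lmor Xs Xs \<epsilon> s"
  let ?f = "lmor [A] Xs p \<one>" and ?g = "lmor Xs [A] i u"
  have one: "\<one> \<in> S" by (rule one_in_S)
  have oA: "([A], ?A) \<in> Obj LC" using lmor_obj[OF AO, of "Ident C A" \<one>] d(1) one by simp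
  have oE: "(Xs, ?E) \<in> Obj LC" by (rule lmor_obj[OF Xs \<epsilon> s idem])
  have "Comp H [A] Xs Xs ?E ?f = ?f" "Comp H Xs Xs [A] ?g ?E = ?g"
    "Comp H [A] [A] Xs ?f ?A = ?f" "Comp H Xs [A] [A] ?A ?g = ?g"
    "Comp H [A] Xs [A] ?g ?f = ?A" "Comp H Xs [A] Xs ?f ?g = ?E"
    using Xs AO d one \<epsilon> s S_mult
    by (auto simp: lmor_Comp smult_smult m_comm intro!: lmor_eqI)
  then show ?thesis
    unfolding isomorphic_def loc_obj_eq[OF d(1)] LC_simps
    using oA oE Xs AO d(1-5) one unfolding LC_simps by (intro conjI bexI[of _ ?f] bexI[of _ ?g]) auto
qed

text \<open>Write the isomorphism and its inverse as \<phi>/t and \<gamma>/v. Their two composites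
  and their compatibility with \<epsilon>/s are four equations of fractions, each holding in the
  category after multiplication by one of \<open>u1\<close> to \<open>u4\<close>.\<close>

lemma loc_retract_if_isomorphic:
  assumes Xs: "set Xs \<subseteq> Obj C" and \<epsilon>: "\<epsilon> \<in> carrier (Hom C (D Xs) (D Xs))" and s: "s \<in> S"
    and B: "B \<in> Obj C" and iso: "isomorphic LC (Xs, lmor Xs Xs \<epsilon> s) (loc_obj R S C B)"
  shows "loc_retract R S C B (D Xs) \<epsilon> s"
proof -
  let ?X = "D Xs"
  have X: "?X \<in> Obj C" using Xs by simp
  have BO: "set [B] \<subseteq> Obj C" using B by simp
  let ?B = "lmor [B] [B] (Ident C B) \<one>" and ?E = "lmor Xs Xs \<epsilon> s"
  have one: "\<one> \<in> S" by (rule one_in_S)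
  obtain f g where fg: "f \<in> carrier (Hom H Xs [B])" "Comp H Xs Xs [B] f ?E = f"
      "g \<in> carrier (Hom H [B] Xs)" "Comp H [B] Xs Xs ?E g = g"
      "Comp H Xs [B] Xs g f = ?E" "Comp H [B] Xs [B] f g = ?B"
    using iso unfolding isomorphic_def loc_obj_eq[OF B] LC_simps by blast
  obtain \<phi> t where \<phi>: "\<phi> \<in> carrier (Hom C ?X B)" "t \<in> S" "f = lmor Xs [B] \<phi> t"
    using lmor_cases[OF Xs BO fg(1)] B by auto
  obtain \<gamma> v where \<gamma>: "\<gamma> \<in> carrier (Hom C B ?X)" "v \<in> S" "g = lmor [B] Xs \<gamma> v"
    using lmor_cases[OF BO Xs fg(3)] B by auto
  note cl = Xs BO B X \<epsilon> s \<phi>(1,2) \<gamma>(1,2) one S_mult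
  have "lmor Xs [B] (Comp C ?X ?X B \<phi> \<epsilon>) (t \<otimes> s) = lmor Xs [B] \<phi> t"
    using fg(2) cl unfolding \<phi>(3) by (simp add: lmor_Comp)
  then obtain u1 where u1: "u1 \<in> S"
      "u1 \<odot>\<^bsub>Hom C ?X B\<^esub> (t \<odot>\<^bsub>Hom C ?X B\<^esub> Comp C ?X ?X B \<phi> \<epsilon>) = u1 \<odot>\<^bsub>Hom C ?X B\<^esub> ((t \<otimes> s) \<odot>\<^bsub>Hom C ?X B\<^esub> \<phi>)"
    using cl by (subst (asm) lmor_eq_iff) auto
  have "lmor [B] Xs (Comp C B ?X ?X \<epsilon> \<gamma>) (s \<otimes> v) = lmor [B] Xs \<gamma> v"
    using fg(4) cl unfolding \<gamma>(3) by (simp add: lmor_Comp)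
  then obtain u2 where u2: "u2 \<in> S"
      "u2 \<odot>\<^bsub>Hom C B ?X\<^esub> (v \<odot>\<^bsub>Hom C B ?X\<^esub> Comp C B ?X ?X \<epsilon> \<gamma>) = u2 \<odot>\<^bsub>Hom C B ?X\<^esub> ((s \<otimes> v) \<odot>\<^bsub>Hom C B ?X\<^esub> \<gamma>)"
    using cl by (subst (asm) lmor_eq_iff) auto
  have "lmor Xs Xs (Comp C ?X B ?X \<gamma> \<phi>) (v \<otimes> t) = lmor Xs Xs \<epsilon> s"
    using fg(5) cl unfolding \<phi>(3) \<gamma>(3) by (simp add: lmor_Comp)
  then obtain u3 where u3: "u3 \<in> S"
      "u3 \<odot>\<^bsub>Hom C ?X ?X\<^esub> (s \<odot>\<^bsub>Hom C ?X ?X\<^esub> Comp C ?X B ?X \<gamma> \<phi>) = u3 \<odot>\<^bsub>Hom C ?X ?X\<^esub> ((v \<otimes> t) \<odot>\<^bsub>Hom C ?X ?X\<^esub> \<epsilon>)"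
    using cl by (subst (asm) lmor_eq_iff) auto
  have "lmor [B] [B] (Comp C B ?X B \<phi> \<gamma>) (t \<otimes> v) = lmor [B] [B] (Ident C B) \<one>"
    using fg(6) cl unfolding \<phi>(3) \<gamma>(3) by (simp add: lmor_Comp)
  then obtain u4 where u4: "u4 \<in> S"
      "u4 \<odot>\<^bsub>Hom C B B\<^esub> (\<one> \<odot>\<^bsub>Hom C B B\<^esub> Comp C B ?X B \<phi> \<gamma>) = u4 \<odot>\<^bsub>Hom C B B\<^esub> ((t \<otimes> v) \<odot>\<^bsub>Hom C B B\<^esub> Ident C B)"
    using cl by (subst (asm) lmor_eq_iff) auto
  note U = u1(1) u2(1) u3(1) u4(1)
  text \<open>Multiplying \<open>\<phi>\<close> and \<open>\<gamma>\<close> by all the annihilators turns the relations into exact equations.\<close>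
  define c where "c = (u1 \<otimes> t) \<otimes> ((u2 \<otimes> v) \<otimes> (u3 \<otimes> u4))"
  have cS: "c \<in> S" using U cl by (simp add: c_def)
  then have cR: "c \<in> carrier R" by simp
  have U': "u1 \<in> carrier R" "u2 \<in> carrier R" "u3 \<in> carrier R" "u4 \<in> carrier R" "t \<in> carrier R" "v \<in> carrier R" "s \<in> carrier R"
    using U cl by auto
  have e1: "Comp C ?X ?X B (c \<odot>\<^bsub>Hom C ?X B\<^esub> \<phi>) \<epsilon> = s \<odot>\<^bsub>Hom C ?X B\<^esub> (c \<odot>\<^bsub>Hom C ?X B\<^esub> \<phi>)"
  proof -
    let ?r = "(u2 \<otimes> v) \<otimes> (u3 \<otimes> u4)"
    have "Comp C ?X ?X B (c \<odot>\<^bsub>Hom C ?X B\<^esub> \<phi>) \<epsilon> = ?r \<odot>\<^bsub>Hom C ?X B\<^esub> (u1 \<odot>\<^bsub>Hom C ?X B\<^esub> (t \<odot>\<^bsub>Hom C ?X B\<^esub> Comp C ?X ?X B \<phi> \<epsilon>))"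
      using U' X B \<phi>(1) \<epsilon> unfolding c_def by (simp add: Comp_lin smult_smult m_ac)
    also have "\<dots> = s \<odot>\<^bsub>Hom C ?X B\<^esub> (c \<odot>\<^bsub>Hom C ?X B\<^esub> \<phi>)"
      unfolding u1(2) c_def using U' X B \<phi>(1) by (simp add: smult_smult m_ac)
    finally show ?thesis .
  qed
  have e2: "Comp C B ?X ?X \<epsilon> (c \<odot>\<^bsub>Hom C B ?X\<^esub> \<gamma>) = s \<odot>\<^bsub>Hom C B ?X\<^esub> (c \<odot>\<^bsub>Hom C B ?X\<^esub> \<gamma>)"
  proof -
    let ?r = "(u1 \<otimes> t) \<otimes> (u3 \<otimes> u4)"
    have "Comp C B ?X ?X \<epsilon> (c \<odot>\<^bsub>Hom C B ?X\<^esub> \<gamma>) = ?r \<odot>\<^bsub>Hom C B ?X\<^esub> (u2 \<odot>\<^bsub>Hom C B ?X\<^esub> (v \<odot>\<^bsub>Hom C B ?X\<^esub> Comp C B ?X ?X \<epsilon> \<gamma>))"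
      using U' X B \<gamma>(1) \<epsilon> unfolding c_def by (simp add: Comp_lin smult_smult m_ac)
    also have "\<dots> = s \<odot>\<^bsub>Hom C B ?X\<^esub> (c \<odot>\<^bsub>Hom C B ?X\<^esub> \<gamma>)"
      unfolding u2(2) c_def using U' X B \<gamma>(1) by (simp add: smult_smult m_ac)
    finally show ?thesis .
  qed
  \<comment> \<open>Both scaled morphisms contribute a factor c, and t v comes from their
    denominators. The factors t and v inside c itself cannot be avoided by cancelling them in the
    compatibility relations, as Hom may have torsion.\<close>
  let ?a = "c \<otimes> c \<otimes> (t \<otimes> v)"
  have e3: "s \<odot>\<^bsub>Hom C ?X ?X\<^esub> Comp C ?X B ?X (c \<odot>\<^bsub>Hom C B ?X\<^esub> \<gamma>) (c \<odot>\<^bsub>Hom C ?X B\<^esub> \<phi>) = ?a \<odot>\<^bsub>Hom C ?X ?X\<^esub> \<epsilon>"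
  proof -
    let ?r = "c \<otimes> ((u1 \<otimes> t) \<otimes> ((u2 \<otimes> v) \<otimes> u4))"
    have c: "c = ((u1 \<otimes> t) \<otimes> ((u2 \<otimes> v) \<otimes> u4)) \<otimes> u3" using U' by (simp add: c_def m_ac)
    have cc: "c \<otimes> c = ?r \<otimes> u3" using U' cR by (subst (2) c) (simp add: m_ac)
    have "s \<odot>\<^bsub>Hom C ?X ?X\<^esub> Comp C ?X B ?X (c \<odot>\<^bsub>Hom C B ?X\<^esub> \<gamma>) (c \<odot>\<^bsub>Hom C ?X B\<^esub> \<phi>)
        = (s \<otimes> (c \<otimes> c)) \<odot>\<^bsub>Hom C ?X ?X\<^esub> Comp C ?X B ?X \<gamma> \<phi>"
      using U' X B \<gamma>(1) \<phi>(1) cR by (simp add: Comp_lin smult_smult m_ac)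
    also have "\<dots> = ?r \<odot>\<^bsub>Hom C ?X ?X\<^esub> (u3 \<odot>\<^bsub>Hom C ?X ?X\<^esub> (s \<odot>\<^bsub>Hom C ?X ?X\<^esub> Comp C ?X B ?X \<gamma> \<phi>))"
      unfolding cc using U' X B \<gamma>(1) \<phi>(1) cR by (simp add: smult_smult m_ac)
    also have "\<dots> = ?a \<odot>\<^bsub>Hom C ?X ?X\<^esub> \<epsilon>"
      unfolding u3(2) cc using U' X \<epsilon> cR by (simp add: smult_smult m_ac)
    finally show ?thesis .
  qed
  have e4: "Comp C B ?X B (c \<odot>\<^bsub>Hom C ?X B\<^esub> \<phi>) (c \<odot>\<^bsub>Hom C B ?X\<^esub> \<gamma>) = ?a \<odot>\<^bsub>Hom C B B\<^esub> Ident C B"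
  proof -
    let ?r = "c \<otimes> ((u1 \<otimes> t) \<otimes> ((u2 \<otimes> v) \<otimes> u3))"
    have c: "c = ((u1 \<otimes> t) \<otimes> ((u2 \<otimes> v) \<otimes> u3)) \<otimes> u4" using U' by (simp add: c_def m_ac)
    have cc: "c \<otimes> c = ?r \<otimes> u4" using U' cR by (subst (2) c) (simp add: m_ac)
    have "Comp C B ?X B (c \<odot>\<^bsub>Hom C ?X B\<^esub> \<phi>) (c \<odot>\<^bsub>Hom C B ?X\<^esub> \<gamma>) = (c \<otimes> c) \<odot>\<^bsub>Hom C B B\<^esub> Comp C B ?X B \<phi> \<gamma>"
      using U' X B \<gamma>(1) \<phi>(1) cR by (simp add: Comp_lin smult_smult)
    also have "\<dots> = ?r \<odot>\<^bsub>Hom C B B\<^esub> (u4 \<odot>\<^bsub>Hom C B B\<^esub> (\<one> \<odot>\<^bsub>Hom C B B\<^esub> Comp C B ?X B \<phi> \<gamma>))"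
      unfolding cc using U' X B \<gamma>(1) \<phi>(1) cR by (simp add: smult_smult)
    also have "\<dots> = ?a \<odot>\<^bsub>Hom C B B\<^esub> Ident C B"
      unfolding u4(2) cc using U' X B cR by (simp add: smult_smult m_ac)
    finally show ?thesis .
  qed
  show ?thesis
    by (rule loc_retractI[OF B X _ _ _ e4 e3 e2 e1]) (use X B \<phi>(1) \<gamma>(1) cR cS \<phi>(2) \<gamma>(2) S_mult in auto)
qed

lemma isomorphic_loc_obj_iff:
  assumes "A \<in> Obj C" "B \<in> Obj C"
  shows "isomorphic LC (loc_obj R S C A) (loc_obj R S C B) \<longleftrightarrow> loc_iso R S C A B"
proof
  assume "isomorphic LC (loc_obj R S C A) (loc_obj R S C B)"
  then have "loc_retract R S C B (D [A]) (Ident C A) \<one>"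
    using assms one_in_S unfolding loc_obj_eq[OF assms(1)]
    by (intro loc_retract_if_isomorphic) auto
  then have "loc_iso R S C B A" using assms by simp
  then show "loc_iso R S C A B" by (rule loc_iso_sym[OF _ S_carrier])
next
  assume "loc_iso R S C A B"
  then show "isomorphic LC (loc_obj R S C A) (loc_obj R S C B)"
    using isomorphic_if_loc_retract[of "[B]" "Ident C B" \<one> A] assms one_in_S
    by (simp add: loc_obj_eq[OF assms(2)])
qed

lemma alt_prod_lmor:
  assumes Xs: "set Xs \<subseteq> Obj C" and \<tau>: "\<tau> \<in> carrier (Hom C (D Xs) (D Xs))"
    and b: "\<And>n. b n \<in> carrier (Hom C (D Xs) (D Xs))"
  shows "alt_prod LC (Xs, E) (Xs, E) (lmor Xs Xs \<tau> \<one>) (\<lambda>n. lmor Xs Xs (b n) \<one>) n =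
    lmor Xs Xs (alt_prod C (D Xs) (D Xs) \<tau> b n) \<one>"
  using assms one_in_S by (induction n) (simp_all add: LC_simps lmor_Comp)

text \<open>The morphism \<tau>/1 is a torsion endomorphism of the object cut out by \<epsilon>/s,
  hence essentially nilpotent there. Equality of fractions with zero then provides the scalar in
  \<open>S\<close> demanded by \<open>loc_nil\<close>.\<close>

lemma loc_nil_if_torsion_reduced:
  assumes Xs: "set Xs \<subseteq> Obj C" and \<epsilon>: "\<epsilon> \<in> carrier (Hom C (D Xs) (D Xs))" and s: "s \<in> S"
    and idem: "Comp C (D Xs) (D Xs) (D Xs) \<epsilon> \<epsilon> = s \<odot>\<^bsub>Hom C (D Xs) (D Xs)\<^esub> \<epsilon>"
    and red: "torsion_reduced F LC (Xs, lmor Xs Xs \<epsilon> s)"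
    and \<tau>: "\<tau> \<in> tors R C (D Xs) (D Xs)" "Comp C (D Xs) (D Xs) (D Xs) \<epsilon> \<tau> = s \<odot>\<^bsub>Hom C (D Xs) (D Xs)\<^esub> \<tau>"
      "Comp C (D Xs) (D Xs) (D Xs) \<tau> \<epsilon> = s \<odot>\<^bsub>Hom C (D Xs) (D Xs)\<^esub> \<tau>"
  shows "loc_nil S (D Xs) \<tau>"
  unfolding loc_nil_def
proof
  let ?X = "D Xs"
  let ?E = "lmor Xs Xs \<epsilon> s"
  fix b :: "nat \<Rightarrow> 'm" assume "b \<in> UNIV \<rightarrow> carrier (Hom C ?X ?X)"
  then have b: "b n \<in> carrier (Hom C ?X ?X)" for n by auto
  have X: "?X \<in> Obj C" using Xs by simp
  have one: "\<one> \<in> S" by (rule one_in_S)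
  obtain r where r: "r \<in> nonzeros R" "r \<odot>\<^bsub>Hom C ?X ?X\<^esub> \<tau> = \<zero>\<^bsub>Hom C ?X ?X\<^esub>" and \<tau>c: "\<tau> \<in> carrier (Hom C ?X ?X)"
    using \<tau>(1) by (auto simp: tors_def)
  \<comment> \<open>An arbitrary sequence need not consist of endomorphisms of the image of
    \<epsilon>/s, but \<epsilon> b \<epsilon> does. Since \<tau> absorbs each neighbouring
    \<epsilon> at the cost of a factor s, the product of length m changes only by s^(2m).\<close>
  define b' where "b' n = Comp C ?X ?X ?X \<epsilon> (Comp C ?X ?X ?X (b n) \<epsilon>)" for n
  have b'c: "b' n \<in> carrier (Hom C ?X ?X)" for n using X b \<epsilon> by (simp add: b'_def)
  have T: "lmor Xs Xs \<tau> \<one> \<in> carrier (Hom LC (Xs, ?E) (Xs, ?E))"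
    unfolding LC_simps using Xs X \<tau>c \<tau>(2,3) \<epsilon> s one S_mult
    by (auto simp: lmor_Comp intro!: lmor_eqI)
  have B: "lmor Xs Xs (b' n) \<one> \<in> carrier (Hom LC (Xs, ?E) (Xs, ?E))" for n
  proof -
    have "Comp C ?X ?X ?X \<epsilon> (b' n) = s \<odot>\<^bsub>Hom C ?X ?X\<^esub> b' n" "Comp C ?X ?X ?X (b' n) \<epsilon> = s \<odot>\<^bsub>Hom C ?X ?X\<^esub> b' n"
      using X b[of n] \<epsilon> s unfolding b'_def
      by (simp_all add: Comp_assoc idem Comp_lin) (simp_all add: Comp_assoc[symmetric] idem Comp_lin)
    then show ?thesis
      unfolding LC_simps using Xs X b'c[of n] \<epsilon> s one S_mult
      by (auto simp: lmor_Comp intro!: lmor_eqI)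
  qed
  have "lmor Xs Xs \<tau> \<one> \<in> tors F LC (Xs, ?E) (Xs, ?E)"
  proof -
    have "fr r \<one> \<odot>\<^bsub>Hom LC (Xs, ?E) (Xs, ?E)\<^esub> lmor Xs Xs \<tau> \<one> = \<zero>\<^bsub>Hom LC (Xs, ?E) (Xs, ?E)\<^esub>"
      unfolding LC_simps using Xs \<tau>c r one by (simp add: lmor_smult lmor_zero)
    moreover have "fr r \<one> \<noteq> \<zero>\<^bsub>F\<^esub>" using r one by (simp add: zero_F frac_eq_iff)
    ultimately show ?thesis using T r one by (auto simp: tors_def intro!: bexI[of _ "fr r \<one>"])
  qed
  then have "lmor Xs Xs \<tau> \<one> \<in> nilrad LC (Xs, ?E) (Xs, ?E)"
    using red by (auto simp: torsion_reduced_def)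
  then have all: "\<forall>b\<in>UNIV \<rightarrow> carrier (Hom LC (Xs, ?E) (Xs, ?E)). \<exists>n.
      alt_prod LC (Xs, ?E) (Xs, ?E) (lmor Xs Xs \<tau> \<one>) b n = \<zero>\<^bsub>Hom LC (Xs, ?E) (Xs, ?E)\<^esub>"
    by (simp add: nilrad_def)
  have "(\<lambda>n. lmor Xs Xs (b' n) \<one>) \<in> UNIV \<rightarrow> carrier (Hom LC (Xs, ?E) (Xs, ?E))"
    by (rule Pi_I, rule B)
  then obtain n where "alt_prod LC (Xs, ?E) (Xs, ?E) (lmor Xs Xs \<tau> \<one>) (\<lambda>n. lmor Xs Xs (b' n) \<one>) n = \<zero>\<^bsub>Hom LC (Xs, ?E) (Xs, ?E)\<^esub>"
    using bspec[OF all] by blast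
  then have "lmor Xs Xs (alt_prod C ?X ?X \<tau> b' n) \<one> = lmor Xs Xs \<zero>\<^bsub>Hom C ?X ?X\<^esub> \<one>"
    unfolding alt_prod_lmor[OF Xs \<tau>c b'c] LC_simps lmor_zero[OF Xs Xs] .
  then obtain u where u: "u \<in> S" "u \<odot>\<^bsub>Hom C ?X ?X\<^esub> alt_prod C ?X ?X \<tau> b' n = \<zero>\<^bsub>Hom C ?X ?X\<^esub>"
    using Xs X \<tau>c b'c one by (subst (asm) lmor_eq_iff) auto
  have P\<epsilon>: "Comp C ?X ?X ?X (alt_prod C ?X ?X \<tau> b m) \<epsilon> = s \<odot>\<^bsub>Hom C ?X ?X\<^esub> alt_prod C ?X ?X \<tau> b m" for m
    using X \<tau>c b \<epsilon> s \<tau>(3) by (cases m) (simp_all add: Comp_assoc[symmetric] Comp_lin)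
  have prod: "alt_prod C ?X ?X \<tau> b' m = s [^] (2 * m) \<odot>\<^bsub>Hom C ?X ?X\<^esub> alt_prod C ?X ?X \<tau> b m" for m
  proof (induction m)
    case 0
    then show ?case using X \<tau>c by simp
  next
    case (Suc m)
    let ?P = "alt_prod C ?X ?X \<tau> b m"
    have P: "?P \<in> carrier (Hom C ?X ?X)" using X \<tau>c b by simp
    have b'\<tau>: "Comp C ?X ?X ?X (b' m) \<tau> = s \<odot>\<^bsub>Hom C ?X ?X\<^esub> Comp C ?X ?X ?X \<epsilon> (Comp C ?X ?X ?X (b m) \<tau>)"
      unfolding b'_def using X \<tau>c b[of m] \<epsilon> s by (simp add: Comp_assoc[symmetric] \<tau>(2) Comp_lin)
    have "alt_prod C ?X ?X \<tau> b' (Suc m) = (s [^] (2 * m) \<otimes> s) \<odot>\<^bsub>Hom C ?X ?X\<^esub>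
        Comp C ?X ?X ?X (Comp C ?X ?X ?X ?P \<epsilon>) (Comp C ?X ?X ?X (b m) \<tau>)"
      unfolding alt_prod.simps(2) Suc b'\<tau>
      using X \<tau>c b[of m] \<epsilon> s P by (simp add: Comp_lin smult_smult m_comm) (simp add: Comp_assoc)
    also have "\<dots> = (s [^] (2 * m) \<otimes> s \<otimes> s) \<odot>\<^bsub>Hom C ?X ?X\<^esub> alt_prod C ?X ?X \<tau> b (Suc m)"
      unfolding P\<epsilon> using X \<tau>c b[of m] s P by (simp add: Comp_lin smult_smult m_assoc)
    finally show ?case using s by (simp add: m_assoc)
  qed
  have "(u \<otimes> s [^] (2 * n)) \<odot>\<^bsub>Hom C ?X ?X\<^esub> alt_prod C ?X ?X \<tau> b n = \<zero>\<^bsub>Hom C ?X ?X\<^esub>"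
    using u X \<tau>c b s unfolding prod by (simp add: smult_smult)
  moreover have "u \<otimes> s [^] (2 * n) \<in> S" using u s S_mult S_pow by auto
  ultimately show "\<exists>n. \<exists>u\<in>S. u \<odot>\<^bsub>Hom C ?X ?X\<^esub> alt_prod C ?X ?X \<tau> b n = \<zero>\<^bsub>Hom C ?X ?X\<^esub>" by blast
qed

end

text \<open>The chosen direct sums depend on \<open>C\<close> alone and not on the denominators, so
  the natural functor between two localisations merely reads f/s with a larger set of
  denominators.\<close>

lemma change_mat_lmor:
  assumes S: "localisation R S C" and T: "localisation R T C" and "S \<subseteq> T"
    and Xs: "set Xs \<subseteq> Obj C" "set Ys \<subseteq> Obj C" and f: "f \<in> carrier (Hom C (additive_category.D C Xs) (additive_category.D C Ys))" "s \<in> S"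
  shows "change_mat R T C Xs Ys (localisation.lmor R S C Xs Ys f s) = localisation.lmor R T C Xs Ys f s"
proof -
  interpret S: localisation R S C by (rule S)
  interpret T: localisation R T C by (rule T)
  have "tens_change R T (Hom C (Xs ! j) (Ys ! i)) (mfrac R S (Hom C (Xs ! j) (Ys ! i)) m s) = mfrac R T (Hom C (Xs ! j) (Ys ! i)) m s"
    if ij: "i < length Ys" "j < length Xs" and m: "m \<in> carrier (Hom C (Xs ! j) (Ys ! i))" for i j m
  proof (rule fraction_change.tens_change_mfrac[OF _ m f(2)])
    show "fraction_change R S T (Hom C (Xs ! j) (Ys ! i))"
      using ij Xs \<open>S \<subseteq> T\<close> S.Hom_fraction_module T.Hom_fraction_module
        S.fraction_setting_axioms T.fraction_setting_axioms
      by (simp add: fraction_change_def fraction_change_axioms_def)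
  qed
  then show ?thesis
    unfolding change_mat_def S.lmor_def T.lmor_def using Xs f by (intro cong_mat) auto
qed

section \<open>Localisations of a fully additive category\<close>

locale dedekind_additive_category = dedekind_category R C
  for R :: "('r, 'k) ring_scheme" (structure) and C :: "('o, 'r, 'm) mcat" +
  assumes fully_additive: "fully_additive C"
begin

sublocale additive_category R C
  by unfold_locales (use fully_additive in \<open>simp add: fully_additive_def\<close>)

lemma localisation_at:
  assumes "\<qq> \<in> max_spec R"
  shows "localisation R (carrier R - \<qq>) C"
  by unfold_locales
    (use compl_max_subset[OF assms] max_specD(3)[OF assms] max_spec_mult_notin[OF assms] in auto)

lemma localisation_Q: "localisation R (nonzeros R) C"
  by unfold_locales (use integral in auto)

text \<open>All powers of \<open>a\<close> are required in \<open>S\<close> because removing the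
  nilpotent error leaves a power with uncontrolled exponent.\<close>

lemma loc_iso_if_quasi_inverse:
  assumes A: "A \<in> Obj C" and B: "B \<in> Obj C" and qi: "quasi_inverse R C A B \<alpha> \<beta> a"
    and S: "S \<subseteq> carrier R" "\<And>n::nat. a [^] n \<in> S"
  shows "loc_iso R S C A B"
proof -
  obtain n g where "g \<in> carrier (Hom C B A)"
    "Comp C A B A g \<alpha> = a [^] (n::nat) \<odot>\<^bsub>Hom C A A\<^esub> Ident C A"
    "Comp C B A B \<alpha> g = a [^] n \<odot>\<^bsub>Hom C B B\<^esub> Ident C B"
    using quasi_inverse_exact[OF A B qi] by blast
  moreover have "\<alpha> \<in> carrier (Hom C A B)" using qi by (simp add: quasi_inverse_def)
  ultimately show ?thesis
    unfolding loc_iso_iff[OF S(1)] using A B S(2) by blast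
qed

lemma zero_in_nilrad: "A \<in> Obj C \<Longrightarrow> \<zero>\<^bsub>Hom C A A\<^esub> \<in> nilrad C A A"
  by (auto simp: nilrad_def intro!: exI[of _ 0])

text \<open>Backwards, the morphisms obtained by clearing denominators compose exactly to a scalar,
  so the errors are zero and zero lies in the nilradical.\<close>

lemma quasi_inverse_iff:
  assumes A: "A \<in> Obj C" and B: "B \<in> Obj C"
  shows "(\<exists>\<alpha> \<beta> a. quasi_inverse R C A B \<alpha> \<beta> a) \<longleftrightarrow> isomorphic (Q_cat R C) (Q_obj R C A) (Q_obj R C B)"
proof -
  interpret Q: localisation R "nonzeros R" C by (rule localisation_Q)
  note Q.S_closed [simp del]
  show ?thesis
    unfolding Q.isomorphic_loc_obj_iff[OF A B]
  proof
    assume "\<exists>\<alpha> \<beta> a. quasi_inverse R C A B \<alpha> \<beta> a"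
    then obtain \<alpha> \<beta> a where qi: "quasi_inverse R C A B \<alpha> \<beta> a" by blast
    then have "a \<in> nonzeros R" by (simp add: quasi_inverse_def)
    then show "loc_iso R (nonzeros R) C A B"
      by (intro loc_iso_if_quasi_inverse[OF A B qi] Q.S_pow) auto
  next
    assume "loc_iso R (nonzeros R) C A B"
    then obtain p i u where d: "p \<in> carrier (Hom C A B)" "i \<in> carrier (Hom C B A)" "u \<in> nonzeros R"
        "Comp C A B A i p = u \<odot>\<^bsub>Hom C A A\<^esub> Ident C A" "Comp C B A B p i = u \<odot>\<^bsub>Hom C B B\<^esub> Ident C B"
      unfolding loc_iso_iff[OF Diff_subset] by blast
    then have "quasi_inverse R C A B p i u"
      using A B zero_in_nilrad minus_eq_zero'[of A A "u \<odot>\<^bsub>Hom C A A\<^esub> Ident C A" "u \<odot>\<^bsub>Hom C A A\<^esub> Ident C A"]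
        minus_eq_zero'[of B B "u \<odot>\<^bsub>Hom C B B\<^esub> Ident C B" "u \<odot>\<^bsub>Hom C B B\<^esub> Ident C B"]
      by (simp add: quasi_inverse_def congruent_nil_def)
    then show "\<exists>\<alpha> \<beta> a. quasi_inverse R C A B \<alpha> \<beta> a" by blast
  qed
qed

text \<open>Since \<open>a\<close> is nonzero, the primes containing it are maximal; at every other
  maximal ideal a is invertible, so \<open>A\<close> and \<open>B\<close> agree there. This is the
  situation of \<open>glue_list\<close>.\<close>

lemma glue_quasi_inverse:
  fixes \<pp> :: "nat \<Rightarrow> 'r set"
  assumes A: "torsion_reduced R C A" and B: "torsion_reduced R C B" and qi: "quasi_inverse R C A B \<alpha> \<beta> a"
    and r: "1 \<le> r" "inj_on \<pp> {1..r}" "\<pp> ` {1..r} = {P. primeideal P R \<and> a \<in> P}"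
  shows "\<exists>A' :: nat \<Rightarrow> 'o.
    (\<forall>i\<in>{1..r}. torsion_reduced R C (A' i) \<and>
       isomorphic (at_cat R (\<pp> i) C) (at_obj R (\<pp> i) C (A' i)) (at_obj R (\<pp> i) C A) \<and>
       (\<forall>\<qq>\<in>max_spec R. \<qq> \<noteq> \<pp> i \<longrightarrow>
          isomorphic (at_cat R \<qq> C) (at_obj R \<qq> C (A' i)) (at_obj R \<qq> C B))) \<and>
    (\<exists>S T. direct_sum C (map A' [1..<Suc r]) S \<and>
           direct_sum C (A # replicate (r - 1) B) T \<and> isomorphic C S T)"
proof -
  have AO: "A \<in> Obj C" and BO: "B \<in> Obj C" using A B by (auto simp: torsion_reduced_def)
  have a: "a \<in> carrier R" "a \<noteq> \<zero>" using qi by (auto simp: quasi_inverse_def)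
  interpret Q: localisation R "nonzeros R" C by (rule localisation_Q)
  note Q.S_closed [simp del]
  \<comment> \<open>Lists are indexed from 0 and the family \<pp> from 1, which explains
    \<open>Suc i\<close> in \<open>nth_ps\<close> and the shift \<open>i - 1\<close> in the family
    of objects returned at the end.\<close>
  let ?ps = "map \<pp> [1..<Suc r]"
  have set_ps: "set ?ps = \<pp> ` {1..r}" by (simp add: atLeastLessThanSuc_atLeastAtMost del: upt_Suc)
  have nth_ps: "?ps ! i = \<pp> (Suc i)" if "i < r" for i using that by (simp del: upt_Suc)
  have "distinct ?ps"
    using r(2) by (simp add: distinct_map atLeastLessThanSuc_atLeastAtMost del: upt_Suc)
  moreover have "set ?ps \<subseteq> max_spec R"
  proof
    fix P assume "P \<in> set ?ps"
    then have "primeideal P R" "a \<in> P" unfolding set_ps r(3) by auto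
    then show "P \<in> max_spec R" using prime_maximal[of P] a by (auto simp: max_spec_def)
  qed
  moreover have "?ps \<noteq> []" using r(1) by simp
  moreover have "loc_iso R (nonzeros R) C B A"
    by (rule loc_iso_sym, rule loc_iso_if_quasi_inverse[OF AO BO qi]) (use a Q.S_pow in auto)
  moreover have "loc_iso R (carrier R - \<qq>) C A B" if q: "\<qq> \<in> max_spec R" "\<qq> \<notin> set ?ps" for \<qq>
  proof -
    have "a \<notin> \<qq>" using q max_specD(2)[OF q(1)] unfolding set_ps r(3) by auto
    then show ?thesis
      using max_spec_pow_notin[OF q(1) a(1)] a(1) by (intro loc_iso_if_quasi_inverse[OF AO BO qi]) auto
  qed
  ultimately obtain As where As: "length As = length ?ps \<and>
      (\<forall>i<length ?ps. torsion_reduced R C (As ! i) \<and> loc_iso R (carrier R - ?ps ! i) C (As ! i) A \<and>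
        (\<forall>\<qq>\<in>max_spec R. \<qq> \<noteq> ?ps ! i \<longrightarrow> loc_iso R (carrier R - \<qq>) C (As ! i) B)) \<and>
      (\<exists>S. direct_sum C As S \<and> direct_sum C (A # replicate (length ?ps - 1) B) S)"
    using glue_list[OF fully_additive B A, of ?ps] by blast
  have len: "length As = r" using As by (simp del: upt_Suc)
  have As': "torsion_reduced R C (As ! i)" "loc_iso R (carrier R - \<pp> (Suc i)) C (As ! i) A"
      "\<And>\<qq>. \<qq> \<in> max_spec R \<Longrightarrow> \<qq> \<noteq> \<pp> (Suc i) \<Longrightarrow> loc_iso R (carrier R - \<qq>) C (As ! i) B" if i: "i < r" for i
    using As i nth_ps[OF i] by (simp_all del: upt_Suc)
  obtain S where S: "direct_sum C As S" "direct_sum C (A # replicate (r - 1) B) S"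
    using As by (auto simp del: upt_Suc)
  have iso: "isomorphic (at_cat R \<qq> C) (at_obj R \<qq> C U) (at_obj R \<qq> C V)"
    if "\<qq> \<in> max_spec R" "loc_iso R (carrier R - \<qq>) C U V" for \<qq> U V
  proof -
    have "U \<in> Obj C" "V \<in> Obj C" using that(2) by (simp_all add: loc_retract_def)
    from localisation.isomorphic_loc_obj_iff[OF localisation_at[OF that(1)] this] show ?thesis
      using that(2) by blast
  qed
  have "map (\<lambda>i. As ! (i - 1)) [1..<Suc r] = As"
    using len by (intro nth_equalityI) (simp_all del: upt_Suc)
  moreover have "S \<in> Obj C" using S(1) by (simp add: direct_sum_def)
  ultimately have sum: "\<exists>S T. direct_sum C (map (\<lambda>i. As ! (i - 1)) [1..<Suc r]) S \<and>
      direct_sum C (A # replicate (r - 1) B) T \<and> isomorphic C S T"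
    using S isomorphic_refl[of S] by (intro exI[of _ S]) (simp del: upt_Suc)
  have "torsion_reduced R C (As ! (i - 1)) \<and>
       isomorphic (at_cat R (\<pp> i) C) (at_obj R (\<pp> i) C (As ! (i - 1))) (at_obj R (\<pp> i) C A) \<and>
       (\<forall>\<qq>\<in>max_spec R. \<qq> \<noteq> \<pp> i \<longrightarrow>
          isomorphic (at_cat R \<qq> C) (at_obj R \<qq> C (As ! (i - 1))) (at_obj R \<qq> C B))" if i: "i \<in> {1..r}" for i
  proof -
    have i': "i - 1 < r" "Suc (i - 1) = i" using i by auto
    have "\<pp> i \<in> max_spec R" using \<open>set ?ps \<subseteq> max_spec R\<close> i unfolding set_ps by auto
    then show ?thesis using As'[OF i'(1)] iso unfolding i'(2) by blast
  qed
  then show ?thesis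
    by (intro exI[of _ "\<lambda>i. As ! (i - 1)"] conjI[OF _ sum] ballI)
qed

text \<open>Each given local object is the image of some \<epsilon>/s. Its image under Q is the
  image of the same fraction, so the isomorphism with \<open>QB\<close> becomes retract data over
  \<open>nonzeros R\<close>, and local torsion reducedness becomes the condition \<open>nil\<close>
  of \<open>glue_family\<close>.\<close>

lemma glue_local_objects:
  fixes \<pp> :: "nat \<Rightarrow> 'r set" and A' :: "nat \<Rightarrow> ('o, 'r, 'm) lobj"
  assumes inj: "inj_on \<pp> {1..r}" and p: "\<pp> ` {1..r} \<subseteq> max_spec R"
    and A': "\<forall>i\<in>{1..r}. torsion_reduced (local_ring R (\<pp> i)) (at_cat R (\<pp> i) C) (A' i)"
    and B: "torsion_reduced R C B"
    and iso: "\<forall>i\<in>{1..r}. isomorphic (Q_cat R C) (Q_of_obj R C (A' i)) (Q_obj R C B)"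
  shows "\<exists>A. torsion_reduced R C A \<and>
    (\<forall>i\<in>{1..r}. isomorphic (at_cat R (\<pp> i) C) (at_obj R (\<pp> i) C A) (A' i)) \<and>
    (\<forall>\<qq>\<in>max_spec R. \<qq> \<notin> \<pp> ` {1..r} \<longrightarrow>
       isomorphic (at_cat R \<qq> C) (at_obj R \<qq> C A) (at_obj R \<qq> C B))"
proof -
  have BO: "B \<in> Obj C" using B by (simp add: torsion_reduced_def)
  interpret Q: localisation R "nonzeros R" C by (rule localisation_Q)
  note Q.S_closed [simp del]
  have data: "\<exists>\<epsilon> s. set (fst (A' i)) \<subseteq> Obj C \<and> \<epsilon> \<in> carrier (Hom C (D (fst (A' i))) (D (fst (A' i)))) \<and>
      s \<in> carrier R - \<pp> i \<and> snd (A' i) = localisation.lmor R (carrier R - \<pp> i) C (fst (A' i)) (fst (A' i)) \<epsilon> s \<and>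
      Comp C (D (fst (A' i))) (D (fst (A' i))) (D (fst (A' i))) \<epsilon> \<epsilon> = s \<odot>\<^bsub>Hom C (D (fst (A' i))) (D (fst (A' i)))\<^esub> \<epsilon>"
    if i: "i \<in> {1..r}" for i
  proof -
    have pi: "\<pp> i \<in> max_spec R" using p i by auto
    interpret P: localisation R "carrier R - \<pp> i" C by (rule localisation_at[OF pi])
    note P.S_closed [simp del]
    have "(fst (A' i), snd (A' i)) \<in> Obj P.LC"
      using A' i by (simp add: torsion_reduced_def)
    then show ?thesis by (rule P.LC_obj_cases) blast
  qed
  then obtain \<epsilon> s where e: "\<And>i. i \<in> {1..r} \<Longrightarrow> set (fst (A' i)) \<subseteq> Obj C"
      "\<And>i. i \<in> {1..r} \<Longrightarrow> \<epsilon> i \<in> carrier (Hom C (D (fst (A' i))) (D (fst (A' i))))"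
      "\<And>i. i \<in> {1..r} \<Longrightarrow> s i \<in> carrier R - \<pp> i"
      "\<And>i. i \<in> {1..r} \<Longrightarrow> snd (A' i) = localisation.lmor R (carrier R - \<pp> i) C (fst (A' i)) (fst (A' i)) (\<epsilon> i) (s i)"
      "\<And>i. i \<in> {1..r} \<Longrightarrow> Comp C (D (fst (A' i))) (D (fst (A' i))) (D (fst (A' i))) (\<epsilon> i) (\<epsilon> i) = s i \<odot>\<^bsub>Hom C (D (fst (A' i))) (D (fst (A' i)))\<^esub> \<epsilon> i"
    by metis
  have A'_eq: "A' i = (fst (A' i), localisation.lmor R (carrier R - \<pp> i) C (fst (A' i)) (fst (A' i)) (\<epsilon> i) (s i))"
    if "i \<in> {1..r}" for i
    using e(4)[OF that] by (simp add: prod_eq_iff)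
  have ret: "loc_retract R (nonzeros R) C B (D (fst (A' i))) (\<epsilon> i) (s i)" if i: "i \<in> {1..r}" for i
  proof -
    have pi: "\<pp> i \<in> max_spec R" using p i by auto
    have "change_mat R (nonzeros R) C (fst (A' i)) (fst (A' i)) (snd (A' i)) = Q.lmor (fst (A' i)) (fst (A' i)) (\<epsilon> i) (s i)"
      unfolding e(4)[OF i]
      by (rule change_mat_lmor[OF localisation_at[OF pi] localisation_Q compl_max_subset[OF pi] e(1)[OF i] e(1)[OF i] e(2)[OF i] e(3)[OF i]])
    then have "isomorphic Q.LC (fst (A' i), Q.lmor (fst (A' i)) (fst (A' i)) (\<epsilon> i) (s i)) (Q_obj R C B)"
      using bspec[OF iso i] by (simp add: change_obj_def)
    then show ?thesis
      using compl_max_subset[OF pi] e(3)[OF i]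
      by (intro Q.loc_retract_if_isomorphic[OF e(1)[OF i] e(2)[OF i] _ BO]) auto
  qed
  have nil: "loc_nil (carrier R - \<pp> i) (D (fst (A' i))) \<tau>"
    if i: "i \<in> {1..r}" and "\<tau> \<in> tors R C (D (fst (A' i))) (D (fst (A' i)))"
      "Comp C (D (fst (A' i))) (D (fst (A' i))) (D (fst (A' i))) (\<epsilon> i) \<tau> = s i \<odot>\<^bsub>Hom C (D (fst (A' i))) (D (fst (A' i)))\<^esub> \<tau>"
      "Comp C (D (fst (A' i))) (D (fst (A' i))) (D (fst (A' i))) \<tau> (\<epsilon> i) = s i \<odot>\<^bsub>Hom C (D (fst (A' i))) (D (fst (A' i)))\<^esub> \<tau>"
    for i \<tau>
  proof -
    have pi: "\<pp> i \<in> max_spec R" using p i by auto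
    interpret P: localisation R "carrier R - \<pp> i" C by (rule localisation_at[OF pi])
    note P.S_closed [simp del]
    have "torsion_reduced P.F P.LC (fst (A' i), P.lmor (fst (A' i)) (fst (A' i)) (\<epsilon> i) (s i))"
      using A' i A'_eq[OF i] by simp
    then show ?thesis
      by (rule P.loc_nil_if_torsion_reduced[OF e(1)[OF i] e(2)[OF i] e(3)[OF i] e(5)[OF i] _ that(2-4)])
  qed
  have "\<exists>A. torsion_reduced R C A \<and> loc_iso R (nonzeros R) C A B \<and>
    (\<forall>i\<in>{1..r}. loc_retract R (carrier R - \<pp> i) C A (D (fst (A' i))) (\<epsilon> i) (s i)) \<and>
    (\<forall>\<qq>\<in>max_spec R. \<qq> \<notin> \<pp> ` {1..r} \<longrightarrow> loc_iso R (carrier R - \<qq>) C A B)"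
  proof (rule glue_family[OF fully_additive B inj])
    fix i assume i: "i \<in> {1..r}"
    show "\<pp> i \<in> max_spec R" using p i by auto
    show "D (fst (A' i)) \<in> Obj C" using e(1)[OF i] by simp
    show "s i \<in> carrier R" "s i \<notin> \<pp> i" using e(3)[OF i] by auto
  qed (use e(2,5) ret nil in blast)+
  then obtain A where A: "torsion_reduced R C A"
      "\<forall>i\<in>{1..r}. loc_retract R (carrier R - \<pp> i) C A (D (fst (A' i))) (\<epsilon> i) (s i)"
      "\<forall>\<qq>\<in>max_spec R. \<qq> \<notin> \<pp> ` {1..r} \<longrightarrow> loc_iso R (carrier R - \<qq>) C A B"
    by (elim exE conjE)
  have AO: "A \<in> Obj C" using A(1) by (simp add: torsion_reduced_def)
  have "isomorphic (at_cat R (\<pp> i) C) (at_obj R (\<pp> i) C A) (A' i)" if i: "i \<in> {1..r}" for i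
  proof -
    have pi: "\<pp> i \<in> max_spec R" using p i by auto
    interpret P: localisation R "carrier R - \<pp> i" C by (rule localisation_at[OF pi])
    note P.S_closed [simp del]
    show ?thesis
      unfolding A'_eq[OF i, THEN arg_cong[where f = "isomorphic P.LC (loc_obj R (carrier R - \<pp> i) C A)"]]
      by (rule P.isomorphic_if_loc_retract[OF e(1)[OF i] e(2)[OF i] e(3)[OF i] e(5)[OF i] bspec[OF A(2) i]])
  qed
  moreover have "isomorphic (at_cat R \<qq> C) (at_obj R \<qq> C A) (at_obj R \<qq> C B)"
    if q: "\<qq> \<in> max_spec R" "\<qq> \<notin> \<pp> ` {1..r}" for \<qq>
    using localisation.isomorphic_loc_obj_iff[OF localisation_at[OF q(1)] AO BO] A(3) q by blast
  ultimately show ?thesis using A(1) by blast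
qed

text \<open>If \<beta> is b/s, equality with \<alpha> after passing to Q means that a nonzero scalar
  kills b - s \<alpha>. Torsion freeness gives b = s \<alpha>, and then b/s is \<alpha>/1 already
  over the localisation at \<pp>.\<close>

lemma glue_local_morphisms:
  assumes tf: "torsion_free R C" and A: "A \<in> Obj C" and B: "B \<in> Obj C" and \<alpha>: "\<alpha> \<in> carrier (Hom C A B)"
    and p: "\<pp> \<in> max_spec R" and \<beta>: "\<beta> \<in> carrier (Hom (at_cat R \<pp> C) (at_obj R \<pp> C A) (at_obj R \<pp> C B))"
    and eq: "Q_of_mor R C (at_obj R \<pp> C A) (at_obj R \<pp> C B) \<beta> = Q_mor R C A B \<alpha>"
  shows "at_mor R \<pp> C A B \<alpha> = \<beta>"
proof -
  interpret Q: localisation R "nonzeros R" C by (rule localisation_Q)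
  note Q.S_closed [simp del]
  interpret P: localisation R "carrier R - \<pp>" C by (rule localisation_at[OF p])
  note P.S_closed [simp del]
  have ob: "set [A] \<subseteq> Obj C" "set [B] \<subseteq> Obj C" using A B by simp_all
  have "\<beta> \<in> carrier (Hom P.H [A] [B])"
    using \<beta> unfolding P.loc_obj_eq[OF A] P.loc_obj_eq[OF B] P.LC_simps by simp
  then obtain b s where b: "b \<in> carrier (Hom C A B)" "s \<in> carrier R - \<pp>" "\<beta> = P.lmor [A] [B] b s"
    using P.lmor_cases[OF ob] A B by (metis D_single)
  have b': "b \<in> carrier (Hom C (D [A]) (D [B]))" "\<alpha> \<in> carrier (Hom C (D [A]) (D [B]))"
    using A B b(1) \<alpha> by simp_all
  have s: "s \<in> nonzeros R" by (rule subsetD[OF compl_max_subset[OF p] b(2)])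
  have "Q_of_mor R C (at_obj R \<pp> C A) (at_obj R \<pp> C B) \<beta> = change_mat R (nonzeros R) C [A] [B] \<beta>"
    by (simp add: change_mor_def P.loc_obj_eq[OF A] P.loc_obj_eq[OF B])
  also have "\<dots> = Q.lmor [A] [B] b s"
    unfolding b(3)
    by (rule change_mat_lmor[OF localisation_at[OF p] localisation_Q compl_max_subset[OF p] ob b'(1) b(2)])
  finally have "Q.lmor [A] [B] b s = Q.lmor [A] [B] \<alpha> \<one>"
    using eq Q.loc_mor_eq[OF A B \<alpha>] by simp
  then obtain u where u: "u \<in> nonzeros R" "u \<odot>\<^bsub>Hom C A B\<^esub> b = u \<odot>\<^bsub>Hom C A B\<^esub> (s \<odot>\<^bsub>Hom C A B\<^esub> \<alpha>)"
    unfolding Q.lmor_eq_iff[OF ob b'(1) s b'(2) Q.one_in_S] D_single[OF A] D_single[OF B]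
      smult_one'[OF A B b(1)] by blast
  have uR: "u \<in> carrier R" and sR: "s \<in> carrier R" using u(1) s by simp_all
  let ?d = "b \<ominus>\<^bsub>Hom C A B\<^esub> (s \<odot>\<^bsub>Hom C A B\<^esub> \<alpha>)"
  have d: "?d \<in> carrier (Hom C A B)" using A B b(1) sR \<alpha> by simp
  have "u \<odot>\<^bsub>Hom C A B\<^esub> ?d = \<zero>\<^bsub>Hom C A B\<^esub>"
    using u(2) uR sR A B b(1) \<alpha> by (simp add: smult_diff_zero_iff)
  then have "?d \<in> tors R C A B" using d u(1) unfolding tors_def by blast
  moreover have "tors R C A B = {\<zero>\<^bsub>Hom C A B\<^esub>}" using tf A B by (simp add: torsion_free_def)
  ultimately have "?d = \<zero>\<^bsub>Hom C A B\<^esub>" by simp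
  then have "b = s \<odot>\<^bsub>Hom C A B\<^esub> \<alpha>"
    using A B b(1) sR \<alpha> by (simp add: minus_eq_zero')
  then have "P.lmor [A] [B] \<alpha> \<one> = P.lmor [A] [B] b s"
    using A B sR \<alpha> by (intro P.lmor_eqI[OF ob b'(2) P.one_in_S b'(1) b(2)]) simp
  then show ?thesis unfolding b(3) P.loc_mor_eq[OF A B \<alpha>] .
qed

end

theorem theorem2p5:
  fixes R :: "('r, 'k) ring_scheme" and C :: "('o, 'r, 'm) mcat"
  assumes "dedekind_domain R" and "r_category R C" and "fully_additive C" and "hom_finite R C"
  shows
    \<comment> \<open>(1)\<close>
    "(\<forall>A B \<alpha> \<beta> a. \<forall>r. \<forall>\<pp> :: nat \<Rightarrow> 'r set.
        torsion_reduced R C A \<and> torsion_reduced R C B \<and> quasi_inverse R C A B \<alpha> \<beta> a \<and>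
        1 \<le> r \<and> inj_on \<pp> {1..r} \<and> \<pp> ` {1..r} = {P. primeideal P R \<and> a \<in> P}
        \<longrightarrow> (\<exists>A' :: nat \<Rightarrow> 'o.
              (\<forall>i\<in>{1..r}. torsion_reduced R C (A' i) \<and>
                 isomorphic (at_cat R (\<pp> i) C) (at_obj R (\<pp> i) C (A' i)) (at_obj R (\<pp> i) C A) \<and>
                 (\<forall>\<qq>\<in>max_spec R. \<qq> \<noteq> \<pp> i \<longrightarrow>
                    isomorphic (at_cat R \<qq> C) (at_obj R \<qq> C (A' i)) (at_obj R \<qq> C B))) \<and>
              (\<exists>S T. direct_sum C (map A' [1..<Suc r]) S \<and>
                     direct_sum C (A # replicate (r - 1) B) T \<and> isomorphic C S T)))
     \<and> (\<forall>A B. torsion_reduced R C A \<and> torsion_reduced R C B \<longrightarrow>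
          ((\<exists>\<alpha> \<beta> a. quasi_inverse R C A B \<alpha> \<beta> a) \<longleftrightarrow>
             isomorphic (Q_cat R C) (Q_obj R C A) (Q_obj R C B)))
     \<and> \<comment> \<open>(2)\<close>
       (\<forall>r. \<forall>\<pp> :: nat \<Rightarrow> 'r set. \<forall>A' :: nat \<Rightarrow> ('o, 'r, 'm) lobj. \<forall>B.
          inj_on \<pp> {1..r} \<and> \<pp> ` {1..r} \<subseteq> max_spec R \<and>
          (\<forall>i\<in>{1..r}. torsion_reduced (local_ring R (\<pp> i)) (at_cat R (\<pp> i) C) (A' i)) \<and>
          torsion_reduced R C B \<and>
          (\<forall>i\<in>{1..r}. isomorphic (Q_cat R C) (Q_of_obj R C (A' i)) (Q_obj R C B))
          \<longrightarrow> (\<exists>A. torsion_reduced R C A \<and>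
                (\<forall>i\<in>{1..r}. isomorphic (at_cat R (\<pp> i) C) (at_obj R (\<pp> i) C A) (A' i)) \<and>
                (\<forall>\<qq>\<in>max_spec R. \<qq> \<notin> \<pp> ` {1..r} \<longrightarrow>
                   isomorphic (at_cat R \<qq> C) (at_obj R \<qq> C A) (at_obj R \<qq> C B))))
     \<and> \<comment> \<open>(3)\<close>
       (torsion_free R C \<longrightarrow>
        (\<forall>r. \<forall>\<pp> :: nat \<Rightarrow> 'r set. \<forall>A\<in>Obj C. \<forall>B\<in>Obj C. \<forall>\<alpha>\<in>carrier (Hom C A B).
         \<forall>\<beta>' :: nat \<Rightarrow> ('r, 'm) lmor.
          inj_on \<pp> {1..r} \<and> \<pp> ` {1..r} \<subseteq> max_spec R \<and>
          (\<forall>i\<in>{1..r}.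
             \<beta>' i \<in> carrier (Hom (at_cat R (\<pp> i) C) (at_obj R (\<pp> i) C A) (at_obj R (\<pp> i) C B)) \<and>
             Q_of_mor R C (at_obj R (\<pp> i) C A) (at_obj R (\<pp> i) C B) (\<beta>' i) = Q_mor R C A B \<alpha>)
          \<longrightarrow> (\<exists>\<beta>\<in>carrier (Hom C A B).
                (\<forall>i\<in>{1..r}. at_mor R (\<pp> i) C A B \<beta> = \<beta>' i) \<and>
                (\<forall>\<qq>\<in>max_spec R. \<qq> \<notin> \<pp> ` {1..r} \<longrightarrow>
                   at_mor R \<qq> C A B \<beta> = at_mor R \<qq> C A B \<alpha>))))"
proof -
  interpret dedekind_domain R by (rule assms(1))
  interpret cat: r_category R C by (rule assms(2))
  interpret dedekind_additive_category R C by unfold_locales (rule assms(3))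
  show ?thesis
  proof (rule conjI[OF _ conjI[OF _ conjI]], goal_cases)
    case 1
    show ?case
      by (intro allI impI; elim conjE; rule glue_quasi_inverse; assumption)
  next
    case 2
    show ?case
      by (intro allI impI; elim conjE; rule quasi_inverse_iff; simp add: torsion_reduced_def)
  next
    case 3
    show ?case
      by (intro allI impI; elim conjE; rule glue_local_objects; assumption)
  next
    case 4
    show ?case
    proof (intro impI allI ballI)
      fix r and \<pp> :: "nat \<Rightarrow> 'r set" and A B \<alpha> and \<beta>' :: "nat \<Rightarrow> ('r, 'm) lmor"
      assume tf: "torsion_free R C" and AB: "A \<in> Obj C" "B \<in> Obj C" "\<alpha> \<in> carrier (Hom C A B)"
        and h: "inj_on \<pp> {1..r} \<and> \<pp> ` {1..r} \<subseteq> max_spec R \<and>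
          (\<forall>i\<in>{1..r}.
             \<beta>' i \<in> carrier (Hom (at_cat R (\<pp> i) C) (at_obj R (\<pp> i) C A) (at_obj R (\<pp> i) C B)) \<and>
             Q_of_mor R C (at_obj R (\<pp> i) C A) (at_obj R (\<pp> i) C B) (\<beta>' i) = Q_mor R C A B \<alpha>)"
      \<comment> \<open>Every prescribed local morphism is the localisation of \<alpha>, so \<alpha>
        itself is the global morphism asked for.\<close>
      have "at_mor R (\<pp> i) C A B \<alpha> = \<beta>' i" if i: "i \<in> {1..r}" for i
        by (rule glue_local_morphisms[OF tf AB]) (use h i in auto)
      then show "\<exists>\<beta>\<in>carrier (Hom C A B).
                (\<forall>i\<in>{1..r}. at_mor R (\<pp> i) C A B \<beta> = \<beta>' i) \<and>
                (\<forall>\<qq>\<in>max_spec R. \<qq> \<notin> \<pp> ` {1..r} \<longrightarrow>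
                   at_mor R \<qq> C A B \<beta> = at_mor R \<qq> C A B \<alpha>)"
        using AB(3) by (intro bexI[of _ \<alpha>]) auto
    qed
  qed
qed

end
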